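(* Let $H(x,y)=\Phi(x)+\Psi(y)$ be as in the context, with $\Psi(y)=e\,y^{2m}+o(y^{2m})$, $e>0$. Let $f_0,f_1,\ldots,f_{n-1}$ be analytic functions on $(x_\ell,x_r)$ and let $g$ be an analytic function on $(y_\ell,y_r)$. Consider the Abelian integrals $$I_i(h)=\int_{\gamma_h}f_i(x)g(y)\,dx,\qquad i=0,1,\ldots,n-1,$$ where, for each $h\in(0,h_0)$, $\gamma_h$ is the oval surrounding the origin inside the level curve $\{\Phi(x)+\Psi(y)=h\}$. Let $\sigma_1$ and $\sigma_2$ be the involutions associated to $\Phi$ and $\Psi$, respectively. Set $g_0=g$ and define $g_{i+1}=\frac{g_i'}{\Psi'}$. Then $(I_0,I_1,\ldots,I_{n-1})$ is an ECT-system on $(0,h_0)$ if the following hypotheses are satisfied: (a) $\Bigl(\mathscr B_{\sigma_1}\bigl(\tfrac{f_0}{\Phi'}\bigr),\mathscr B_{\sigma_1}\bigl(\tfrac{f_1}{\Phi'}\bigr),\ldots,\mathscr B_{\sigma_1}\bigl(\tfrac{f_{n-1}}{\Phi'}\bigr)\Bigr)$ is a CT-system on $(0,x_r)$, and (b) $\bigl(\mathscr B_{\sigma_2}(g_0),\mathscr B_{\sigma_2}(g_1),\ldots,\mathscr B_{\sigma_2}(g_{n-1})\bigr)$ is a CT-system on $(0,y_r)$ and $\mathscr B_{\sigma_2}(g_0)(y)=o\bigl(y^{2m(n-2)}\bigr)$ as $y\to 0$.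
   Context: Setting. $H$ is a real analytic function on an open subset of the plane having a local minimum at the origin, with $H(0,0)=0$, and here $H(x,y)=\Phi(x)+\Psi(y)$ with $\Phi(0)=\Psi(0)=0$. A punctured neighbourhood $\mathcal P$ of the origin (the period annulus) is foliated by ovals (closed curves surrounding the origin) $\gamma_h\subset\{H(x,y)=h\}$, parameterized by the energy levels $h\in(0,h_0)$ for some $h_0\in(0,+\infty]$. The projections of $\mathcal P$ on the $x$-axis and on the $y$-axis are denoted $(x_\ell,x_r)$ and $(y_\ell,y_r)$. In this situation $x\Phi'(x)>0$ for all $x\in(x_\ell,x_r)\setminus\{0\}$ and $y\Psi'(y)>0$ for all $y\in(y_\ell,y_r)\setminus\{0\}$; $\Phi$ and $\Psi$ have even multiplicity at $0$, and $2m$ denotes the multiplicity of $\Psi$ at $0$. Involutions. A map $\sigma$ is an involution if $\sigma\circ\sigma=Id$ and $\sigma\neq Id$. The involution associated to $\Phi$ is the analytic involution $\sigma_1$ of $(x_\ell,x_r)$ with $\Phi(x)=\Phi(\sigma_1(x))$ for all $x\in(x_\ell,x_r)$; the involution associated to $\Psi$ is the analytic involution $\sigma_2$ of $(y_\ell,y_r)$ with $\Psi(y)=\Psi(\sigma_2(y))$ for all $y\in(y_\ell,y_r)$. Both fix $0$. Balance. For a function $\kappa$ and an involution $\sigma$, $\mathscr B_\sigma(\kappa)(x)=\kappa(x)-\kappa(\sigma(x))$. Chebyshev systems. Let $f_0,\ldots,f_{n-1}$ be analytic functions on an open interval $L$. $(f_0,\ldots,f_{n-1})$ is a T-system on $L$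 if any nontrivial linear combination $\alpha_0f_0+\cdots+\alpha_{n-1}f_{n-1}$ has at most $n-1$ isolated zeros on $L$. It is a CT-system on $L$ if $(f_0,\ldots,f_{k-1})$ is a T-system on $L$ for all $k=1,\ldots,n$. It is an ECT-system on $L$ if, for all $k=1,\ldots,n$, any nontrivial linear combination $\alpha_0f_0+\cdots+\alpha_{k-1}f_{k-1}$ has at most $k-1$ isolated zeros on $L$ counted with multiplicities. As usual, in T-, CT- and ECT-systems a linear combination with coefficients not all zero is understood not to vanish identically, so that: CT-system on $L$ is equivalent to $\det(f_j(x_i))_{0\le i,j\le k-1}\neq0$ for all $k=1,\ldots,n$ and all pairwise distinct $x_0,\ldots,x_{k-1}\in L$; and ECT-system on $L$ is equivalent to the Wronskian $\det(f_j^{(i)}(x))_{0\le i,j\le k-1}\neq 0$ for all $k=1,\ldots,n$ and all $x\in L$. *)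

theory Defs
  imports
    "HOL-Complex_Analysis.Complex_Analysis"
    "HOL-Library.Landau_Symbols"
begin

definition real_analytic_on :: "(real \<Rightarrow> real) \<Rightarrow> real set \<Rightarrow> bool"
    (infixl \<open>real'_analytic'_on\<close> 50) where
  "f real_analytic_on S \<longleftrightarrow>
     (\<forall>x\<in>S. \<exists>r>0. \<exists>a. \<forall>y. \<bar>y - x\<bar> < r \<longrightarrow> (\<lambda>k. a k * (y - x) ^ k) sums f y)"

subsection \<open>Chebyshev systems\<close>

definition lincomb :: "nat \<Rightarrow> (nat \<Rightarrow> real) \<Rightarrow> (nat \<Rightarrow> real \<Rightarrow> real) \<Rightarrow> real \<Rightarrow> real" where
  "lincomb n \<alpha> f x = (\<Sum>i<n. \<alpha> i * f i x)"

definition isolated_zeros :: "(real \<Rightarrow> real) \<Rightarrow> real set \<Rightarrow> real set" where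
  "isolated_zeros f L = {x\<in>L. f x = 0 \<and> eventually (\<lambda>y. f y \<noteq> 0) (at x)}"

text \<open>
  Order of vanishing. It is only used at isolated zeros of analytic functions, where some
  derivative is nonzero.
\<close>
definition zero_multiplicity :: "(real \<Rightarrow> real) \<Rightarrow> real \<Rightarrow> nat" where
  "zero_multiplicity f x = (LEAST k. (deriv ^^ k) f x \<noteq> 0)"

text \<open>
  In all three notions only \<open>f 0, \<dots>, f (n - 1)\<close> matter, \<open>L\<close> is meant to be an open interval, and
  linear combinations with coefficients not all zero are required not to vanish identically
  on \<open>L\<close>.
\<close>
definition T_system :: "nat \<Rightarrow> (nat \<Rightarrow> real \<Rightarrow> real) \<Rightarrow> real set \<Rightarrow> bool" where
  "T_system n f L \<longleftrightarrow>
     (\<forall>i<n. f i real_analytic_on L) \<and>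
     (\<forall>\<alpha>. (\<exists>i<n. \<alpha> i \<noteq> 0) \<longrightarrow>
        (\<exists>x\<in>L. lincomb n \<alpha> f x \<noteq> 0) \<and>
        finite (isolated_zeros (lincomb n \<alpha> f) L) \<and>
        card (isolated_zeros (lincomb n \<alpha> f) L) \<le> n - 1)"

definition CT_system :: "nat \<Rightarrow> (nat \<Rightarrow> real \<Rightarrow> real) \<Rightarrow> real set \<Rightarrow> bool" where
  "CT_system n f L \<longleftrightarrow> (\<forall>k\<in>{1..n}. T_system k f L)"

definition ECT_system :: "nat \<Rightarrow> (nat \<Rightarrow> real \<Rightarrow> real) \<Rightarrow> real set \<Rightarrow> bool" where
  "ECT_system n f L \<longleftrightarrow>
     (\<forall>i<n. f i real_analytic_on L) \<and>
     (\<forall>k\<in>{1..n}. \<forall>\<alpha>. (\<exists>i<k. \<alpha> i \<noteq> 0) \<longrightarrow>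
        (\<exists>x\<in>L. lincomb k \<alpha> f x \<noteq> 0) \<and>
        finite (isolated_zeros (lincomb k \<alpha> f) L) \<and>
        (\<Sum>x\<in>isolated_zeros (lincomb k \<alpha> f) L. zero_multiplicity (lincomb k \<alpha> f) x) \<le> k - 1)"

subsection \<open>Involutions and balance\<close>

definition involution_on :: "(real \<Rightarrow> real) \<Rightarrow> real set \<Rightarrow> bool" where
  "involution_on \<sigma> S \<longleftrightarrow>
     \<sigma> ` S \<subseteq> S \<and> (\<forall>x\<in>S. \<sigma> (\<sigma> x) = x) \<and> (\<exists>x\<in>S. \<sigma> x \<noteq> x)"

definition associated_involution :: "(real \<Rightarrow> real) \<Rightarrow> real set \<Rightarrow> (real \<Rightarrow> real) \<Rightarrow> bool" where
  "associated_involution \<Phi> S \<sigma> \<longleftrightarrow>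
     \<sigma> real_analytic_on S \<and> involution_on \<sigma> S \<and> (\<forall>x\<in>S. \<Phi> x = \<Phi> (\<sigma> x))"

definition balance :: "(real \<Rightarrow> real) \<Rightarrow> (real \<Rightarrow> real) \<Rightarrow> real \<Rightarrow> real" where
  "balance \<sigma> \<kappa> x = \<kappa> x - \<kappa> (\<sigma> x)"

subsection \<open>Ovals and Abelian integrals\<close>

text \<open>
  The plane is identified with the complex numbers, \<open>(x, y)\<close> being \<open>Complex x y\<close>.
  An oval is given by a piecewise continuously differentiable parameterization \<open>c\<close> on \<open>[0, 1]\<close>.
\<close>
definition oval :: "(complex \<Rightarrow> real) \<Rightarrow> real \<Rightarrow> (real \<Rightarrow> complex) \<Rightarrow> bool" where
  "oval H h c \<longleftrightarrow>
     valid_path c \<and> simple_path c \<and> pathfinish c = pathstart c \<and>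
     0 \<in> inside (path_image c) \<and> path_image c \<subseteq> {z. H z = h}"

text \<open>
  \<open>P\<close> is a punctured neighbourhood of the origin foliated by the ovals \<open>\<gamma> h\<close>, \<open>0 < h < h0\<close>.
  The ovals are all oriented in the same way; whether this is counterclockwise (\<open>s = 1\<close>) or
  clockwise (\<open>s = -1\<close>) is left open.
\<close>
definition period_annulus ::
    "(complex \<Rightarrow> real) \<Rightarrow> ereal \<Rightarrow> (real \<Rightarrow> real \<Rightarrow> complex) \<Rightarrow> complex set \<Rightarrow> bool" where
  "period_annulus H h0 \<gamma> P \<longleftrightarrow>
     0 \<notin> P \<and> open (insert 0 P) \<and>
     (\<forall>h\<in>einterval 0 h0. oval H h (\<gamma> h)) \<and>
     P = (\<Union>h\<in>einterval 0 h0. path_image (\<gamma> h)) \<and>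
     (\<exists>s\<in>{1, -1}. \<forall>h\<in>einterval 0 h0. winding_number (\<gamma> h) 0 = s)"

text \<open>The line integral of the differential form \<open>F(x, y) dx\<close> along \<open>c\<close>.\<close>
definition line_integral_dx :: "(real \<Rightarrow> real \<Rightarrow> real) \<Rightarrow> (real \<Rightarrow> complex) \<Rightarrow> real" where
  "line_integral_dx F c =
     integral {0..1} (\<lambda>t. F (Re (c t)) (Im (c t)) * Re (vector_derivative c (at t within {0..1})))"

definition abelian_integral ::
    "(real \<Rightarrow> real \<Rightarrow> complex) \<Rightarrow> (real \<Rightarrow> real) \<Rightarrow> (real \<Rightarrow> real) \<Rightarrow> real \<Rightarrow> real" where
  "abelian_integral \<gamma> f g h = line_integral_dx (\<lambda>x y. f x * g y) (\<gamma> h)"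

text \<open>
  The functions \<open>g\<^sub>i\<close>. For \<open>i > 0\<close> the value at the critical point \<open>0\<close> of \<open>\<Psi>\<close> is an artefact of
  totalised division; it does not influence the values elsewhere.
\<close>
primrec g_seq :: "(real \<Rightarrow> real) \<Rightarrow> (real \<Rightarrow> real) \<Rightarrow> nat \<Rightarrow> real \<Rightarrow> real" where
  "g_seq \<Psi> g 0 = g"
| "g_seq \<Psi> g (Suc i) = (\<lambda>y. deriv (g_seq \<Psi> g i) y / deriv \<Psi> y)"

end

theory Submission
  imports Defs
begin

text \<open>
  The idea is to use the energy as the variable. Let \<open>X\<close> and \<open>Y\<close> be the inverses of \<open>\<Phi>\<close> and \<open>\<Psi>\<close>
  on the positive half axes, both defined on \<open>(0, h\<^sub>0)\<close>, and put
  \<open>F\<^sub>i = balance \<sigma>1 (f\<^sub>i / \<Phi>') \<circ> X\<close> and \<open>K\<^sub>j = balance \<sigma>2 g\<^sub>j \<circ> Y\<close>.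
  Pairing the two points of the oval above each \<open>x\<close>, and then the two points \<open>x\<close> and \<open>\<sigma>1 x\<close> of equal
  potential, turns the Abelian integral into a convolution: up to a constant sign given by the
  orientation, \<open>I\<^sub>i(h)\<close> is the integral of \<open>F\<^sub>i(t) K\<^sub>0(h - t)\<close> over \<open>0 < t < h\<close>
  (\<open>oval_integral_eq_convolution\<close>).

  The operation \<open>g' / \<Psi>'\<close> is differentiation with respect to the energy, so \<open>K\<^sub>j\<^sub>+\<^sub>1\<close> is the derivative
  of \<open>K\<^sub>j\<close>. The order condition in (b) implies that \<open>K\<^sub>0, \<dots>, K\<^sub>n\<^sub>-\<^sub>2\<close> tend to \<open>0\<close> at energy \<open>0\<close>. Hence no
  boundary terms appear when the convolution is differentiated, and the \<open>j\<close>-th derivative of \<open>I\<^sub>i\<close>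
  is the convolution of \<open>F\<^sub>i\<close> with \<open>K\<^sub>j\<close> for \<open>j < n\<close> (\<open>deriv_convolution\<close>).

  Suppose that a nontrivial combination of \<open>I\<^sub>0, \<dots>, I\<^sub>k\<^sub>-\<^sub>1\<close> vanishes at \<open>h\<close> together with its first
  \<open>k - 1\<close> derivatives. The corresponding combination \<open>F\<close> of the \<open>F\<^sub>i\<close> is then orthogonal on \<open>(0, h)\<close> to
  \<open>K\<^sub>j(h - t)\<close> for all \<open>j < k\<close>. By (a), \<open>F\<close> has at most \<open>k - 1\<close> sign changes; by (b), some combination
  of the \<open>K\<^sub>j(h - t)\<close> changes sign at exactly the same points. The product of the two has constant
  sign, so its integral is not \<open>0\<close>, a contradiction (\<open>haar_systems_not_orthogonal\<close>). In other words,
  the Wronskians of the \<open>I\<^sub>i\<close> have no zeros. The bound on the number of zeros with multiplicities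
  follows by dividing by the first function, differentiating and applying Rolle's theorem
  (\<open>nondegenerate_jets_zero_count\<close>).

  Two points need separate care. The functions \<open>F\<^sub>i\<close> and \<open>K\<^sub>j\<close> are analytic on \<open>(0, h\<^sub>0)\<close> but may be
  unbounded at \<open>0\<close>. The analyticity of the convolution is obtained by cutting the interval
  \<open>[0, h]\<close> into three pieces and replacing, on the outer pieces, the singular factor by a continuous
  primitive. Moreover, the ovals come with arbitrary piecewise smooth parameterizations.
  On the level curve, however, \<open>f(x) g(y) dx\<close> is a constant multiple of the angular form plus
  an exact form, so only the winding number matters (\<open>oval_integral\<close>).
\<close>

section \<open>Real analytic functions through holomorphic extensions\<close>

text \<open>A real power series converges on the complex disc with the same radius.\<close>

lemma real_analytic_onD:
  assumes "f real_analytic_on S" "x \<in> S"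
  obtains r F where "r > 0" "F holomorphic_on ball (complex_of_real x) r"
    "\<And>y. \<bar>y - x\<bar> < r \<Longrightarrow> F (of_real y) = of_real (f y)"
proof -
  obtain r a where r: "r > 0" and
    a: "\<And>y. \<bar>y - x\<bar> < r \<Longrightarrow> (\<lambda>k. a k * (y - x) ^ k) sums f y"
    using assms unfolding real_analytic_on_def by blast
  define F where "F z = (\<Sum>k. complex_of_real (a k) * (z - of_real x) ^ k)" for z
  have "(\<lambda>k. complex_of_real (a k) * (z - of_real x) ^ k) sums F z"
    if "z \<in> ball (of_real x) r" for z
  proof -
    from that have "cmod (z - of_real x) < r"
      by (simp add: dist_norm norm_minus_commute)
    then obtain s where s: "cmod (z - of_real x) < s" "s < r"
      using dense by blast
    have s0: "s > 0"
      using s(1) norm_ge_zero[of "z - of_real x"] by linarith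
    have "(\<lambda>k. a k * s ^ k) sums f (x + s)"
      using a[of "x + s"] s(2) s0 by simp
    hence "summable (\<lambda>k. complex_of_real (a k * s ^ k))"
      using summable_of_real sums_summable by blast
    hence "summable (\<lambda>k. complex_of_real (a k) * of_real s ^ k)"
      by simp
    moreover have "cmod (z - of_real x) < cmod (of_real s)"
      using s s0 by simp
    ultimately have "summable (\<lambda>k. complex_of_real (a k) * (z - of_real x) ^ k)"
      by (rule powser_inside)
    thus ?thesis
      unfolding F_def by (rule summable_sums)
  qed
  hence "F holomorphic_on ball (of_real x) r"
    by (rule power_series_holomorphic)
  moreover have "F (of_real y) = of_real (f y)" if "\<bar>y - x\<bar> < r" for y
  proof -
    have "(\<lambda>k. complex_of_real (a k * (y - x) ^ k)) sums of_real (f y)"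
      using a[OF that] by (simp only: sums_of_real_iff)
    thus ?thesis
      by (simp add: F_def sums_iff)
  qed
  ultimately show ?thesis
    using r that by blast
qed

text \<open>Through this characterization the closure properties of real analytic functions are
  inherited from holomorphic functions.\<close>

lemma real_analytic_on_iff_complex:
  "f real_analytic_on S \<longleftrightarrow>
     (\<forall>x\<in>S. \<exists>F. F analytic_on {of_real x} \<and>
        (\<forall>\<^sub>F y in nhds x. F (of_real y) = complex_of_real (f y)))"
proof safe
  fix x assume f: "f real_analytic_on S" and x: "x \<in> S"
  obtain r F where r: "r > 0" "F holomorphic_on ball (complex_of_real x) r"
    "\<And>y. \<bar>y - x\<bar> < r \<Longrightarrow> F (of_real y) = of_real (f y)"
    using real_analytic_onD[OF f x] by metis
  have "F analytic_on {of_real x}"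
    using r analytic_at by (metis centre_in_ball open_ball)
  moreover have "\<forall>\<^sub>F y in nhds x. F (of_real y) = complex_of_real (f y)"
    unfolding eventually_nhds_metric using r by (auto simp: dist_real_def)
  ultimately show "\<exists>F. F analytic_on {of_real x} \<and>
        (\<forall>\<^sub>F y in nhds x. F (of_real y) = complex_of_real (f y))" by blast
next
  assume *: "\<forall>x\<in>S. \<exists>F. F analytic_on {of_real x} \<and>
        (\<forall>\<^sub>F y in nhds x. F (of_real y) = complex_of_real (f y))"
  show "f real_analytic_on S"
    unfolding real_analytic_on_def
  proof
    fix x assume "x \<in> S"
    then obtain F where F: "F analytic_on {of_real x}"
        "\<forall>\<^sub>F y in nhds x. F (of_real y) = complex_of_real (f y)"
      using * by blast
    obtain r1 where r1: "r1 > 0" "F holomorphic_on ball (of_real x) r1"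
      using F(1) by (auto simp: analytic_on_def)
    obtain r2 where r2: "r2 > 0" "\<And>y. \<bar>y - x\<bar> < r2 \<Longrightarrow> F (of_real y) = of_real (f y)"
      using F(2) unfolding eventually_nhds_metric by (auto simp: dist_real_def)
    define r where "r = min r1 r2"
    define c where "c k = (deriv ^^ k) F (of_real x) / fact k" for k
    have sums: "(\<lambda>k. Re (c k) * (y - x) ^ k) sums f y" if y: "\<bar>y - x\<bar> < r" for y
    proof -
      have "cmod (of_real x - of_real y) = \<bar>y - x\<bar>"
        by (metis abs_minus_commute norm_of_real of_real_diff)
      hence "of_real y \<in> ball (complex_of_real x) r1"
        using y by (simp add: r_def dist_norm)
      hence "(\<lambda>k. c k * (of_real y - of_real x) ^ k) sums F (of_real y)"
        unfolding c_def by (rule holomorphic_power_series[OF r1(2)])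
      hence "(\<lambda>k. Re (c k * (of_real y - of_real x) ^ k)) sums Re (F (of_real y))"
        by (rule sums_Re)
      moreover have "Re (c k * (of_real y - of_real x) ^ k) = Re (c k) * (y - x) ^ k" for k
      proof -
        have eq: "(complex_of_real y - of_real x) ^ k = of_real ((y - x) ^ k)"
          by (simp only: of_real_power of_real_diff)
        show ?thesis
          unfolding eq times_complex.sel Re_complex_of_real Im_complex_of_real by simp
      qed
      moreover have "F (of_real y) = of_real (f y)"
        using r2 y by (simp add: r_def)
      ultimately show ?thesis by (simp only: Re_complex_of_real)
    qed
    have "r > 0" using r1 r2 by (simp add: r_def)
    thus "\<exists>r>0. \<exists>a. \<forall>y. \<bar>y - x\<bar> < r \<longrightarrow> (\<lambda>k. a k * (y - x) ^ k) sums f y"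
      by (intro exI[of _ r] conjI exI[of _ "\<lambda>k. Re (c k)"] allI impI sums)
  qed
qed

lemma real_analytic_onI:
  assumes "\<And>x. x \<in> S \<Longrightarrow> f real_analytic_on {x}"
  shows "f real_analytic_on S"
  using assms by (auto simp: real_analytic_on_def)

lemma real_analytic_on_subset:
  "f real_analytic_on S \<Longrightarrow> T \<subseteq> S \<Longrightarrow> f real_analytic_on T"
  by (auto simp: real_analytic_on_def)

lemma real_analytic_on_cong_ev:
  assumes "f real_analytic_on {x}" "\<forall>\<^sub>F y in nhds x. f y = g y"
  shows "g real_analytic_on {x}"
proof -
  obtain F where F: "F analytic_on {of_real x}"
      "\<forall>\<^sub>F y in nhds x. F (of_real y) = complex_of_real (f y)"
    using assms by (auto simp: real_analytic_on_iff_complex)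
  have "\<forall>\<^sub>F y in nhds x. F (of_real y) = complex_of_real (g y)"
    using F(2) assms(2) by eventually_elim simp
  thus ?thesis using F(1) by (auto simp: real_analytic_on_iff_complex)
qed

lemma real_analytic_on_cong:
  assumes "f real_analytic_on S" "open S" "\<And>x. x \<in> S \<Longrightarrow> f x = g x"
  shows "g real_analytic_on S"
proof (rule real_analytic_onI)
  fix x assume x: "x \<in> S"
  have "\<forall>\<^sub>F y in nhds x. f y = g y"
    using eventually_nhds_in_open[OF assms(2) x] assms(3) by (auto elim: eventually_mono)
  thus "g real_analytic_on {x}"
    using real_analytic_on_cong_ev real_analytic_on_subset[OF assms(1)] x by blast
qed

lemma real_analytic_on_const [simp, intro]: "(\<lambda>x. c) real_analytic_on S"
  unfolding real_analytic_on_iff_complex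
  by (intro ballI exI[of _ "\<lambda>z. of_real c"]) auto

lemma real_analytic_on_ident [simp, intro]: "(\<lambda>x. x) real_analytic_on S"
  unfolding real_analytic_on_iff_complex
  by (intro ballI exI[of _ "\<lambda>z. z"]) auto

lemma real_analytic_on_add:
  assumes "f real_analytic_on S" "g real_analytic_on S"
  shows "(\<lambda>x. f x + g x) real_analytic_on S"
  unfolding real_analytic_on_iff_complex
proof
  fix x assume "x \<in> S"
  then obtain F G where F: "F analytic_on {of_real x}"
      "\<forall>\<^sub>F y in nhds x. F (of_real y) = complex_of_real (f y)"
    and G: "G analytic_on {of_real x}"
      "\<forall>\<^sub>F y in nhds x. G (of_real y) = complex_of_real (g y)"
    using assms unfolding real_analytic_on_iff_complex by meson
  show "\<exists>F. F analytic_on {of_real x} \<and>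
       (\<forall>\<^sub>F y in nhds x. F (of_real y) = complex_of_real (f y + g y))"
    by (intro exI[of _ "\<lambda>z. F z + G z"] conjI analytic_intros F(1) G(1),
        use F(2) G(2) in eventually_elim) auto
qed

lemma real_analytic_on_mult:
  assumes "f real_analytic_on S" "g real_analytic_on S"
  shows "(\<lambda>x. f x * g x) real_analytic_on S"
  unfolding real_analytic_on_iff_complex
proof
  fix x assume "x \<in> S"
  then obtain F G where F: "F analytic_on {of_real x}"
      "\<forall>\<^sub>F y in nhds x. F (of_real y) = complex_of_real (f y)"
    and G: "G analytic_on {of_real x}"
      "\<forall>\<^sub>F y in nhds x. G (of_real y) = complex_of_real (g y)"
    using assms unfolding real_analytic_on_iff_complex by meson
  show "\<exists>F. F analytic_on {of_real x} \<and>
       (\<forall>\<^sub>F y in nhds x. F (of_real y) = complex_of_real (f y * g y))"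
    by (intro exI[of _ "\<lambda>z. F z * G z"] conjI analytic_intros F(1) G(1),
        use F(2) G(2) in eventually_elim) auto
qed

lemma real_analytic_on_uminus:
  assumes "f real_analytic_on S" shows "(\<lambda>x. - f x) real_analytic_on S"
  using real_analytic_on_mult[OF real_analytic_on_const[of "-1"] assms] by simp

lemma real_analytic_on_diff:
  assumes "f real_analytic_on S" "g real_analytic_on S"
  shows "(\<lambda>x. f x - g x) real_analytic_on S"
  using real_analytic_on_add[OF assms(1) real_analytic_on_uminus[OF assms(2)]] by simp

lemma real_analytic_on_sum:
  assumes "\<And>i. i \<in> I \<Longrightarrow> f i real_analytic_on S"
  shows "(\<lambda>x. \<Sum>i\<in>I. f i x) real_analytic_on S"
  using assms by (induction I rule: infinite_finite_induct) (auto intro: real_analytic_on_add)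

lemma real_analytic_on_lincomb:
  assumes "\<And>i. i < k \<Longrightarrow> f i real_analytic_on S"
  shows "lincomb k \<alpha> f real_analytic_on S"
  unfolding lincomb_def
  by (intro real_analytic_on_sum real_analytic_on_mult real_analytic_on_const assms) simp

lemma real_analytic_on_inverse:
  assumes "f real_analytic_on S" "\<And>x. x \<in> S \<Longrightarrow> f x \<noteq> 0"
  shows "(\<lambda>x. inverse (f x)) real_analytic_on S"
  unfolding real_analytic_on_iff_complex
proof
  fix x assume x: "x \<in> S"
  then obtain F where F: "F analytic_on {of_real x}"
      "\<forall>\<^sub>F y in nhds x. F (of_real y) = complex_of_real (f y)"
    using assms unfolding real_analytic_on_iff_complex by meson
  have "F (of_real x) \<noteq> 0"
    using eventually_nhds_x_imp_x[OF F(2)] assms(2)[OF x] by simp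
  hence "(\<lambda>z. inverse (F z)) analytic_on {of_real x}"
    using F(1) by (auto intro!: analytic_intros)
  moreover have "\<forall>\<^sub>F y in nhds x. inverse (F (of_real y)) = complex_of_real (inverse (f y))"
    using F(2) by eventually_elim simp
  ultimately show "\<exists>F. F analytic_on {of_real x} \<and>
       (\<forall>\<^sub>F y in nhds x. F (of_real y) = complex_of_real (inverse (f y)))"
    by blast
qed

lemma real_analytic_on_divide:
  assumes "f real_analytic_on S" "g real_analytic_on S" "\<And>x. x \<in> S \<Longrightarrow> g x \<noteq> 0"
  shows "(\<lambda>x. f x / g x) real_analytic_on S"
  using real_analytic_on_mult[OF assms(1) real_analytic_on_inverse[OF assms(2,3)]]
  by (simp add: divide_inverse)

text \<open>The imaginary part of the extension vanishes on the real line near \<open>x\<close>, so its complex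
  derivative is real there.\<close>

lemma real_analytic_on_deriv_aux:
  assumes "F analytic_on {of_real x}"
    and ev: "\<forall>\<^sub>F y in nhds x. F (of_real y) = complex_of_real (f y)"
  shows "(f has_real_derivative Re (deriv F (of_real x))) (at x)"
    and "deriv F (of_real x) = of_real (deriv f x)"
proof -
  have "(F has_field_derivative deriv F (of_real x)) (at (of_real x))"
    using assms(1) analytic_on_imp_differentiable_at DERIV_deriv_iff_field_differentiable by blast
  hence "((\<lambda>y. F (of_real y)) has_vector_derivative deriv F (of_real x)) (at x)"
    by (rule has_vector_derivative_real_field)
  moreover have "\<forall>\<^sub>F y in nhds x. y \<in> UNIV \<longrightarrow> F (of_real y) = complex_of_real (f y)"
    using ev by eventually_elim simp
  ultimately have *: "((\<lambda>y. complex_of_real (f y)) has_vector_derivative deriv F (of_real x)) (at x)"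
    using eventually_nhds_x_imp_x[OF ev] has_vector_derivative_cong_ev[of UNIV] by metis
  have "((\<lambda>y. Re (of_real (f y))) has_vector_derivative Re (deriv F (of_real x))) (at x)"
    by (rule bounded_linear.has_vector_derivative[OF bounded_linear_Re *])
  thus 1: "(f has_real_derivative Re (deriv F (of_real x))) (at x)"
    by (simp add: has_real_derivative_iff_has_vector_derivative)
  have "((\<lambda>y. Im (of_real (f y))) has_vector_derivative Im (deriv F (of_real x))) (at x)"
    by (rule bounded_linear.has_vector_derivative[OF bounded_linear_Im *])
  hence "((\<lambda>y. 0) has_real_derivative Im (deriv F (of_real x))) (at x)"
    by (simp add: has_real_derivative_iff_has_vector_derivative)
  hence "Im (deriv F (of_real x)) = 0"
    using DERIV_unique DERIV_const by blast
  thus "deriv F (of_real x) = of_real (deriv f x)"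
    using DERIV_imp_deriv[OF 1] by (simp add: complex_eq_iff)
qed

lemma analytic_extension_nearby:
  assumes F: "F analytic_on {of_real x}"
    and ev: "\<forall>\<^sub>F y in nhds x. F (of_real y) = complex_of_real (f y)"
  shows "\<forall>\<^sub>F y in nhds x. F analytic_on {of_real y} \<and>
           (\<forall>\<^sub>F z in nhds y. F (of_real z) = complex_of_real (f z))"
proof -
  obtain r where r: "r > 0" "F holomorphic_on ball (of_real x) r"
    using F by (auto simp: analytic_on_def)
  have "\<forall>\<^sub>F y in nhds x. y \<in> ball x r"
    using r by (intro eventually_nhds_in_open) auto
  moreover have "\<forall>\<^sub>F y in nhds x. \<forall>\<^sub>F z in nhds y. F (of_real z) = complex_of_real (f z)"
    using ev by (simp add: eventually_eventually)
  ultimately show ?thesis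
  proof eventually_elim
    case (elim y)
    have "of_real y \<in> ball (complex_of_real x) r"
      using elim(1) by (metis dist_of_real mem_ball)
    hence "F analytic_on {of_real y}"
      using r(2) analytic_at open_ball by blast
    thus ?case using elim(2) by blast
  qed
qed

lemma real_analytic_on_open_nhd:
  assumes "f real_analytic_on {x}"
  shows "\<forall>\<^sub>F y in nhds x. f real_analytic_on {y}"
proof -
  obtain F where F: "F analytic_on {of_real x}"
      "\<forall>\<^sub>F y in nhds x. F (of_real y) = complex_of_real (f y)"
    using assms by (auto simp: real_analytic_on_iff_complex)
  show ?thesis
    using analytic_extension_nearby[OF F]
    by eventually_elim (auto simp: real_analytic_on_iff_complex)
qed

lemma real_analytic_on_imp_DERIV:
  assumes "f real_analytic_on S" "x \<in> S"
  shows "(f has_real_derivative deriv f x) (at x)"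
proof -
  obtain F where F: "F analytic_on {of_real x}"
      "\<forall>\<^sub>F y in nhds x. F (of_real y) = complex_of_real (f y)"
    using assms by (auto simp: real_analytic_on_iff_complex)
  show ?thesis
    using real_analytic_on_deriv_aux[OF F] DERIV_imp_deriv by fastforce
qed

lemma real_analytic_on_imp_isCont:
  assumes "f real_analytic_on S" "x \<in> S"
  shows "isCont f x"
  using real_analytic_on_imp_DERIV[OF assms] DERIV_isCont by blast

lemma real_analytic_on_imp_continuous_on:
  "f real_analytic_on S \<Longrightarrow> continuous_on S f"
  by (meson continuous_at_imp_continuous_on real_analytic_on_imp_isCont)

lemma real_analytic_on_deriv:
  assumes "f real_analytic_on S"
  shows "deriv f real_analytic_on S"
  unfolding real_analytic_on_iff_complex
proof
  fix x assume x: "x \<in> S"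
  then obtain F where F: "F analytic_on {of_real x}"
      "\<forall>\<^sub>F y in nhds x. F (of_real y) = complex_of_real (f y)"
    using assms unfolding real_analytic_on_iff_complex by meson
  have "\<forall>\<^sub>F y in nhds x. deriv F (of_real y) = complex_of_real (deriv f y)"
    using analytic_extension_nearby[OF F]
    by eventually_elim (use real_analytic_on_deriv_aux(2) in blast)
  thus "\<exists>F. F analytic_on {of_real x} \<and>
       (\<forall>\<^sub>F y in nhds x. F (of_real y) = complex_of_real (deriv f y))"
    using analytic_deriv[OF F(1)] by blast
qed

lemma real_analytic_on_compose:
  assumes "f real_analytic_on T" "g real_analytic_on S" "g ` S \<subseteq> T"
  shows "(\<lambda>x. f (g x)) real_analytic_on S"
  unfolding real_analytic_on_iff_complex
proof
  fix x assume x: "x \<in> S"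
  then obtain G where G: "G analytic_on {of_real x}"
      "\<forall>\<^sub>F y in nhds x. G (of_real y) = complex_of_real (g y)"
    using assms unfolding real_analytic_on_iff_complex by meson
  obtain F where F: "F analytic_on {of_real (g x)}"
      "\<forall>\<^sub>F y in nhds (g x). F (of_real y) = complex_of_real (f y)"
    using assms x unfolding real_analytic_on_iff_complex by (metis image_subset_iff)
  have "G (of_real x) = of_real (g x)"
    using eventually_nhds_x_imp_x[OF G(2)] .
  hence "(F \<circ> G) analytic_on {of_real x}"
    using F(1) G(1) by (intro analytic_on_compose) auto
  moreover have "filterlim g (nhds (g x)) (nhds x)"
    using real_analytic_on_imp_isCont[OF assms(2) x] by (simp add: continuous_at tendsto_at_iff_tendsto_nhds)
  hence "\<forall>\<^sub>F y in nhds x. F (of_real (g y)) = complex_of_real (f (g y))"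
    by (rule eventually_compose_filterlim[OF F(2)])
  hence "\<forall>\<^sub>F y in nhds x. (F \<circ> G) (of_real y) = complex_of_real (f (g y))"
    using G(2) by eventually_elim simp
  ultimately show "\<exists>F. F analytic_on {of_real x} \<and>
       (\<forall>\<^sub>F y in nhds x. F (of_real y) = complex_of_real (f (g y)))"
    by blast
qed

text \<open>The real analytic inverse function theorem, read off from the injectivity of a
  holomorphic extension near a point where the derivative does not vanish.\<close>

lemma real_analytic_on_inverse_function:
  assumes f: "f real_analytic_on {g t}" and nz: "deriv f (g t) \<noteq> 0"
    and cont: "isCont g t" and inv: "\<forall>\<^sub>F s in nhds t. f (g s) = s"
  shows "g real_analytic_on {t}"
proof -
  obtain r F where r: "r > 0" "F holomorphic_on ball (complex_of_real (g t)) r"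
    "\<And>y. \<bar>y - g t\<bar> < r \<Longrightarrow> F (of_real y) = of_real (f y)"
    using real_analytic_onD[OF f] by blast
  have Fan: "F analytic_on {of_real (g t)}"
    using r analytic_at by (metis centre_in_ball open_ball)
  have ev: "\<forall>\<^sub>F y in nhds (g t). F (of_real y) = complex_of_real (f y)"
    unfolding eventually_nhds_metric using r by (auto simp: dist_real_def)
  have "deriv F (of_real (g t)) \<noteq> 0"
    using real_analytic_on_deriv_aux(2)[OF Fan ev] nz by simp
  then obtain d where d: "d > 0" "ball (complex_of_real (g t)) d \<subseteq> ball (complex_of_real (g t)) r"
      "inj_on F (ball (complex_of_real (g t)) d)"
    using has_complex_derivative_locally_injective[OF r(2)] r(1) by (metis centre_in_ball open_ball)
  have hol: "F holomorphic_on ball (complex_of_real (g t)) d"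
    using r(2) d(2) holomorphic_on_subset by blast
  obtain G where G: "G holomorphic_on F ` ball (complex_of_real (g t)) d"
      "\<And>z. z \<in> ball (complex_of_real (g t)) d \<Longrightarrow> G (F z) = z"
    using holomorphic_has_inverse[OF hol open_ball d(3)] by metis
  have op: "open (F ` ball (complex_of_real (g t)) d)"
    by (rule open_mapping_thm3[OF hol open_ball d(3)])
  have filt: "filterlim g (nhds (g t)) (nhds t)"
    using cont by (simp add: continuous_at tendsto_at_iff_tendsto_nhds)
  have "\<forall>\<^sub>F s in nhds t. g s \<in> ball (g t) d"
    using d(1) by (intro eventually_compose_filterlim[OF _ filt] eventually_nhds_in_open) auto
  hence ev1: "\<forall>\<^sub>F s in nhds t. of_real (g s) \<in> ball (complex_of_real (g t)) d"
    by eventually_elim (metis dist_of_real mem_ball)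
  have ev2: "\<forall>\<^sub>F s in nhds t. F (of_real (g s)) = complex_of_real (f (g s))"
    using eventually_compose_filterlim[OF ev filt] .
  have "\<forall>\<^sub>F s in nhds t. G (of_real s) = complex_of_real (g s) \<and>
          complex_of_real s \<in> F ` ball (complex_of_real (g t)) d"
    using ev1 ev2 inv
  proof eventually_elim
    case (elim s)
    hence "F (of_real (g s)) = of_real s" by simp
    thus ?case using G(2)[OF elim(1)] elim(1) by (metis imageI)
  qed
  moreover from this have "complex_of_real t \<in> F ` ball (complex_of_real (g t)) d"
    using eventually_nhds_x_imp_x by blast
  hence "G analytic_on {of_real t}"
    using G(1) op analytic_at by blast
  ultimately show ?thesis
    unfolding real_analytic_on_iff_complex by (auto elim: eventually_mono)
qed

text \<open>Local holomorphic extensions glue: discs centred on the real line meet in a convex set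
  symmetric about the line, so two extensions that agree on its real points agree on all of it.\<close>

lemma real_analytic_on_holomorphic_extension:
  assumes f: "f real_analytic_on S" and S: "open S" "connected S"
  obtains U F where "open U" "connected U" "complex_of_real ` S \<subseteq> U" "F holomorphic_on U"
    "\<And>x. x \<in> S \<Longrightarrow> F (of_real x) = of_real (f x)"
proof (cases "S = {}")
  case True
  show ?thesis
    by (rule that[of "{}" "\<lambda>_. 0"]) (use True in auto)
next
  case False
  have "\<forall>x\<in>S. \<exists>r F. r > 0 \<and> F holomorphic_on ball (complex_of_real x) r \<and>
    (\<forall>y. \<bar>y - x\<bar> < r \<longrightarrow> F (of_real y) = of_real (f y))"
    using real_analytic_onD[OF f] by metis
  then obtain r E where r: "\<And>x. x \<in> S \<Longrightarrow> r x > 0"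
    and hol: "\<And>x. x \<in> S \<Longrightarrow> E x holomorphic_on ball (complex_of_real x) (r x)"
    and E: "\<And>x y. x \<in> S \<Longrightarrow> \<bar>y - x\<bar> < r x \<Longrightarrow> E x (of_real y) = of_real (f y)"
    by metis
  have agree: "E x z = E x' z"
    if x: "x \<in> S" "x' \<in> S" and z: "z \<in> ball (of_real x) (r x) \<inter> ball (of_real x') (r x')" for x x' z
  proof -
    let ?B = "ball (complex_of_real x) (r x) \<inter> ball (complex_of_real x') (r x')"
    let ?U = "?B \<inter> \<real>"
    have dist_Re: "dist (complex_of_real u) (of_real (Re w)) \<le> dist (of_real u) w" for u w
    proof -
      have "\<bar>Re (of_real u - w)\<bar> \<le> cmod (of_real u - w)"
        by (rule abs_Re_le_cmod)
      thus ?thesis unfolding dist_of_real by (simp add: dist_norm dist_real_def)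
    qed
    have ReB: "complex_of_real (Re z) \<in> ?B"
      using z dist_Re[of x z] dist_Re[of x' z] by auto
    have lim: "complex_of_real (Re z) islimpt ?U"
      unfolding islimpt_approachable
    proof (intro allI impI)
      fix e :: real assume "e > 0"
      have "open ?B" by auto
      then obtain d where d: "d > 0" "ball (complex_of_real (Re z)) d \<subseteq> ?B"
        using ReB open_contains_ball by metis
      define t where "t = Re z + min d e / 2"
      have dist: "dist (complex_of_real (Re z)) (of_real t) = min d e / 2"
        unfolding dist_of_real using d \<open>e > 0\<close> by (simp add: t_def dist_real_def)
      have "of_real t \<in> ball (complex_of_real (Re z)) d"
        unfolding mem_ball dist using d(1) \<open>e > 0\<close> by linarith
      hence "of_real t \<in> ?U"
        using d(2) Reals_of_real by blast
      moreover have "dist (of_real t) (complex_of_real (Re z)) < e"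
        unfolding dist_commute[of "of_real t"] dist using d(1) \<open>e > 0\<close> by linarith
      moreover have "of_real t \<noteq> complex_of_real (Re z)"
        using dist d(1) \<open>e > 0\<close> by (metis dist_self half_gt_zero less_irrefl min_less_iff_conj)
      ultimately show "\<exists>x'\<in>?U. x' \<noteq> complex_of_real (Re z) \<and> dist x' (complex_of_real (Re z)) < e"
        by blast
    qed
    have "(\<lambda>w. E x w - E x' w) z = 0"
    proof (rule analytic_continuation[where f = "\<lambda>w. E x w - E x' w" and S = ?B and U = ?U and \<xi> = "of_real (Re z)"])
      show "(\<lambda>z. E x z - E x' z) holomorphic_on ?B"
        using hol[OF x(1)] hol[OF x(2)] by (auto intro!: holomorphic_intros intro: holomorphic_on_subset)
      show "open ?B" by auto
      show "connected ?B" by (intro convex_connected convex_Int) auto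
      show "(\<lambda>w. E x w - E x' w) w = 0" if "w \<in> ?U" for w
      proof -
        from that obtain y where y: "w = of_real y" by (auto elim: Reals_cases)
        have "dist (complex_of_real x) w < r x" "dist (complex_of_real x') w < r x'"
          using that by auto
        hence "\<bar>y - x\<bar> < r x" "\<bar>y - x'\<bar> < r x'"
          unfolding y dist_of_real by (simp_all add: dist_real_def abs_minus_commute)
        thus ?thesis
          using E[OF x(1)] E[OF x(2)] y by simp
      qed
    qed (use z ReB lim in auto)
    thus ?thesis by simp
  qed
  define U where "U = (\<Union>x\<in>S. ball (complex_of_real x) (r x))"
  define F where "F z = E (SOME x. x \<in> S \<and> z \<in> ball (of_real x) (r x)) z" for z
  have F_eq: "F z = E x z" if "x \<in> S" "z \<in> ball (of_real x) (r x)" for x z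
  proof -
    let ?P = "\<lambda>x. x \<in> S \<and> z \<in> ball (of_real x) (r x)"
    have "?P (SOME x. ?P x)"
      by (rule someI[of ?P]) (use that in auto)
    thus ?thesis unfolding F_def using agree that by blast
  qed
  have sub: "complex_of_real ` S \<subseteq> U"
    unfolding U_def using r by auto
  have "connected (complex_of_real ` S)"
    using S by (intro connected_continuous_image continuous_intros)
  hence "connected (\<Union>x\<in>S. complex_of_real ` S \<union> ball (complex_of_real x) (r x))"
    using False r by (intro connected_Union) (auto intro!: connected_Un)
  moreover have "(\<Union>x\<in>S. complex_of_real ` S \<union> ball (complex_of_real x) (r x)) = U"
    using False sub unfolding U_def by auto
  ultimately have "connected U" by simp
  moreover have "open U" unfolding U_def by auto
  moreover have "F holomorphic_on U"
    unfolding U_def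
  proof (rule holomorphic_on_UN_open)
    show "F holomorphic_on ball (complex_of_real x) (r x)" if "x \<in> S" for x
      using hol[OF that] F_eq[OF that] holomorphic_cong by metis
  qed auto
  moreover have "F (of_real x) = of_real (f x)" if "x \<in> S" for x
    using F_eq[OF that, of "of_real x"] E[OF that, of x] r[OF that] by simp
  ultimately show ?thesis using that sub by blast
qed

lemma real_analytic_on_zero_isolated:
  assumes f: "f real_analytic_on S" and S: "open S" "connected S"
    and z: "x \<in> S" "f x = 0" and nz: "y \<in> S" "f y \<noteq> 0"
  shows "\<forall>\<^sub>F t in at x. f t \<noteq> 0"
proof -
  obtain U F where U: "open U" "connected U" "complex_of_real ` S \<subseteq> U" "F holomorphic_on U"
    and F: "\<And>x. x \<in> S \<Longrightarrow> F (of_real x) = of_real (f x)"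
    using real_analytic_on_holomorphic_extension[OF f S] by metis
  obtain r where r: "0 < r" "\<And>z. z \<in> ball (complex_of_real x) r - {of_real x} \<Longrightarrow> F z \<noteq> 0"
    using isolated_zeros[OF U(4,1,2), of "of_real x" "of_real y"] U(3) F z nz
    by (metis imageI of_real_0 of_real_eq_iff subsetD)
  have "\<forall>\<^sub>F t in at x. t \<in> S"
    using S z by (simp add: eventually_at_in_open')
  moreover have "\<forall>\<^sub>F t in at x. t \<in> ball x r - {x}"
    using r(1) by (intro eventually_at_in_open) auto
  ultimately show ?thesis
  proof eventually_elim
    case (elim t)
    have "complex_of_real t \<in> ball (of_real x) r - {of_real x}"
      using elim(2) by (metis Diff_iff dist_of_real mem_ball of_real_eq_iff singleton_iff)
    thus ?case using r(2) F[OF elim(1)] by auto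
  qed
qed

lemma isolated_zeros_real_analytic:
  assumes "f real_analytic_on S" "open S" "connected S" "\<exists>y\<in>S. f y \<noteq> 0"
  shows "isolated_zeros f S = {x\<in>S. f x = 0}"
  using real_analytic_on_zero_isolated[OF assms(1-3)] assms(4) unfolding isolated_zeros_def by blast

lemma real_analytic_on_divide_by_id:
  assumes f: "f real_analytic_on {0}" and "f 0 = 0"
  shows "\<exists>g. g real_analytic_on {0} \<and> (\<forall>y. f y = y * g y)"
proof -
  obtain r c where r: "r > 0" and
    c: "\<And>y. \<bar>y - 0\<bar> < r \<Longrightarrow> (\<lambda>k. c k * (y - 0) ^ k) sums f y"
    using f unfolding real_analytic_on_def by blast
  define g where "g y = (if y = 0 then c 1 else f y / y)" for y
  have "(\<lambda>k. c k * 0 ^ k) sums c 0"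
    using powser_sums_zero[of c] by simp
  hence "c 0 = 0" using c[of 0] r assms(2) sums_unique2 by fastforce
  have sums: "(\<lambda>k. c (Suc k) * (y - 0) ^ k) sums g y" if y: "\<bar>y - 0\<bar> < r" for y
  proof (cases "y = 0")
    case True
    thus ?thesis using powser_sums_zero[of "\<lambda>k. c (Suc k)"] by (simp add: g_def)
  next
    case False
    have "(\<lambda>k. c (Suc k) * y ^ Suc k) sums (f y - c 0 * y ^ 0)"
      by (rule iffD2[OF sums_Suc_iff[of "\<lambda>k. c k * y ^ k"]]) (use c[OF y] in simp)
    hence "(\<lambda>k. c (Suc k) * y ^ Suc k / y) sums (f y / y)"
      using \<open>c 0 = 0\<close> by (intro sums_divide) simp
    thus ?thesis using False by (simp add: g_def)
  qed
  have "g real_analytic_on {0}"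
    unfolding real_analytic_on_def
    by (intro ballI exI[of _ r] conjI exI[of _ "\<lambda>k. c (Suc k)"] allI impI)
       (use r sums in auto)
  moreover have "f y = y * g y" for y
    using assms(2) by (simp add: g_def)
  ultimately show ?thesis by blast
qed

text \<open>A Taylor coefficient of order below \<open>N\<close> would violate the bound; they are removed one
  at a time.\<close>

lemma real_analytic_on_factor_power:
  assumes f: "f real_analytic_on {0}" and ev: "\<forall>\<^sub>F y in at 0. \<bar>f y\<bar> \<le> C * \<bar>y\<bar> ^ N"
  shows "\<exists>g. g real_analytic_on {0} \<and> (\<forall>y. f y = y ^ N * g y)"
  using ev
proof (induction N arbitrary: C)
  case 0
  thus ?case using f by auto
next
  case (Suc N)
  have "\<forall>\<^sub>F y in at 0. \<bar>f y\<bar> \<le> \<bar>C\<bar> * \<bar>y\<bar> ^ N"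
  proof -
    have "\<forall>\<^sub>F y :: real in at 0. y \<in> ball 0 1"
      using eventually_at_in_open'[of "ball (0::real) 1" 0] by simp
    thus ?thesis using Suc.prems
    proof eventually_elim
      case (elim y)
      have "C * \<bar>y\<bar> ^ Suc N \<le> \<bar>C\<bar> * \<bar>y\<bar> ^ N"
        using elim(1) by (intro mult_mono power_decreasing) auto
      thus ?case using elim(2) by linarith
    qed
  qed
  then obtain g where g: "g real_analytic_on {0}" "\<And>y. f y = y ^ N * g y"
    using Suc.IH by blast
  have "\<forall>\<^sub>F y in at 0. \<bar>g y\<bar> \<le> C * \<bar>y\<bar>"
    using Suc.prems eventually_neq_at_within[of 0]
  proof eventually_elim
    case (elim y)
    have "\<bar>y\<bar> ^ N * \<bar>g y\<bar> \<le> \<bar>y\<bar> ^ N * (C * \<bar>y\<bar>)"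
      using elim(1) g(2)[of y] by (simp add: abs_mult power_abs ac_simps)
    thus ?case using elim(2) by simp
  qed
  moreover have "((\<lambda>y. C * \<bar>y\<bar>) \<longlongrightarrow> 0) (at 0)"
    by (auto intro!: tendsto_eq_intros)
  ultimately have "(g \<longlongrightarrow> 0) (at 0)"
    by (intro Lim_null_comparison[of g]) auto
  moreover have "(g \<longlongrightarrow> g 0) (at 0)"
    using real_analytic_on_imp_isCont[OF g(1)] by (simp add: isCont_def)
  ultimately have "g 0 = 0"
    using tendsto_unique trivial_limit_at by metis
  then obtain h where h: "h real_analytic_on {0}" "\<And>y. g y = y * h y"
    using real_analytic_on_divide_by_id[OF g(1)] by blast
  have "f y = y ^ Suc N * h y" for y
    using g(2)[of y] h(2)[of y] by simp
  thus ?case using h(1) by blast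
qed

section \<open>Extended Chebyshev systems from nondegenerate jets\<close>

text \<open>A lower bound for the order of vanishing. Unlike \<open>zero_multiplicity\<close>, it passes to sums and
  products without any knowledge of the exact orders.\<close>

definition vanishes_to :: "(real \<Rightarrow> real) \<Rightarrow> real \<Rightarrow> nat \<Rightarrow> bool" where
  "vanishes_to f x m \<longleftrightarrow> (\<forall>j<m. (deriv ^^ j) f x = 0)"

lemma vanishes_to_0 [simp]: "vanishes_to f x 0"
  by (simp add: vanishes_to_def)

lemma vanishes_to_Suc: "vanishes_to f x (Suc m) \<longleftrightarrow> f x = 0 \<and> vanishes_to (deriv f) x m"
  unfolding vanishes_to_def by (simp add: All_less_Suc2 funpow_Suc_right del: funpow.simps(2))

lemma vanishes_to_mono: "vanishes_to f x m \<Longrightarrow> k \<le> m \<Longrightarrow> vanishes_to f x k"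
  by (auto simp: vanishes_to_def)

lemma vanishes_to_cong_ev:
  assumes "\<forall>\<^sub>F y in nhds x. f y = g y"
  shows "vanishes_to f x m \<longleftrightarrow> vanishes_to g x m"
  unfolding vanishes_to_def using higher_deriv_cong_ev[OF assms refl] by simp

lemma vanishes_to_add:
  assumes "f real_analytic_on {x}" "g real_analytic_on {x}" "vanishes_to f x m" "vanishes_to g x m"
  shows "vanishes_to (\<lambda>y. f y + g y) x m"
  using assms
proof (induction m arbitrary: f g)
  case (Suc m)
  have "\<forall>\<^sub>F y in nhds x. deriv f y + deriv g y = deriv (\<lambda>y. f y + g y) y"
    using real_analytic_on_open_nhd[OF Suc.prems(1)] real_analytic_on_open_nhd[OF Suc.prems(2)]
  proof eventually_elim
    case (elim y)
    show ?case
      using DERIV_imp_deriv[OF DERIV_add[OF real_analytic_on_imp_DERIV[OF elim(1)]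
              real_analytic_on_imp_DERIV[OF elim(2)]]] by simp
  qed
  moreover have "vanishes_to (\<lambda>y. deriv f y + deriv g y) x m"
    using Suc.prems by (intro Suc.IH real_analytic_on_deriv) (auto simp: vanishes_to_Suc)
  ultimately show ?case
    using Suc.prems vanishes_to_cong_ev by (auto simp: vanishes_to_Suc)
qed simp

lemma vanishes_to_mult:
  assumes "f real_analytic_on {x}" "g real_analytic_on {x}" "vanishes_to f x m"
  shows "vanishes_to (\<lambda>y. f y * g y) x m"
  using assms
proof (induction m arbitrary: f g)
  case (Suc m)
  have "\<forall>\<^sub>F y in nhds x. deriv f y * g y + f y * deriv g y = deriv (\<lambda>y. f y * g y) y"
    using real_analytic_on_open_nhd[OF Suc.prems(1)] real_analytic_on_open_nhd[OF Suc.prems(2)]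
  proof eventually_elim
    case (elim y)
    show ?case
      using DERIV_imp_deriv[OF DERIV_mult[OF real_analytic_on_imp_DERIV[OF elim(1)]
              real_analytic_on_imp_DERIV[OF elim(2)]]] by (simp add: mult.commute)
  qed
  moreover have "vanishes_to (\<lambda>y. deriv f y * g y + f y * deriv g y) x m"
  proof (rule vanishes_to_add)
    show "vanishes_to (\<lambda>y. deriv f y * g y) x m"
      using Suc.prems by (intro Suc.IH real_analytic_on_deriv) (auto simp: vanishes_to_Suc)
    show "vanishes_to (\<lambda>y. f y * deriv g y) x m"
      using Suc.prems by (intro Suc.IH real_analytic_on_deriv) (auto intro: vanishes_to_mono)
  qed (use Suc.prems in \<open>auto intro!: real_analytic_on_mult real_analytic_on_deriv\<close>)
  ultimately show ?case
    using Suc.prems vanishes_to_cong_ev by (auto simp: vanishes_to_Suc)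
qed simp

text \<open>The bound \<open>x < Max S\<close> serves the induction over \<open>S\<close>: when a new largest point is added, the
  new critical point lies beyond the old maximum and hence is new.\<close>

lemma rolle_points:
  assumes f: "f real_analytic_on L" and L: "is_interval L"
    and S: "finite S" "S \<noteq> {}" "S \<subseteq> L" "\<And>x. x \<in> S \<Longrightarrow> f x = 0"
  shows "\<exists>R. finite R \<and> R \<subseteq> L - S \<and> Suc (card R) = card S \<and> (\<forall>x\<in>R. deriv f x = 0 \<and> x < Max S)"
  using S
proof (induction S rule: finite_linorder_max_induct)
  case (insert b A)
  show ?case
  proof (cases "A = {}")
    case True
    thus ?thesis by (intro exI[of _ "{}"]) auto
  next
    case False
    have AL: "A \<subseteq> L" and A0: "\<And>x. x \<in> A \<Longrightarrow> f x = 0"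
      using insert.prems by auto
    have "\<exists>R. finite R \<and> R \<subseteq> L - A \<and> Suc (card R) = card A \<and>
        (\<forall>x\<in>R. deriv f x = 0 \<and> x < Max A)"
      by (rule insert.IH[OF False AL]) (rule A0)
    then obtain R where R: "finite R" "R \<subseteq> L - A"
      "Suc (card R) = card A" "\<forall>x\<in>R. deriv f x = 0 \<and> x < Max A"
      by (elim exE conjE)
    define a where "a = Max A"
    have aA: "a \<in> A" unfolding a_def using False insert.hyps by simp
    hence ab: "a < b" using insert.hyps by blast
    have sub: "{a..b} \<subseteq> L"
    proof
      fix x assume x: "x \<in> {a..b}"
      have "a \<in> L" "b \<in> L" using aA AL insert.prems(2) by blast+
      from mem_is_interval_1_I[OF L this] show "x \<in> L" using x by simp
    qed
    have "\<exists>z>a. z < b \<and> DERIV f z :> 0"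
    proof (rule Rolle[OF ab])
      have "f a = 0" by (rule insert.prems(3)) (use aA in simp)
      moreover have "f b = 0" by (rule insert.prems(3)) simp
      ultimately show "f a = f b" by simp
      show "continuous_on {a..b} f"
        using real_analytic_on_imp_continuous_on[OF f] sub continuous_on_subset by blast
      show "f differentiable at x" if "a < x" "x < b" for x
        using real_analytic_on_imp_DERIV[OF f] sub that real_differentiable_def
        by (metis atLeastAtMost_iff less_imp_le subsetD)
    qed
    then obtain z where z: "a < z" "z < b" "DERIV f z :> 0" by blast
    have zR: "z \<notin> R" using R(4) z(1) unfolding a_def by fastforce
    have zA: "z \<notin> A" using z(1) insert.hyps(1) unfolding a_def by (metis Max_ge not_less)
    have Max: "Max (insert b A) = b"
      using insert.hyps by (intro Max_eqI) auto
    show ?thesis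
    proof (intro exI[of _ "insert z R"] conjI ballI)
      show "insert z R \<subseteq> L - insert b A"
        using R z zA sub ab unfolding a_def by fastforce
      show "Suc (card (insert z R)) = card (insert b A)"
        using R insert.hyps zR by auto
      show "deriv f x = 0" "x < Max (insert b A)" if "x \<in> insert z R" for x
        using that R z ab DERIV_imp_deriv[OF z(3)] unfolding Max a_def by fastforce+
    qed (use R in auto)
  qed
qed simp

text \<open>Rolle's theorem with multiplicities: a zero of order \<open>\<mu>\<close> of \<open>f\<close> is one of order \<open>\<mu> - 1\<close> of \<open>f'\<close>,
  and every gap between two zeros of \<open>f\<close> contributes a further zero of \<open>f'\<close>, so that only one zero is
  lost in total.\<close>

lemma rolle_with_multiplicities:
  assumes f: "f real_analytic_on L" and L: "is_interval L"
    and S: "finite S" "S \<subseteq> L" "\<And>x. x \<in> S \<Longrightarrow> vanishes_to f x (\<mu> x)"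
  obtains T \<nu> where "finite T" "T \<subseteq> L" "\<And>x. x \<in> T \<Longrightarrow> vanishes_to (deriv f) x (\<nu> x)"
    "sum \<mu> S \<le> Suc (sum \<nu> T)"
proof -
  define S1 where "S1 = {x\<in>S. \<mu> x > 0}"
  have S1: "finite S1" "S1 \<subseteq> L" using S by (auto simp: S1_def)
  have sum_S1: "sum \<mu> S = sum \<mu> S1"
    unfolding S1_def using S(1) by (intro sum.mono_neutral_right) auto
  show ?thesis
  proof (cases "S1 = {}")
    case True
    show ?thesis
      by (rule that[of "{}" \<mu>]) (use sum_S1 True in auto)
  next
    case False
    have van: "f x = 0 \<and> vanishes_to (deriv f) x (\<mu> x - 1)" if "x \<in> S1" for x
      using S(3)[of x] that vanishes_to_Suc[of f x "\<mu> x - 1"] by (auto simp: S1_def)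
    obtain R where R: "finite R" "R \<subseteq> L - S1" "Suc (card R) = card S1" "\<forall>x\<in>R. deriv f x = 0"
      using rolle_points[OF f L S1(1) False S1(2)] van by blast
    define \<nu> where "\<nu> x = (if x \<in> R then 1 else \<mu> x - 1)" for x
    have "sum \<nu> (S1 \<union> R) = sum \<nu> S1 + sum \<nu> R"
      using R S1 by (intro sum.union_disjoint) auto
    also have "sum \<nu> S1 = (\<Sum>x\<in>S1. \<mu> x - 1)"
      using R by (intro sum.cong) (auto simp: \<nu>_def)
    also have "sum \<nu> R = card R" by (simp add: \<nu>_def)
    finally have "Suc (sum \<nu> (S1 \<union> R)) = (\<Sum>x\<in>S1. \<mu> x - 1) + (\<Sum>x\<in>S1. 1)"
      using R by simp
    also have "\<dots> = (\<Sum>x\<in>S1. \<mu> x)"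
      unfolding sum.distrib[symmetric] by (intro sum.cong) (auto simp: S1_def)
    finally have "sum \<mu> S \<le> Suc (sum \<nu> (S1 \<union> R))"
      using sum_S1 by simp
    moreover have "vanishes_to (deriv f) x (\<nu> x)" if "x \<in> S1 \<union> R" for x
      using that van R by (auto simp: \<nu>_def vanishes_to_Suc)
    ultimately show ?thesis
      using that[of "S1 \<union> R" \<nu>] R S1 by auto
  qed
qed

text \<open>The condition that the Wronskians of \<open>f 0, \<dots>, f (k - 1)\<close>, \<open>k \<le> n\<close>, have no zero in \<open>L\<close>,
  expressed as the injectivity of the map from coefficients to jets, so that no determinants
  are needed.\<close>

definition nondegenerate_jets :: "nat \<Rightarrow> (nat \<Rightarrow> real \<Rightarrow> real) \<Rightarrow> real set \<Rightarrow> bool" where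
  "nondegenerate_jets n f L \<longleftrightarrow>
     (\<forall>k\<in>{1..n}. \<forall>x\<in>L. \<forall>\<alpha>. (\<exists>i<k. \<alpha> i \<noteq> 0) \<longrightarrow> \<not> vanishes_to (lincomb k \<alpha> f) x k)"

lemma lincomb_Suc_shift:
  "lincomb (Suc k) \<alpha> f x = \<alpha> 0 * f 0 x + lincomb k (\<lambda>i. \<alpha> (Suc i)) (\<lambda>i. f (Suc i)) x"
  unfolding lincomb_def by (rule sum.lessThan_Suc_shift)

lemma deriv_lincomb:
  assumes "\<And>i. i < k \<Longrightarrow> f i real_analytic_on {x}"
  shows "deriv (lincomb k \<alpha> f) x = lincomb k \<alpha> (\<lambda>i. deriv (f i)) x"
proof -
  have "((\<lambda>x. \<Sum>i<k. \<alpha> i * f i x) has_real_derivative (\<Sum>i<k. \<alpha> i * deriv (f i) x)) (at x)"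
    using assms by (intro DERIV_sum DERIV_cmult real_analytic_on_imp_DERIV) auto
  thus ?thesis unfolding lincomb_def[abs_def] by (rule DERIV_imp_deriv)
qed

text \<open>If \<open>q\<close> is a combination of the quotients \<open>f (Suc i) / f 0\<close> and the jet of \<open>q'\<close> vanishes at \<open>x\<close>, then
  that of \<open>q - q x\<close> vanishes to one order more, and \<open>(q - q x) f 0\<close> is a combination of the \<open>f i\<close>.\<close>

lemma nondegenerate_jets_divide:
  assumes L: "open L" and f: "\<And>i. i < Suc n \<Longrightarrow> f i real_analytic_on L"
    and nd: "nondegenerate_jets (Suc n) f L" and nz: "\<And>x. x \<in> L \<Longrightarrow> f 0 x \<noteq> 0"
  shows "nondegenerate_jets n (\<lambda>i. deriv (\<lambda>x. f (Suc i) x / f 0 x)) L"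
  unfolding nondegenerate_jets_def
proof (intro ballI allI impI notI)
  fix k x \<beta>
  assume k: "k \<in> {1..n}" and x: "x \<in> L" and \<beta>: "\<exists>i<k. \<beta> i \<noteq> 0"
    and van: "vanishes_to (lincomb k \<beta> (\<lambda>i. deriv (\<lambda>x. f (Suc i) x / f 0 x))) x k"
  define q where "q = lincomb k \<beta> (\<lambda>i x. f (Suc i) x / f 0 x)"
  have quot: "(\<lambda>x. f (Suc i) x / f 0 x) real_analytic_on L" if "i < k" for i
    using that k nz by (intro real_analytic_on_divide f) auto
  have q: "q real_analytic_on L"
    unfolding q_def by (intro real_analytic_on_lincomb quot)
  have "\<forall>\<^sub>F y in nhds x. y \<in> L"
    using L x by (rule eventually_nhds_in_open)
  hence "\<forall>\<^sub>F y in nhds x. lincomb k \<beta> (\<lambda>i. deriv (\<lambda>x. f (Suc i) x / f 0 x)) y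
           = deriv (\<lambda>y. q y - q x) y"
  proof eventually_elim
    case (elim y)
    have "deriv (\<lambda>y. q y - q x) y = deriv q y"
      using DERIV_diff[OF real_analytic_on_imp_DERIV[OF q elim] DERIV_const]
      by (intro DERIV_imp_deriv) simp
    also have "\<dots> = lincomb k \<beta> (\<lambda>i. deriv (\<lambda>x. f (Suc i) x / f 0 x)) y"
      unfolding q_def
      by (rule deriv_lincomb) (use quot elim real_analytic_on_subset in blast)
    finally show ?case by simp
  qed
  hence "vanishes_to (deriv (\<lambda>y. q y - q x)) x k"
    using van vanishes_to_cong_ev by blast
  hence "vanishes_to (\<lambda>y. q y - q x) x (Suc k)"
    by (simp add: vanishes_to_Suc)
  hence "vanishes_to (\<lambda>y. (q y - q x) * f 0 y) x (Suc k)"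
    using x by (intro vanishes_to_mult real_analytic_on_subset[OF f] real_analytic_on_diff
        real_analytic_on_subset[OF q]) auto
  \<comment> \<open>The constant \<open>q x\<close> is a multiple of \<open>f 0 / f 0\<close>, so it accounts for the coefficient of \<open>f 0\<close>.\<close>
  define \<alpha> where "\<alpha> = case_nat (- q x) \<beta>"
  have "\<forall>\<^sub>F y in nhds x. y \<in> L"
    using L x by (rule eventually_nhds_in_open)
  hence "\<forall>\<^sub>F y in nhds x. (q y - q x) * f 0 y = lincomb (Suc k) \<alpha> f y"
  proof eventually_elim
    case (elim y)
    have "q y * f 0 y = lincomb k \<beta> (\<lambda>i. f (Suc i)) y"
      using nz[OF elim] by (simp add: q_def lincomb_def sum_distrib_right)
    thus ?case
      by (simp add: lincomb_Suc_shift \<alpha>_def algebra_simps)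
  qed
  from iffD1[OF vanishes_to_cong_ev[OF this] \<open>vanishes_to (\<lambda>y. (q y - q x) * f 0 y) x (Suc k)\<close>]
  have "vanishes_to (lincomb (Suc k) \<alpha> f) x (Suc k)" .
  moreover have "\<exists>i<Suc k. \<alpha> i \<noteq> 0"
  proof -
    obtain i where "i < k" "\<beta> i \<noteq> 0" using \<beta> by blast
    thus ?thesis by (intro exI[of _ "Suc i"]) (simp add: \<alpha>_def)
  qed
  moreover have "Suc k \<in> {1..Suc n}" using k by auto
  ultimately show False
    using nd x unfolding nondegenerate_jets_def by blast
qed

text \<open>Division by \<open>f 0\<close> followed by differentiation reduces the number of functions by one and, by
  Rolle's theorem, the number of zeros by at most one.\<close>

lemma nondegenerate_jets_zero_count:
  assumes L: "open L" "is_interval L"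
    and f: "\<And>i. i < n \<Longrightarrow> f i real_analytic_on L"
    and nd: "nondegenerate_jets n f L" and \<alpha>: "\<exists>i<n. \<alpha> i \<noteq> 0"
    and S: "finite S" "S \<subseteq> L" "\<And>x. x \<in> S \<Longrightarrow> vanishes_to (lincomb n \<alpha> f) x (\<mu> x)"
  shows "sum \<mu> S < n"
  using f nd \<alpha> S
proof (induction n arbitrary: f \<alpha> S \<mu>)
  case 0
  thus ?case by simp
next
  case (Suc n)
  have nz: "f 0 x \<noteq> 0" if "x \<in> L" for x
  proof -
    have "\<not> vanishes_to (lincomb 1 (\<lambda>i. 1) f) x 1"
      using Suc.prems(2) that unfolding nondegenerate_jets_def by auto
    thus ?thesis by (simp add: vanishes_to_Suc lincomb_def)
  qed
  show ?case
  proof (cases "\<exists>i<n. \<alpha> (Suc i) \<noteq> 0")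
    case False
    hence "lincomb (Suc n) \<alpha> f x = \<alpha> 0 * f 0 x" for x
      unfolding lincomb_Suc_shift by (simp add: lincomb_def)
    moreover have "\<alpha> 0 \<noteq> 0"
      using Suc.prems(3) False by (metis not0_implies_Suc Suc_less_eq)
    ultimately have "\<mu> x = 0" if "x \<in> S" for x
      using Suc.prems(6)[OF that] Suc.prems(5) nz[of x] that
      by (cases "\<mu> x") (auto simp: vanishes_to_Suc)
    thus ?thesis by simp
  next
    case True
    define g where "g i = deriv (\<lambda>x. f (Suc i) x / f 0 x)" for i
    define q where "q x = lincomb (Suc n) \<alpha> f x / f 0 x" for x
    have quot: "(\<lambda>x. f (Suc i) x / f 0 x) real_analytic_on L" if "i < n" for i
      using that nz by (intro real_analytic_on_divide Suc.prems) auto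
    have lin: "lincomb (Suc n) \<alpha> f real_analytic_on L"
      by (intro real_analytic_on_lincomb Suc.prems)
    have q: "q real_analytic_on L"
      unfolding q_def using nz by (intro real_analytic_on_divide lin Suc.prems) auto
    have van: "vanishes_to q x (\<mu> x)" if "x \<in> S" for x
    proof -
      have "x \<in> L" using that Suc.prems(5) by blast
      hence "vanishes_to (\<lambda>y. lincomb (Suc n) \<alpha> f y * inverse (f 0 y)) x (\<mu> x)"
        using that nz
        by (intro vanishes_to_mult Suc.prems(6) real_analytic_on_inverse
              real_analytic_on_subset[OF lin] real_analytic_on_subset[OF Suc.prems(1)]) auto
      thus ?thesis by (simp add: q_def[abs_def] divide_inverse)
    qed
    obtain T \<nu> where T: "finite T" "T \<subseteq> L" "\<And>x. x \<in> T \<Longrightarrow> vanishes_to (deriv q) x (\<nu> x)"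
      "sum \<mu> S \<le> Suc (sum \<nu> T)"
      using rolle_with_multiplicities[OF q L(2) Suc.prems(4,5) van] by blast
    have dq: "deriv q y = lincomb n (\<lambda>i. \<alpha> (Suc i)) g y" if y: "y \<in> L" for y
    proof -
      have "\<forall>\<^sub>F z in nhds y. z \<in> L"
        using L(1) y by (rule eventually_nhds_in_open)
      hence "\<forall>\<^sub>F z in nhds y. q z = \<alpha> 0 + lincomb n (\<lambda>i. \<alpha> (Suc i)) (\<lambda>i x. f (Suc i) x / f 0 x) z"
        proof eventually_elim
        case (elim z)
        have "q z = (\<alpha> 0 * f 0 z + lincomb n (\<lambda>i. \<alpha> (Suc i)) (\<lambda>i. f (Suc i)) z) / f 0 z"
          unfolding q_def lincomb_Suc_shift ..
        thus ?case
          using nz[OF elim] by (simp add: add_divide_distrib lincomb_def sum_divide_distrib)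
      qed
      hence "deriv q y = deriv (\<lambda>z. \<alpha> 0 + lincomb n (\<lambda>i. \<alpha> (Suc i)) (\<lambda>i x. f (Suc i) x / f 0 x) z) y"
        by (intro deriv_cong_ev) auto
      also have "\<dots> = deriv (lincomb n (\<lambda>i. \<alpha> (Suc i)) (\<lambda>i x. f (Suc i) x / f 0 x)) y"
        using DERIV_add[OF DERIV_const real_analytic_on_imp_DERIV[OF
            real_analytic_on_lincomb[OF quot] y]]
        by (intro DERIV_imp_deriv) simp
      also have "\<dots> = lincomb n (\<lambda>i. \<alpha> (Suc i)) g y"
        unfolding g_def by (rule deriv_lincomb) (use quot y real_analytic_on_subset in blast)
      finally show ?thesis .
    qed
    have "sum \<nu> T < n"
    proof (rule Suc.IH[of g "\<lambda>i. \<alpha> (Suc i)"])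
      show "g i real_analytic_on L" if "i < n" for i
        unfolding g_def by (intro real_analytic_on_deriv quot that)
      show "nondegenerate_jets n g L"
        unfolding g_def[abs_def] by (intro nondegenerate_jets_divide L Suc.prems nz)
      show "vanishes_to (lincomb n (\<lambda>i. \<alpha> (Suc i)) g) x (\<nu> x)" if "x \<in> T" for x
      proof -
        have "x \<in> L" using that T by blast
        hence "\<forall>\<^sub>F y in nhds x. deriv q y = lincomb n (\<lambda>i. \<alpha> (Suc i)) g y"
          by (rule eventually_mono[OF eventually_nhds_in_open[OF L(1)] dq])
        thus ?thesis using T(3)[OF that] vanishes_to_cong_ev by blast
      qed
    qed (use True T in auto)
    thus ?thesis using T(4) by simp
  qed
qed

lemma ECT_systemI:
  assumes L: "open L" "is_interval L" "L \<noteq> {}"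
    and f: "\<And>i. i < n \<Longrightarrow> f i real_analytic_on L"
    and nd: "nondegenerate_jets n f L"
  shows "ECT_system n f L"
  unfolding ECT_system_def
proof (intro conjI allI impI ballI)
  fix k and \<alpha> :: "nat \<Rightarrow> real" assume k: "k \<in> {1..n}" and \<alpha>: "\<exists>i<k. \<alpha> i \<noteq> 0"
  let ?\<phi> = "lincomb k \<alpha> f"
  let ?Z = "isolated_zeros ?\<phi> L"
  have ndk: "nondegenerate_jets k f L"
    using nd k unfolding nondegenerate_jets_def by auto
  have nvan: "\<not> vanishes_to ?\<phi> x k" if "x \<in> L" for x
    using nd k \<alpha> that unfolding nondegenerate_jets_def by blast
  show "\<exists>x\<in>L. ?\<phi> x \<noteq> 0"
  proof (rule ccontr)
    assume "\<not> ?thesis"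
    hence *: "?\<phi> x = 0" if "x \<in> L" for x using that by blast
    obtain x where x: "x \<in> L" using L by blast
    have "\<forall>\<^sub>F y in nhds x. ?\<phi> y = 0"
      using eventually_nhds_in_open[OF L(1) x] * by (auto elim: eventually_mono)
    moreover have "vanishes_to (\<lambda>y. 0) x k" for k
      by (induction k) (simp_all add: vanishes_to_Suc)
    ultimately show False
      using nvan[OF x] vanishes_to_cong_ev[of ?\<phi> "\<lambda>y. 0" x k] by simp
  qed
  have mult: "vanishes_to ?\<phi> x (zero_multiplicity ?\<phi> x)" for x
    unfolding vanishes_to_def zero_multiplicity_def by (auto dest: not_less_Least)
  have pos: "zero_multiplicity ?\<phi> x \<ge> 1" if "x \<in> ?Z" for x
  proof -
    have x: "x \<in> L" "?\<phi> x = 0" using that by (auto simp: isolated_zeros_def)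
    obtain j where "(deriv ^^ j) ?\<phi> x \<noteq> 0"
      using nvan[OF x(1)] by (auto simp: vanishes_to_def)
    hence "(deriv ^^ zero_multiplicity ?\<phi> x) ?\<phi> x \<noteq> 0"
      unfolding zero_multiplicity_def by (rule LeastI)
    thus ?thesis using x(2) by (cases "zero_multiplicity ?\<phi> x") auto
  qed
  have bound: "sum (zero_multiplicity ?\<phi>) S < k" if "finite S" "S \<subseteq> ?Z" for S
  proof (rule nondegenerate_jets_zero_count[OF L(1,2) _ ndk \<alpha> that(1)])
    show "S \<subseteq> L" using that by (auto simp: isolated_zeros_def)
  qed (use k f mult in auto)
  show fin: "finite ?Z"
  proof (rule ccontr)
    assume "infinite ?Z"
    then obtain S where S: "S \<subseteq> ?Z" "finite S" "card S = k"
      using infinite_arbitrarily_large by metis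
    have "card S \<le> sum (zero_multiplicity ?\<phi>) S"
      unfolding card_eq_sum using pos S by (intro sum_mono) auto
    thus False using bound[OF S(2,1)] S(3) by simp
  qed
  show "sum (zero_multiplicity ?\<phi>) ?Z \<le> k - 1"
    using bound[OF fin subset_refl] by simp
qed (use f in auto)

section \<open>Sign changes in Chebyshev systems\<close>

text \<open>The part of \<open>T_system\<close> that survives a change of variable without any smoothness: all zeros
  are counted, isolated or not.\<close>

definition haar_system :: "nat \<Rightarrow> (nat \<Rightarrow> real \<Rightarrow> real) \<Rightarrow> real set \<Rightarrow> bool" where
  "haar_system k v L \<longleftrightarrow> (\<forall>\<alpha>. (\<exists>i<k. \<alpha> i \<noteq> 0) \<longrightarrow>
     finite {x\<in>L. lincomb k \<alpha> v x = 0} \<and> card {x\<in>L. lincomb k \<alpha> v x = 0} < k)"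

lemma haar_systemD:
  assumes "haar_system k v L" "\<exists>i<k. \<alpha> i \<noteq> 0"
  shows "finite {x\<in>L. lincomb k \<alpha> v x = 0}" "card {x\<in>L. lincomb k \<alpha> v x = 0} < k"
  using assms unfolding haar_system_def by blast+

lemma haar_system_card_less:
  assumes "haar_system k v L" "\<exists>i<k. \<alpha> i \<noteq> 0"
    and "C \<subseteq> L" "\<And>x. x \<in> C \<Longrightarrow> lincomb k \<alpha> v x = 0"
  shows "card C < k"
proof -
  have "card C \<le> card {x\<in>L. lincomb k \<alpha> v x = 0}"
    using assms(3,4) by (intro card_mono haar_systemD(1)[OF assms(1,2)]) auto
  thus ?thesis using haar_systemD(2)[OF assms(1,2)] by simp
qed

lemma haar_system_subset:
  assumes "haar_system k v L" "M \<subseteq> L"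
  shows "haar_system k v M"
  unfolding haar_system_def
proof (intro allI impI)
  fix \<alpha> :: "nat \<Rightarrow> real" assume \<alpha>: "\<exists>i<k. \<alpha> i \<noteq> 0"
  have sub: "{x\<in>M. lincomb k \<alpha> v x = 0} \<subseteq> {x\<in>L. lincomb k \<alpha> v x = 0}"
    using assms(2) by blast
  show "finite {x\<in>M. lincomb k \<alpha> v x = 0} \<and> card {x\<in>M. lincomb k \<alpha> v x = 0} < k"
    using haar_systemD[OF assms(1) \<alpha>] sub card_mono[OF _ sub] finite_subset[OF sub] by linarith
qed

text \<open>This transports the Chebyshev property from the space variable to the energy.\<close>

lemma haar_system_reparam:
  assumes h: "haar_system k v L" and \<phi>: "inj_on \<phi> M" "\<phi> ` M \<subseteq> L"
    and c: "c \<noteq> 0"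
    and w: "\<And>i x. i < k \<Longrightarrow> x \<in> M \<Longrightarrow> w i x = c * v i (\<phi> x)"
  shows "haar_system k w M"
  unfolding haar_system_def
proof (intro allI impI)
  fix \<alpha> :: "nat \<Rightarrow> real" assume \<alpha>: "\<exists>i<k. \<alpha> i \<noteq> 0"
  have lin: "lincomb k \<alpha> w x = c * lincomb k \<alpha> v (\<phi> x)" if "x \<in> M" for x
    unfolding lincomb_def sum_distrib_left
    by (intro sum.cong refl) (simp add: w[OF _ that])
  let ?Z = "{x\<in>M. lincomb k \<alpha> w x = 0}"
  have sub: "\<phi> ` ?Z \<subseteq> {x\<in>L. lincomb k \<alpha> v x = 0}"
    using \<phi>(2) lin c by auto
  have inj: "inj_on \<phi> ?Z" using \<phi>(1) by (rule inj_on_subset) auto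
  have "finite (\<phi> ` ?Z)" using finite_subset[OF sub haar_systemD(1)[OF h \<alpha>]] .
  moreover have "card (\<phi> ` ?Z) < k"
    using card_mono[OF haar_systemD(1)[OF h \<alpha>] sub] haar_systemD(2)[OF h \<alpha>] by simp
  ultimately show "finite ?Z \<and> card ?Z < k"
    using card_image[OF inj] finite_image_iff[OF inj] by simp
qed

text \<open>A homogeneous linear system with more unknowns than equations, solved by eliminating one
  unknown per equation.\<close>

lemma homogeneous_system_nontrivial:
  fixes v :: "'i \<Rightarrow> 'a \<Rightarrow> real"
  assumes "finite C" "finite I" "card C < card I"
  shows "\<exists>\<beta>. (\<exists>i\<in>I. \<beta> i \<noteq> 0) \<and> (\<forall>c\<in>C. (\<Sum>i\<in>I. \<beta> i * v i c) = 0)"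
  using assms
proof (induction C arbitrary: I v rule: finite_induct)
  case empty
  hence "I \<noteq> {}" by auto
  thus ?case by (intro exI[of _ "\<lambda>_. 1"]) auto
next
  case (insert c C)
  show ?case
  proof (cases "\<forall>i\<in>I. v i c = 0")
    case True
    have "card C < card I" using insert by simp
    then obtain \<beta> where \<beta>: "\<exists>i\<in>I. \<beta> i \<noteq> 0" "\<forall>c\<in>C. (\<Sum>i\<in>I. \<beta> i * v i c) = 0"
      using insert.IH[OF insert.prems(1)] by meson
    have "(\<Sum>i\<in>I. \<beta> i * v i c) = 0"
      using True by (intro sum.neutral) simp
    thus ?thesis using \<beta> by (intro exI[of _ \<beta>]) simp
  next
    case False
    then obtain p where p: "p \<in> I" "v p c \<noteq> 0" by blast
    define J where "J = I - {p}"
    define w where "w i x = v i x - v i c / v p c * v p x" for i x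
    have "finite J" "card C < card J"
      using insert p by (auto simp: J_def)
    then obtain \<beta> where \<beta>: "\<exists>i\<in>J. \<beta> i \<noteq> 0" "\<forall>x\<in>C. (\<Sum>i\<in>J. \<beta> i * w i x) = 0"
      using insert.IH[of J w] by blast
      \<comment> \<open>The coefficient at the pivot \<open>p\<close> is chosen so that the equation at \<open>c\<close> holds.\<close>
    define \<beta>' where "\<beta>' = \<beta>(p := - (\<Sum>i\<in>J. \<beta> i * v i c) / v p c)"
    have I: "I = insert p J" "p \<notin> J" "finite J"
      using p insert by (auto simp: J_def)
    have eq: "(\<Sum>i\<in>I. \<beta>' i * v i x) = (\<Sum>i\<in>J. \<beta> i * w i x)" for x
    proof -
      have "(\<Sum>i\<in>I. \<beta>' i * v i x) = \<beta>' p * v p x + (\<Sum>i\<in>J. \<beta>' i * v i x)"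
        using I by simp
      also have "(\<Sum>i\<in>J. \<beta>' i * v i x) = (\<Sum>i\<in>J. \<beta> i * v i x)"
        using I by (intro sum.cong) (auto simp: \<beta>'_def)
      also have "\<beta>' p * v p x = - (\<Sum>i\<in>J. \<beta> i * (v i c / v p c * v p x))"
        by (simp add: \<beta>'_def sum_divide_distrib sum_distrib_right mult.assoc)
      finally show ?thesis
        by (simp add: w_def right_diff_distrib sum_subtractf)
    qed
    have "(\<Sum>i\<in>J. \<beta> i * w i c) = 0"
      using p by (intro sum.neutral) (simp add: w_def)
    hence "\<forall>x\<in>insert c C. (\<Sum>i\<in>I. \<beta>' i * v i x) = 0"
      using \<beta>(2) eq by simp
    moreover have "\<exists>i\<in>I. \<beta>' i \<noteq> 0"
      using \<beta>(1) I by (auto simp: \<beta>'_def)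
    ultimately show ?thesis by blast
  qed
qed

lemma lincomb_with_zeros:
  assumes "finite C" "card C < k"
  obtains \<beta> where "\<exists>i<k. \<beta> i \<noteq> 0" "\<And>x. x \<in> C \<Longrightarrow> lincomb k \<beta> v x = 0"
  using homogeneous_system_nontrivial[of C "{..<k}" v] assms unfolding lincomb_def by auto

lemma constant_sign:
  fixes u :: "real \<Rightarrow> real"
  assumes u: "continuous_on {a<..<b} u" and nz: "\<And>x. x \<in> {a<..<b} \<Longrightarrow> u x \<noteq> 0"
  obtains s where "s \<in> {1, -1}" "\<And>x. x \<in> {a<..<b} \<Longrightarrow> s * u x > 0"
proof -
  have conn: "connected (u ` {a<..<b})"
    by (rule connected_continuous_image[OF u]) simp
  have "(\<forall>x\<in>{a<..<b}. u x > 0) \<or> (\<forall>x\<in>{a<..<b}. u x < 0)"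
  proof (rule ccontr)
    assume "\<not> ?thesis"
    then obtain x y where "x \<in> {a<..<b}" "y \<in> {a<..<b}" "u x \<le> 0" "0 \<le> u y"
      by (meson not_le)
    hence "0 \<in> u ` {a<..<b}"
      using connectedD_interval[OF conn, of "u x" "u y" 0] by blast
    thus False using nz by auto
  qed
  thus ?thesis using that[of 1] that[of "-1"] by auto
qed

text \<open>The set \<open>C\<close> of sign changes of \<open>u\<close> is encoded by the sign of a polynomial with simple roots
  at \<open>C\<close>. For two functions with the same sign changes, multiplying the two inequalities then shows
  at once that their product has constant sign. The induction splits off the largest zero.\<close>

lemma sign_change_set:
  fixes u :: "real \<Rightarrow> real"
  assumes "continuous_on {a<..<b} u" "finite {x\<in>{a<..<b}. u x = 0}"
  shows "\<exists>C s. s \<in> {1, -1} \<and> C \<subseteq> {x\<in>{a<..<b}. u x = 0} \<and>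
           (\<forall>x\<in>{a<..<b}. s * u x * (\<Prod>c\<in>C. x - c) \<ge> 0)"
  using assms
proof (induction "card {x\<in>{a<..<b}. u x = 0}" arbitrary: b rule: less_induct)
  case less
  let ?Z = "{x\<in>{a<..<b}. u x = 0}"
  show ?case
  proof (cases "?Z = {}")
    case True
    then obtain s where "s \<in> {1, -1}" "\<And>x. x \<in> {a<..<b} \<Longrightarrow> s * u x > 0"
      using constant_sign[OF less.prems(1)] by blast
    thus ?thesis by (intro exI[of _ "{}"] exI[of _ s]) (auto intro: less_imp_le)
  next
    case False
    define z where "z = Max ?Z"
    have zZ: "z \<in> ?Z" unfolding z_def using False less.prems(2) by (rule Max_in[rotated])
    have zmax: "x \<le> z" if "x \<in> ?Z" for x
      unfolding z_def using less.prems(2) that by (rule Max_ge)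
    have sub: "{x\<in>{a<..<z}. u x = 0} \<subset> ?Z"
      using zZ by auto
    have contl: "continuous_on {a<..<z} u" and contr: "continuous_on {z<..<b} u"
      using zZ by (auto intro!: continuous_on_subset[OF less.prems(1)])
    have finl: "finite {x\<in>{a<..<z}. u x = 0}"
      by (rule finite_subset[OF psubset_imp_subset[OF sub] less.prems(2)])
    from less.hyps[OF psubset_card_mono[OF less.prems(2) sub] contl finl]
    obtain C s where Cs: "s \<in> {1, -1}" "C \<subseteq> {x\<in>{a<..<z}. u x = 0}"
      and Cs': "\<forall>x\<in>{a<..<z}. s * u x * (\<Prod>c\<in>C. x - c) \<ge> 0"
      by (elim exE conjE)
    have nzr: "u x \<noteq> 0" if "x \<in> {z<..<b}" for x
      using zmax[of x] that zZ by force
    obtain s' where s': "s' \<in> {1, -1}" "\<And>x. x \<in> {z<..<b} \<Longrightarrow> s' * u x > 0"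
      using constant_sign[OF contr nzr] by blast
    have fin: "finite C"
      using Cs(2) finite_subset[OF psubset_imp_subset[OF sub] less.prems(2)] finite_subset by blast
    have pos: "(\<Prod>c\<in>C. x - c) > 0" if "x \<in> {z<..<b}" for x
      using Cs(2) that by (intro prod_pos) force
    show ?thesis
    proof (cases "s = s'")
      case True
      have "s * u x * (\<Prod>c\<in>C. x - c) \<ge> 0" if x: "x \<in> {a<..<b}" for x
      proof -
        consider "x \<in> {a<..<z}" | "x = z" | "x \<in> {z<..<b}" using x by fastforce
        thus ?thesis
        proof cases
          case 3
          thus ?thesis using s'(2)[OF 3] pos[OF 3] True by (simp add: less_imp_le)
        qed (use Cs' zZ in auto)
      qed
      moreover have "C \<subseteq> ?Z" using Cs(2) sub by blast
      ultimately show ?thesis using Cs(1) by blast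
    next
      case False
      hence s'_eq: "s' = - s" using Cs(1) s'(1) by auto
      have zC: "z \<notin> C" using Cs(2) by auto
      have "s' * u x * (\<Prod>c\<in>insert z C. x - c) \<ge> 0" if x: "x \<in> {a<..<b}" for x
      proof -
        have eq: "s' * u x * (\<Prod>c\<in>insert z C. x - c) = (s' * u x) * ((x - z) * (\<Prod>c\<in>C. x - c))"
          using fin zC by simp
        consider "x \<in> {a<..<z}" | "x = z" | "x \<in> {z<..<b}" using x by fastforce
        thus ?thesis
        proof cases
          case 1
          have "s' * u x * (\<Prod>c\<in>insert z C. x - c) = (z - x) * (s * u x * (\<Prod>c\<in>C. x - c))"
            unfolding eq unfolding s'_eq by (simp add: algebra_simps)
          also have "\<dots> \<ge> 0" by (rule mult_nonneg_nonneg[OF _ bspec[OF Cs' 1]]) (use 1 in auto)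
          finally show ?thesis .
        next
          case 3
          show ?thesis unfolding eq
            by (rule mult_nonneg_nonneg[OF less_imp_le[OF s'(2)[OF 3]]]) (use pos[OF 3] 3 in auto)
        qed (use zZ in auto)
      qed
      moreover have "insert z C \<subseteq> ?Z" using Cs(2) sub zZ by blast
      ultimately show ?thesis using s'(1) by blast
    qed
  qed
qed

text \<open>A combination of \<open>k\<close> functions that uses up all its \<open>k - 1\<close> zeros cannot touch zero
  without crossing it: pushed down slightly at the touching point, it would get two zeros there.\<close>

lemma haar_system_no_touching_zero:
  fixes v :: "nat \<Rightarrow> real \<Rightarrow> real"
  assumes h: "haar_system k v {a<..<b}"
    and cont: "\<And>i. i < k \<Longrightarrow> continuous_on {a<..<b} (v i)"
    and \<alpha>: "\<exists>i<k. \<alpha> i \<noteq> 0"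
    and C: "{x\<in>{a<..<b}. lincomb k \<alpha> v x = 0} = C" "Suc (card C) = k" "c \<in> C"
    and s: "s \<in> {1, -1::real}"
  shows "\<not> (\<forall>\<^sub>F x in nhds c. s * lincomb k \<alpha> v x \<ge> 0)"
proof
  assume "\<forall>\<^sub>F x in nhds c. s * lincomb k \<alpha> v x \<ge> 0"
  then obtain d1 where d1: "d1 > 0" "\<And>x. dist x c < d1 \<Longrightarrow> s * lincomb k \<alpha> v x \<ge> 0"
    unfolding eventually_nhds_metric by blast
  define w where "w = lincomb k \<alpha> v"
  have contl: "continuous_on {a<..<b} (lincomb k \<beta> v)" for \<beta>
    unfolding lincomb_def[abs_def] by (intro continuous_intros cont) simp
  have finC: "finite C" using haar_systemD(1)[OF h \<alpha>] C(1) by simp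
  have cL: "c \<in> {a<..<b}" "w c = 0" using C unfolding w_def by auto
  have "open ({a<..<b} - (C - {c}))" using finC by (intro open_Diff finite_imp_closed) auto
  then obtain d2 where d2: "d2 > 0" "ball c d2 \<subseteq> {a<..<b} - (C - {c})"
    using cL by (metis Diff_iff insertI1 open_contains_ball)
  define d where "d = min d1 d2 / 2"
  have d: "0 < d" "d < d1" "d < d2" using d1(1) d2(1) by (auto simp: d_def)
  have near: "x \<in> {a<..<b} \<and> s * w x \<ge> 0 \<and> (x \<noteq> c \<longrightarrow> x \<notin> C \<and> s * w x > 0)" if "\<bar>x - c\<bar> \<le> d" for x
  proof -
    have dist: "dist x c < d1" "dist c x < d2" using that d by (auto simp: dist_real_def)
    have 1: "x \<in> {a<..<b}" "x \<notin> C - {c}" using d2(2) dist(2) by (auto simp: subset_iff)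
    have 2: "s * w x \<ge> 0" using d1(2)[OF dist(1)] by (simp add: w_def)
    have "s * w x > 0" if "x \<noteq> c"
    proof -
      have "w x \<noteq> 0" using 1 C(1) that by (auto simp: w_def)
      thus ?thesis using 2 s by auto
    qed
    thus ?thesis using 1 2 by blast
  qed
  \<comment> \<open>The extra zero \<open>p\<close> of \<open>\<phi>\<close> exhausts the zeros it may have, which forces \<open>\<phi> c \<noteq> 0\<close>.\<close>
  have "infinite ({a<..<b} - C)" using cL finC by (intro Diff_infinite_finite) auto
  then obtain p where p: "p \<in> {a<..<b}" "p \<notin> C" by (metis Diff_iff ex_in_conv finite.emptyI)
  have cardC: "Suc (card (C - {c})) = card C"
    using finC C(3) by (rule card_Suc_Diff1)
  have "card (insert p (C - {c})) = Suc (card (C - {c}))"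
    using p finC by (intro card_insert_disjoint) auto
  hence "card (insert p (C - {c})) = card C" using cardC by simp
  then obtain \<beta> where \<beta>: "\<exists>i<k. \<beta> i \<noteq> 0" "\<And>x. x \<in> insert p (C - {c}) \<Longrightarrow> lincomb k \<beta> v x = 0"
    using lincomb_with_zeros[of "insert p (C - {c})" k v] finC C(2) by auto
  define \<phi> where "\<phi> = lincomb k \<beta> v"
  have "\<phi> c \<noteq> 0"
  proof
    assume "\<phi> c = 0"
    hence "card (insert p C) < k"
      using \<beta> p C unfolding \<phi>_def by (intro haar_system_card_less[OF h \<beta>(1)]) auto
    thus False using p finC C(2) by simp
  qed
  define x1 x2 where "x1 = c - d" and "x2 = c + d"
  have x12: "s * w x1 > 0" "s * w x2 > 0" using near[of x1] near[of x2] d by (auto simp: x1_def x2_def)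
  \<comment> \<open>\<open>\<epsilon>\<close> is so small that the perturbation does not change the sign at \<open>x1\<close> and \<open>x2\<close>.\<close>
  define M where "M = \<bar>\<phi> c * \<phi> x1\<bar> + \<bar>\<phi> c * \<phi> x2\<bar> + 1"
  define \<epsilon> where "\<epsilon> = min (s * w x1) (s * w x2) / M"
  have M: "M > 0" unfolding M_def by linarith
  have \<epsilon>: "\<epsilon> > 0" unfolding \<epsilon>_def using x12 M by simp
  have small: "\<epsilon> * (\<phi> c * \<phi> x) < s * w x" if "x \<in> {x1, x2}" for x
  proof -
    have "\<phi> c * \<phi> x < M"
    proof (cases "x = x1")
      case True
      show ?thesis unfolding True M_def by linarith
    next
      case False
      hence "x = x2" using that by simp
      show ?thesis unfolding \<open>x = x2\<close> M_def by linarith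
    qed
    hence "\<epsilon> * (\<phi> c * \<phi> x) < \<epsilon> * M" using \<epsilon> by simp
    also have "\<dots> \<le> s * w x" using that M unfolding \<epsilon>_def by auto
    finally show ?thesis .
  qed
  \<comment> \<open>The combination \<open>w - \<epsilon> s \<phi>(c) \<phi>\<close>: at \<open>c\<close> its product with \<open>s\<close> is \<open>- \<epsilon> \<phi>(c)\<^sup>2\<close>, and it keeps
    the zeros of \<open>w\<close> in \<open>C - {c}\<close>.\<close>
  define \<delta> where "\<delta> i = \<alpha> i - \<epsilon> * s * \<phi> c * \<beta> i" for i
  define u where "u = lincomb k \<delta> v"
  have ss: "s * s = 1" using s by auto
  have u: "u x = w x - \<epsilon> * s * \<phi> c * \<phi> x" for x
  proof -
    have "u x = lincomb k \<alpha> v x - \<epsilon> * s * \<phi> c * lincomb k \<beta> v x"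
      unfolding u_def \<delta>_def lincomb_def
      by (simp add: sum_subtractf sum_distrib_left algebra_simps)
    thus ?thesis by (simp add: w_def \<phi>_def)
  qed
  have su: "s * u x = s * w x - \<epsilon> * (\<phi> c * \<phi> x)" for x
  proof -
    have "s * u x = s * w x - (s * s) * (\<epsilon> * (\<phi> c * \<phi> x))"
      unfolding u by (simp add: algebra_simps)
    thus ?thesis using ss by simp
  qed
  have suc: "s * u c < 0"
    unfolding su using cL \<epsilon> \<open>\<phi> c \<noteq> 0\<close> by (simp add: zero_less_mult_iff not_square_less_zero less_le)
  have sux: "s * u x1 > 0" "s * u x2 > 0" using small su by auto
  have contu: "continuous_on {x1..x2} (\<lambda>x. s * u x)"
  proof -
    have "{x1..x2} \<subseteq> {a<..<b}"
    proof
      fix x assume "x \<in> {x1..x2}"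
      hence "\<bar>x - c\<bar> \<le> d" by (auto simp: x1_def x2_def)
      thus "x \<in> {a<..<b}" using near by blast
    qed
    thus ?thesis unfolding u_def by (intro continuous_intros continuous_on_subset[OF contl])
  qed
  have "\<exists>x\<ge>x1. x \<le> c \<and> s * u x = 0"
    using suc sux d by (intro IVT2' continuous_on_subset[OF contu]) (auto simp: x1_def x2_def)
  then obtain y1 where y1: "x1 \<le> y1" "y1 \<le> c" "s * u y1 = 0" by blast
  have "\<exists>x\<ge>c. x \<le> x2 \<and> s * u x = 0"
    using suc sux d by (intro IVT' continuous_on_subset[OF contu]) (auto simp: x1_def x2_def)
  then obtain y2 where y2: "c \<le> y2" "y2 \<le> x2" "s * u y2 = 0" by blast
  have ne: "y1 \<noteq> c" "y2 \<noteq> c" using y1 y2 suc by auto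
  have y1': "\<bar>y1 - c\<bar> \<le> d" and y2': "\<bar>y2 - c\<bar> \<le> d" using y1 y2 by (auto simp: x1_def x2_def)
  have yC: "y1 \<notin> C" "y2 \<notin> C" "y1 \<noteq> y2" "y1 \<in> {a<..<b}" "y2 \<in> {a<..<b}"
    using near[OF y1'] near[OF y2'] ne y1 y2 by auto
  have u0: "u y1 = 0" "u y2 = 0" using y1(3) y2(3) s by auto
  have \<delta>: "\<exists>i<k. \<delta> i \<noteq> 0"
  proof (rule ccontr)
    assume "\<not> ?thesis"
    hence "u c = 0" by (simp add: u_def lincomb_def)
    thus False using suc by simp
  qed
  have "card (insert y1 (insert y2 (C - {c}))) < k"
  proof (rule haar_system_card_less[OF h \<delta>])
    show "lincomb k \<delta> v x = 0" if "x \<in> insert y1 (insert y2 (C - {c}))" for x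
    proof -
      have "u x = 0" if x: "x \<in> C - {c}"
      proof -
        have "w x = 0" using x C(1) by (auto simp: w_def)
        moreover have "\<phi> x = 0" unfolding \<phi>_def using x \<beta>(2) by simp
        ultimately show ?thesis unfolding u by simp
      qed
      thus ?thesis using u0 that unfolding u_def by blast
    qed
    show "insert y1 (insert y2 (C - {c})) \<subseteq> {a<..<b}"
      using yC C(1) by blast
  qed
  moreover have "card (insert y1 (insert y2 (C - {c}))) = Suc (Suc (card (C - {c})))"
    using yC finC by (subst card_insert_disjoint; simp)+
  ultimately show False using C(2) cardC by simp
qed

text \<open>Linear algebra provides a nontrivial combination with zeros at \<open>C\<close>. The Haar condition leaves
  no room for further zeros, and none of the zeros is a mere touching point.\<close>

lemma haar_system_prescribed_sign_changes:
  fixes v :: "nat \<Rightarrow> real \<Rightarrow> real"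
  assumes h: "haar_system (Suc (card C)) v {a<..<b}"
    and cont: "\<And>i. i \<le> card C \<Longrightarrow> continuous_on {a<..<b} (v i)"
    and C: "finite C" "C \<subseteq> {a<..<b}"
  obtains \<beta> s where "s \<in> {1, -1}" "\<exists>i<Suc (card C). \<beta> i \<noteq> 0"
    "\<And>x. x \<in> {a<..<b} \<Longrightarrow> s * lincomb (Suc (card C)) \<beta> v x * (\<Prod>c\<in>C. x - c) \<ge> 0"
proof -
  obtain \<beta> where \<beta>: "\<exists>i<Suc (card C). \<beta> i \<noteq> 0"
    "\<And>x. x \<in> C \<Longrightarrow> lincomb (Suc (card C)) \<beta> v x = 0"
    using lincomb_with_zeros[OF C(1), of "Suc (card C)" v] by auto
  define w where "w = lincomb (Suc (card C)) \<beta> v"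
  let ?Z = "{x\<in>{a<..<b}. w x = 0}"
  have Z: "finite ?Z" "card ?Z \<le> card C"
    using haar_systemD[OF h \<beta>(1)] by (auto simp: w_def)
  have CZ: "?Z = C"
    using card_seteq[OF Z(1) _ Z(2)] C(2) \<beta>(2) unfolding w_def by blast
  have contw: "continuous_on {a<..<b} w"
    unfolding w_def lincomb_def[abs_def] by (intro continuous_intros cont) simp
  obtain D s where D: "s \<in> {1, -1}" "D \<subseteq> ?Z" "\<And>x. x \<in> {a<..<b} \<Longrightarrow> s * w x * (\<Prod>c\<in>D. x - c) \<ge> 0"
    using sign_change_set[OF contw Z(1)] by blast
  have finD: "finite D" using D(2) Z(1) finite_subset by blast
  have "C \<subseteq> D"
  proof (rule ccontr)
    assume "\<not> ?thesis"
    then obtain c where c: "c \<in> C" "c \<notin> D" by blast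
    define q where "q x = (\<Prod>c\<in>D. x - c)" for x
    have qc: "q c \<noteq> 0" unfolding q_def using finD c(2) by auto
    define t where "t = s * sgn (q c)"
    have t: "t \<in> {1, -1}" using D(1) qc by (auto simp: t_def sgn_if)
    have "isCont q c" unfolding q_def by (intro continuous_intros)
    hence "((\<lambda>x. q x * sgn (q c)) \<longlongrightarrow> q c * sgn (q c)) (nhds c)"
      unfolding continuous_at tendsto_at_iff_tendsto_nhds by (intro tendsto_intros)
    moreover have "q c * sgn (q c) > 0" using qc by (simp add: sgn_if)
    ultimately have "\<forall>\<^sub>F x in nhds c. q x * sgn (q c) > 0"
      by (rule order_tendstoD(1))
    moreover have "\<forall>\<^sub>F x in nhds c. x \<in> {a<..<b}"
      using c C by (intro eventually_nhds_in_open) auto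
    ultimately have "\<forall>\<^sub>F x in nhds c. t * w x \<ge> 0"
    proof eventually_elim
      case (elim x)
      have "sgn (q c) * sgn (q c) = 1" using qc by (simp add: sgn_if)
      hence "(t * w x) * (q x * sgn (q c)) = s * w x * q x"
        by (simp add: t_def algebra_simps)
      also have "\<dots> \<ge> 0" using D(3)[OF elim(2)] by (simp add: q_def)
      finally show ?case using elim(1) by (simp add: zero_le_mult_iff)
    qed
    moreover have "\<not> (\<forall>\<^sub>F x in nhds c. t * w x \<ge> 0)"
      unfolding w_def
      by (rule haar_system_no_touching_zero[OF h _ \<beta>(1) _ refl c(1) t])
         (use cont CZ in \<open>auto simp: w_def\<close>)
    ultimately show False by blast
  qed
  hence "D = C" using D(2) CZ by auto
  thus ?thesis using that[OF D(1) \<beta>(1)] D(3) unfolding w_def by blast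
qed

text \<open>Continuous functions spanning Haar systems cannot be orthogonal: to a combination of the
  \<open>F i\<close> there is a combination of the \<open>K j\<close> with the same sign changes, and the product of
  the two has constant sign.\<close>

lemma haar_systems_not_orthogonal:
  fixes F K :: "nat \<Rightarrow> real \<Rightarrow> real"
  assumes ab: "a < b"
    and F: "haar_system k F {a<..<b}" "\<And>i. i < k \<Longrightarrow> continuous_on {a<..<b} (F i)"
    and K: "\<And>j. j \<in> {1..k} \<Longrightarrow> haar_system j K {a<..<b}"
           "\<And>i. i < k \<Longrightarrow> continuous_on {a<..<b} (K i)"
    and \<alpha>: "\<exists>i<k. \<alpha> i \<noteq> 0"
    and orth: "\<And>j. j < k \<Longrightarrow> ((\<lambda>t. lincomb k \<alpha> F t * K j t) has_integral 0) {a..b}"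
  shows False
proof -
  define u where "u = lincomb k \<alpha> F"
  have contu: "continuous_on {a<..<b} u"
    unfolding u_def lincomb_def[abs_def] by (intro continuous_intros F) simp
  have Z: "finite {x\<in>{a<..<b}. u x = 0}" "card {x\<in>{a<..<b}. u x = 0} < k"
    using haar_systemD[OF F(1) \<alpha>] by (auto simp: u_def)
  obtain C s where C: "s \<in> {1, -1}" "C \<subseteq> {x\<in>{a<..<b}. u x = 0}"
    "\<And>x. x \<in> {a<..<b} \<Longrightarrow> s * u x * (\<Prod>c\<in>C. x - c) \<ge> 0"
    using sign_change_set[OF contu Z(1)] by blast
  have finC: "finite C" using C(2) Z(1) finite_subset by blast
  have cardC: "card C < k" using card_mono[OF Z(1) C(2)] Z(2) by simp
  let ?r = "Suc (card C)"
  have "haar_system ?r K {a<..<b}" using K(1) cardC by simp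
  moreover have "continuous_on {a<..<b} (K i)" if "i \<le> card C" for i
    using K(2) that cardC by simp
  moreover have "C \<subseteq> {a<..<b}" using C(2) by blast
  ultimately obtain \<beta> t where \<beta>: "t \<in> {1, -1}" "\<exists>i<?r. \<beta> i \<noteq> 0"
    "\<And>x. x \<in> {a<..<b} \<Longrightarrow> t * lincomb ?r \<beta> K x * (\<Prod>c\<in>C. x - c) \<ge> 0"
    using haar_system_prescribed_sign_changes[of C K a b, OF _ _ finC] by metis
  define w where "w = lincomb ?r \<beta> K"
  have contw: "continuous_on {a<..<b} w"
    unfolding w_def lincomb_def[abs_def] using cardC by (intro continuous_intros K) simp
  define p where "p x = s * t * (u x * w x)" for x
  have contp: "continuous_on {a<..<b} p"
    unfolding p_def by (intro continuous_intros contu contw)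
  have "((\<lambda>x. \<Sum>j<?r. \<beta> j * (u x * K j x)) has_integral (\<Sum>j<?r. \<beta> j * 0)) {a..b}"
    using cardC unfolding u_def
    by (intro has_integral_sum has_integral_mult_right orth) auto
  moreover have "(\<Sum>j<?r. \<beta> j * (u x * K j x)) = u x * w x" for x
    by (simp only: w_def lincomb_def sum_distrib_left mult.left_commute)
  ultimately have "((\<lambda>x. u x * w x) has_integral 0) {a..b}" by simp
  hence int: "(p has_integral 0) {a..b}"
    unfolding p_def using has_integral_mult_right[of "\<lambda>x. u x * w x" 0 "{a..b}" "s * t"] by simp
  have pnonneg: "p x \<ge> 0" if x: "x \<in> {a<..<b}" for x
  proof (cases "x \<in> C")
    case True
    hence "u x = 0" using C(2) by blast
    thus ?thesis by (simp add: p_def)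
  next
    case False
    define q where "q = (\<Prod>c\<in>C. x - c)"
    have "q \<noteq> 0" unfolding q_def using finC False by auto
    hence "q * q > 0" by (simp add: zero_less_mult_iff) linarith
    moreover have "0 \<le> (s * u x * q) * (t * w x * q)"
      unfolding q_def w_def by (intro mult_nonneg_nonneg C(3)[OF x] \<beta>(3)[OF x])
    hence "0 \<le> p x * (q * q)" by (simp add: p_def algebra_simps)
    ultimately show ?thesis by (simp add: zero_le_mult_iff)
  qed
  have "finite ({x\<in>{a<..<b}. u x = 0} \<union> {x\<in>{a<..<b}. w x = 0})"
    using Z(1) haar_systemD(1)[OF K(1) \<beta>(2)] cardC by (simp add: w_def)
  moreover have "infinite {a<..<b}" using ab by simp
  ultimately obtain x0 where x0: "x0 \<in> {a<..<b}" "u x0 \<noteq> 0" "w x0 \<noteq> 0"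
    using finite_subset[of "{a<..<b}" "{x\<in>{a<..<b}. u x = 0} \<union> {x\<in>{a<..<b}. w x = 0}"] by blast
  define c d where "c = (a + x0) / 2" and "d = (x0 + b) / 2"
  have cd: "a < c" "c < x0" "x0 < d" "d < b" using x0(1) by (auto simp: c_def d_def)
  have int': "p integrable_on {c..d}"
    using cd by (intro integrable_continuous_interval continuous_on_subset[OF contp]) auto
  have "(p has_integral 0) {a<..<b}"
    using int by (simp add: has_integral_Icc_iff_Ioo)
  hence "integral {a<..<b} p = 0" "p integrable_on {a<..<b}" by auto
  moreover have "{c..d} \<subseteq> {a<..<b}" using cd by auto
  ultimately have "integral {c..d} p \<le> 0"
    using integral_subset_le[of "{c..d}" "{a<..<b}" p] int' pnonneg cd by auto
  moreover have "integral {c..d} p \<ge> 0"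
    using cd by (intro integral_nonneg int' pnonneg) auto
  ultimately have "(p has_integral 0) {c..d}"
    using int' by (metis antisym integrable_integral)
  hence "p x0 = 0"
  proof (intro has_integral_0_cbox_imp_0[of c d p x0])
    show "continuous_on (cbox c d) p"
      using cd by (intro continuous_on_subset[OF contp]) auto
    show "p x \<ge> 0" if "x \<in> box c d" for x
      using that cd by (intro pnonneg) auto
  qed (use cd in auto)
  thus False using x0 C(1) \<beta>(1) by (auto simp: p_def)
qed

section \<open>Convolutions of analytic functions with integrable singularities\<close>

lemma real_analytic_on_holomorphic_extension_deriv:
  assumes f: "f real_analytic_on S" and S: "open S" "connected S"
  obtains U F where "open U" "complex_of_real ` S \<subseteq> U" "F holomorphic_on U"
    "\<And>x. x \<in> S \<Longrightarrow> F (of_real x) = of_real (f x)"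
    "\<And>x. x \<in> S \<Longrightarrow> deriv F (of_real x) = of_real (deriv f x)"
proof -
  obtain U F where U: "open U" "complex_of_real ` S \<subseteq> U" "F holomorphic_on U"
    and F: "\<And>x. x \<in> S \<Longrightarrow> F (of_real x) = of_real (f x)"
    using real_analytic_on_holomorphic_extension[OF f S] by metis
  have "deriv F (of_real x) = of_real (deriv f x)" if "x \<in> S" for x
  proof (rule real_analytic_on_deriv_aux(2))
    have "of_real x \<in> U" using U(2) that by blast
    thus "F analytic_on {of_real x}"
      using U(1,3) analytic_at by blast
    show "\<forall>\<^sub>F y in nhds x. F (of_real y) = of_real (f y)"
      by (rule eventually_mono[OF eventually_nhds_in_open[OF S(1) that] F])
  qed
  thus ?thesis using that U F by blast
qed

text \<open>Analyticity is obtained by differentiating a holomorphic extension of the integrand under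
  the integral sign.\<close>

lemma real_analytic_parameter_integral:
  fixes p p' :: "complex \<Rightarrow> real \<Rightarrow> complex" and q :: "real \<Rightarrow> real \<Rightarrow> real"
  assumes r: "r > 0"
    and deriv: "\<And>z t. z \<in> ball (of_real h) r \<Longrightarrow> t \<in> {a..b} \<Longrightarrow>
           ((\<lambda>z. p z t) has_field_derivative p' z t) (at z)"
    and contp: "continuous_on (ball (of_real h) r \<times> {a..b}) (\<lambda>(z, t). p z t)"
    and contp': "continuous_on (ball (of_real h) r \<times> {a..b}) (\<lambda>(z, t). p' z t)"
    and real: "\<And>x t. \<bar>x - h\<bar> < r \<Longrightarrow> t \<in> {a..b} \<Longrightarrow> p (of_real x) t = of_real (q x t)"
  shows "(\<lambda>x. integral {a..b} (q x)) real_analytic_on {h}"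
    and "((\<lambda>x. integral {a..b} (q x)) has_real_derivative
            integral {a..b} (\<lambda>t. Re (p' (of_real h) t))) (at h)"
proof -
  let ?B = "ball (complex_of_real h) r"
  define G where "G z = integral (cbox a b) (p z)" for z
  have slice: "continuous_on (cbox a b) (p z)" "continuous_on (cbox a b) (p' z)" if "z \<in> ?B" for z
  proof -
    have 1: "continuous_on {a..b} (\<lambda>t. (z, t))" by (intro continuous_intros)
    have 2: "(\<lambda>t. (z, t)) ` {a..b} \<subseteq> ?B \<times> {a..b}" using that by auto
    show "continuous_on (cbox a b) (p z)" "continuous_on (cbox a b) (p' z)"
      using continuous_on_compose2[OF contp 1 2] continuous_on_compose2[OF contp' 1 2] by simp_all
  qed
  have DG: "(G has_field_derivative integral (cbox a b) (p' z)) (at z)" if z: "z \<in> ?B" for z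
  proof -
    have "(G has_field_derivative integral (cbox a b) (p' z)) (at z within ?B)"
      unfolding G_def
    proof (rule leibniz_rule_field_derivative)
      show "((\<lambda>z. p z t) has_field_derivative p' z t) (at z within ?B)"
        if "z \<in> ?B" "t \<in> cbox a b" for z t
        using deriv that by (intro DERIV_subset[OF deriv]) auto
      show "p z integrable_on cbox a b" if "z \<in> ?B" for z
        by (rule integrable_continuous[OF slice(1)[OF that]])
    qed (use contp' z in auto)
    thus ?thesis using z at_within_open[OF z] by simp
  qed
  have "G holomorphic_on ?B"
    unfolding holomorphic_on_open[OF open_ball]
  proof
    fix z assume "z \<in> ?B"
    from DG[OF this] show "\<exists>f'. (G has_field_derivative f') (at z)" ..
  qed
  hence G_an: "G analytic_on {of_real h}"
    using r analytic_at by (metis centre_in_ball open_ball)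
  have Gq: "G (of_real x) = of_real (integral {a..b} (q x))" if x: "\<bar>x - h\<bar> < r" for x
  proof -
    have xB: "of_real x \<in> ?B"
      using x by (simp add: dist_real_def abs_minus_commute flip: dist_of_real[where 'a = complex])
    have "p (of_real x) integrable_on cbox a b"
      by (rule integrable_continuous[OF slice(1)[OF xB]])
    hence "(p (of_real x) has_integral G (of_real x)) {a..b}"
      unfolding G_def by (simp add: integrable_integral)
    hence "((\<lambda>t. complex_of_real (q x t)) has_integral G (of_real x)) {a..b}"
      by (rule has_integral_eq[rotated]) (use real[OF x] in auto)
    from has_integral_Re[OF this] has_integral_Im[OF this]
    have "integral {a..b} (q x) = Re (G (of_real x))" "Im (G (of_real x)) = 0"
      by (auto simp: integral_unique)
    thus ?thesis by (simp add: complex_eq_iff)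
  qed
  have ev: "\<forall>\<^sub>F x in nhds h. G (of_real x) = of_real (integral {a..b} (q x))"
    unfolding eventually_nhds_metric using Gq r by (auto simp: dist_real_def)
  show "(\<lambda>x. integral {a..b} (q x)) real_analytic_on {h}"
    unfolding real_analytic_on_iff_complex using G_an ev by blast
  have hB: "of_real h \<in> ?B" using r by simp
  have "deriv G (of_real h) = integral {a..b} (p' (of_real h))"
    using DERIV_imp_deriv[OF DG[OF hB]] by simp
  hence "Re (deriv G (of_real h)) = integral {a..b} (\<lambda>t. Re (p' (of_real h) t))"
    using integrable_continuous[OF slice(2)[OF hB]]
    by (metis box_real(2) has_integral_Re integrable_integral integral_unique)
  thus "((\<lambda>x. integral {a..b} (q x)) has_real_derivative
            integral {a..b} (\<lambda>t. Re (p' (of_real h) t))) (at h)"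
    using real_analytic_on_deriv_aux(1)[OF G_an ev] by simp
qed

lemma compact_subset_open_imp_radius:
  fixes K U :: "'a::heine_borel set"
  assumes "compact K" "open U" "K \<subseteq> U"
  obtains e where "e > 0" "\<And>x y. x \<in> K \<Longrightarrow> dist x y < e \<Longrightarrow> y \<in> U"
proof -
  obtain e where "e > 0" "(\<Union>x\<in>K. ball x e) \<subseteq> U"
    using compact_subset_open_imp_ball_epsilon_subset[OF assms] by blast
  show ?thesis
  proof (rule that[OF \<open>e > 0\<close>])
    fix x y assume "x \<in> K" "dist x y < e"
    hence "y \<in> (\<Union>x\<in>K. ball x e)" by auto
    thus "y \<in> U" using \<open>(\<Union>x\<in>K. ball x e) \<subseteq> U\<close> by blast
  qed
qed

text \<open>The arguments \<open>h - t\<close> fill a compact interval, so one radius works for the holomorphic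
  extension of all translates.\<close>

lemma real_analytic_translation_integral:
  fixes u N :: "real \<Rightarrow> real"
  assumes L: "open L" "connected L" and N: "N real_analytic_on L"
    and u: "continuous_on {0..a} u" and sub: "{h - a..h} \<subseteq> L"
  shows "(\<lambda>x. integral {0..a} (\<lambda>t. u t * N (x - t))) real_analytic_on {h}"
    and "((\<lambda>x. integral {0..a} (\<lambda>t. u t * N (x - t))) has_real_derivative
            integral {0..a} (\<lambda>t. u t * deriv N (h - t))) (at h)"
proof -
  obtain U G where U: "open U" "complex_of_real ` L \<subseteq> U" "G holomorphic_on U"
    and G: "\<And>x. x \<in> L \<Longrightarrow> G (of_real x) = of_real (N x)"
      "\<And>x. x \<in> L \<Longrightarrow> deriv G (of_real x) = of_real (deriv N x)"
    using real_analytic_on_holomorphic_extension_deriv[OF N L] by metis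
  have "compact (complex_of_real ` {h - a..h})"
    by (intro compact_continuous_image continuous_intros) auto
  then obtain e1 where e1: "e1 > 0"
    "\<And>x y. x \<in> complex_of_real ` {h - a..h} \<Longrightarrow> dist x y < e1 \<Longrightarrow> y \<in> U"
    using compact_subset_open_imp_radius[OF _ U(1)] sub U(2) by (metis image_mono subset_trans)
  obtain e2 where e2: "e2 > 0" "\<And>x y. x \<in> {h - a..h} \<Longrightarrow> dist x y < e2 \<Longrightarrow> y \<in> L"
    using compact_subset_open_imp_radius[OF _ L(1) sub] by (metis compact_Icc)
  define r where "r = min e1 e2"
  have r: "r > 0" using e1 e2 by (simp add: r_def)
  have inU: "z - of_real t \<in> U" if "z \<in> ball (of_real h) r" "t \<in> {0..a}" for z t
  proof (rule e1(2))
    show "complex_of_real (h - t) \<in> complex_of_real ` {h - a..h}"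
      using that by (intro imageI) auto
    have "dist (complex_of_real (h - t)) (z - of_real t) = dist (of_real h) z"
      by (simp add: dist_norm)
    thus "dist (complex_of_real (h - t)) (z - of_real t) < e1" using that by (simp add: r_def)
  qed
  have inL: "x - t \<in> L" if "\<bar>x - h\<bar> < r" "t \<in> {0..a}" for x t
    using that by (intro e2(2)[of "h - t"]) (auto simp: r_def dist_real_def)
  define p where "p z t = of_real (u t) * G (z - of_real t)" for z t
  define p' where "p' z t = of_real (u t) * deriv G (z - of_real t)" for z t
  have contG: "continuous_on U G" "continuous_on U (deriv G)"
    using U by (auto intro!: holomorphic_on_imp_continuous_on holomorphic_deriv)
  have map: "continuous_on (ball (of_real h) r \<times> {0..a}) (\<lambda>x. fst x - complex_of_real (snd x))"
    by (intro continuous_intros)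
  have mapim: "(\<lambda>x. fst x - complex_of_real (snd x)) ` (ball (of_real h) r \<times> {0..a}) \<subseteq> U"
    using inU by auto
  have uc: "continuous_on (ball (of_real h) r \<times> {0..a}) (\<lambda>x. complex_of_real (u (snd x)))"
    by (intro continuous_intros continuous_on_compose2[OF u]) auto
  have cont: "continuous_on (ball (of_real h) r \<times> {0..a}) (\<lambda>(z, t). p z t)"
    "continuous_on (ball (of_real h) r \<times> {0..a}) (\<lambda>(z, t). p' z t)"
    unfolding p_def p'_def case_prod_beta
    by (intro continuous_on_mult uc continuous_on_compose2[OF contG(1) map mapim]
          continuous_on_compose2[OF contG(2) map mapim])+
  have der: "((\<lambda>z. p z t) has_field_derivative p' z t) (at z)"
    if "z \<in> ball (of_real h) r" "t \<in> {0..a}" for z t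
  proof -
    have "(G has_field_derivative deriv G (z - of_real t)) (at (z - of_real t))"
      using holomorphic_derivI[OF U(3,1) inU[OF that]] .
    hence "((\<lambda>z. G (z - of_real t)) has_field_derivative deriv G (z - of_real t) * 1) (at z)"
      by (rule DERIV_chain2) (auto intro!: derivative_eq_intros)
    from DERIV_cmult[OF this, of "of_real (u t)"] show ?thesis unfolding p_def p'_def by simp
  qed
  have re: "p (of_real x) t = of_real (u t * N (x - t))" if "\<bar>x - h\<bar> < r" "t \<in> {0..a}" for x t
    unfolding p_def using G(1)[OF inL[OF that]] by simp
  show "(\<lambda>x. integral {0..a} (\<lambda>t. u t * N (x - t))) real_analytic_on {h}"
    by (rule real_analytic_parameter_integral(1)[OF r der cont re])
  have "integral {0..a} (\<lambda>t. Re (p' (of_real h) t)) = integral {0..a} (\<lambda>t. u t * deriv N (h - t))"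
  proof (rule integral_cong)
    fix t assume "t \<in> {0..a}"
    hence "h - t \<in> L" using inL[of h t] r by simp
    thus "Re (p' (of_real h) t) = u t * deriv N (h - t)"
      using G(2)[of "h - t"] by (simp add: p'_def)
  qed
  thus "((\<lambda>x. integral {0..a} (\<lambda>t. u t * N (x - t))) has_real_derivative
            integral {0..a} (\<lambda>t. u t * deriv N (h - t))) (at h)"
    using real_analytic_parameter_integral(2)[OF r der cont re] by simp
qed

text \<open>Integration by parts trades the singular factor \<open>F\<close> for its continuous primitive.\<close>

lemma end_piece_has_integral:
  fixes F F1 N :: "real \<Rightarrow> real"
  assumes a: "a > 0" and F1: "continuous_on {0..a} F1" "F1 0 = 0"
      "\<And>t. 0 < t \<Longrightarrow> t < a \<Longrightarrow> (F1 has_real_derivative F t) (at t)"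
    and N: "N real_analytic_on L" and sub: "{h - a..h} \<subseteq> L"
  shows "((\<lambda>t. F t * N (h - t)) has_integral
     (F1 a * N (h - a) + integral {0..a} (\<lambda>t. F1 t * deriv N (h - t)))) {0..a}"
proof -
  have inL: "h - t \<in> L" if "t \<in> {0..a}" for t
    using sub that by auto
  have refl: "continuous_on {0..a} (\<lambda>t. f (h - t))" if "f real_analytic_on L" for f
    by (rule continuous_on_compose2[OF real_analytic_on_imp_continuous_on[OF that]])
       (use sub in \<open>auto intro!: continuous_intros\<close>)
  have "((\<lambda>t. F t * N (h - t) - F1 t * deriv N (h - t)) has_integral
      (F1 a * N (h - a) - F1 0 * N (h - 0))) {0..a}"
  proof (rule fundamental_theorem_of_calculus_interior)
    show "continuous_on {0..a} (\<lambda>t. F1 t * N (h - t))"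
      by (intro continuous_intros F1 refl N)
    fix t assume t: "t \<in> {0<..<a}"
    have "(N has_real_derivative deriv N (h - t)) (at (h - t))"
      using real_analytic_on_imp_DERIV[OF N inL] t by simp
    hence "((\<lambda>t. N (h - t)) has_real_derivative deriv N (h - t) * (0 - 1)) (at t)"
      by (rule DERIV_chain2) (intro derivative_intros)
    from DERIV_mult[OF F1(3) this]
    have "((\<lambda>t. F1 t * N (h - t)) has_real_derivative
        (F t * N (h - t) - F1 t * deriv N (h - t))) (at t)"
      using t by (simp add: algebra_simps)
    thus "((\<lambda>t. F1 t * N (h - t)) has_vector_derivative
        (F t * N (h - t) - F1 t * deriv N (h - t))) (at t)"
      by (simp add: has_real_derivative_iff_has_vector_derivative)
  qed (use a in simp)
  moreover have "(\<lambda>t. F1 t * deriv N (h - t)) integrable_on {0..a}"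
    by (intro integrable_continuous_interval continuous_intros F1 refl real_analytic_on_deriv N)
  ultimately have "((\<lambda>t. (F t * N (h - t) - F1 t * deriv N (h - t)) + F1 t * deriv N (h - t))
     has_integral ((F1 a * N (h - a) - F1 0 * N (h - 0)) +
       integral {0..a} (\<lambda>t. F1 t * deriv N (h - t)))) {0..a}"
    by (intro has_integral_add integrable_integral)
  thus ?thesis using F1(2) by simp
qed

text \<open>After integration by parts the integrand is continuous and can be differentiated. The same
  integration by parts with \<open>N'\<close> in place of \<open>N\<close> brings the derivative back to its expected form.\<close>

lemma end_piece_real_analytic:
  fixes F F1 N :: "real \<Rightarrow> real"
  assumes a: "a > 0" and F1: "continuous_on {0..a} F1" "F1 0 = 0"
      "\<And>t. 0 < t \<Longrightarrow> t < a \<Longrightarrow> (F1 has_real_derivative F t) (at t)"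
    and L: "open L" "connected L" and N: "N real_analytic_on L" and sub: "{h - a..h} \<subseteq> L"
  shows "(\<lambda>x. integral {0..a} (\<lambda>t. F t * N (x - t))) real_analytic_on {h}"
    and "((\<lambda>x. integral {0..a} (\<lambda>t. F t * N (x - t))) has_real_derivative
            integral {0..a} (\<lambda>t. F t * deriv N (h - t))) (at h)"
proof -
  let ?G = "\<lambda>x. F1 a * N (x - a) + integral {0..a} (\<lambda>t. F1 t * deriv N (x - t))"
  have dN: "deriv N real_analytic_on L" by (rule real_analytic_on_deriv[OF N])
  obtain e where e: "e > 0" "\<And>x y. x \<in> {h - a..h} \<Longrightarrow> dist x y < e \<Longrightarrow> y \<in> L"
    using compact_subset_open_imp_radius[OF _ L(1) sub] by (metis compact_Icc)
  have eq: "?G x = integral {0..a} (\<lambda>t. F t * N (x - t))" if "dist x h < e" for x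
  proof -
    have "{x - a..x} \<subseteq> L"
    proof
      fix y assume "y \<in> {x - a..x}"
      thus "y \<in> L" using that by (intro e(2)[of "y - x + h"]) (auto simp: dist_real_def)
    qed
    from integral_unique[OF end_piece_has_integral[OF a F1 N this]] show ?thesis by simp
  qed
  have ev: "\<forall>\<^sub>F x in nhds h. ?G x = integral {0..a} (\<lambda>t. F t * N (x - t))"
    unfolding eventually_nhds_metric using eq e(1) by blast
  have hL: "h - a \<in> L" using sub a by auto
  have shift: "(\<lambda>x. N (x - a)) real_analytic_on {h}"
    using hL by (intro real_analytic_on_compose[OF N] real_analytic_on_diff) auto
  have "?G real_analytic_on {h}"
    by (intro real_analytic_on_add real_analytic_on_mult real_analytic_on_const shift
          real_analytic_translation_integral(1)[OF L dN F1(1) sub])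
  thus "(\<lambda>x. integral {0..a} (\<lambda>t. F t * N (x - t))) real_analytic_on {h}"
    using ev by (rule real_analytic_on_cong_ev)
  have "(N has_real_derivative deriv N (h - a)) (at (h - a))"
    using real_analytic_on_imp_DERIV[OF N hL] .
  hence "((\<lambda>x. N (x - a)) has_real_derivative deriv N (h - a) * 1) (at h)"
    by (rule DERIV_chain2) (auto intro!: derivative_eq_intros)
  from DERIV_add[OF DERIV_cmult[OF this, of "F1 a"]
      real_analytic_translation_integral(2)[OF L dN F1(1) sub]]
  have "(?G has_real_derivative (F1 a * deriv N (h - a) +
      integral {0..a} (\<lambda>t. F1 t * deriv (deriv N) (h - t)))) (at h)"
    by simp
  also have "F1 a * deriv N (h - a) + integral {0..a} (\<lambda>t. F1 t * deriv (deriv N) (h - t))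
      = integral {0..a} (\<lambda>t. F t * deriv N (h - t))"
    using integral_unique[OF end_piece_has_integral[OF a F1 dN sub]] by simp
  finally show "((\<lambda>x. integral {0..a} (\<lambda>t. F t * N (x - t))) has_real_derivative
            integral {0..a} (\<lambda>t. F t * deriv N (h - t))) (at h)"
    using DERIV_cong_ev[OF refl ev refl] by blast
qed

text \<open>Both factors are regular here, but the domain of integration moves with \<open>x\<close>; a substitution
  makes it constant and shifts the dependence on \<open>x\<close> into the integrand.\<close>

lemma middle_piece_real_analytic:
  fixes F M :: "real \<Rightarrow> real"
  assumes L: "open L" "connected L" and F: "F real_analytic_on L" and M: "M real_analytic_on L"
    and ab: "a + b < h" and sub: "{a..h - b} \<subseteq> L" "{b..h - a} \<subseteq> L"
  shows "(\<lambda>x. integral {a..x - b} (\<lambda>t. F t * M (x - t))) real_analytic_on {h}"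
    and "((\<lambda>x. integral {a..x - b} (\<lambda>t. F t * M (x - t))) has_real_derivative
            F (h - b) * M b + integral {a..h - b} (\<lambda>t. F t * deriv M (h - t))) (at h)"
proof -
  define l where "l = h - a - b"
  have l: "l > 0" using ab by (simp add: l_def)
  obtain U1 F' where U1: "open U1" "complex_of_real ` L \<subseteq> U1" "F' holomorphic_on U1"
    and F': "\<And>x. x \<in> L \<Longrightarrow> F' (of_real x) = of_real (F x)"
      "\<And>x. x \<in> L \<Longrightarrow> deriv F' (of_real x) = of_real (deriv F x)"
    using real_analytic_on_holomorphic_extension_deriv[OF F L] by metis
  obtain U2 M' where U2: "open U2" "complex_of_real ` L \<subseteq> U2" "M' holomorphic_on U2"
    and M': "\<And>x. x \<in> L \<Longrightarrow> M' (of_real x) = of_real (M x)"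
      "\<And>x. x \<in> L \<Longrightarrow> deriv M' (of_real x) = of_real (deriv M x)"
    using real_analytic_on_holomorphic_extension_deriv[OF M L] by metis
  define K where "K = {a..h - b} \<union> {b..h - a}"
  have KL: "K \<subseteq> L" using sub by (simp add: K_def)
  have compK: "compact K" unfolding K_def by (intro compact_Un) auto
  have "compact (complex_of_real ` K)"
    by (intro compact_continuous_image continuous_intros compK)
  moreover have "open (U1 \<inter> U2)" "complex_of_real ` K \<subseteq> U1 \<inter> U2"
    using U1 U2 KL by blast+
  ultimately obtain e1 where e1: "e1 > 0"
    "\<And>x y. x \<in> complex_of_real ` K \<Longrightarrow> dist x y < e1 \<Longrightarrow> y \<in> U1 \<inter> U2"
    using compact_subset_open_imp_radius by metis
  obtain e2 where e2: "e2 > 0" "\<And>x y. x \<in> K \<Longrightarrow> dist x y < e2 \<Longrightarrow> y \<in> L"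
    using compact_subset_open_imp_radius[OF compK L(1) KL] by metis
  define r where "r = min (min e1 e2) l"
  have r: "r > 0" using e1 e2 l by (simp add: r_def)
  have pts: "a + t * l \<in> K" "b + (1 - t) * l \<in> K" if "t \<in> {0..1}" for t
  proof -
    have "0 \<le> t * l" using that l by simp
    moreover have "t * l \<le> 1 * l" using that l by (intro mult_right_mono) auto
    ultimately show "a + t * l \<in> K" "b + (1 - t) * l \<in> K"
      by (auto simp: K_def l_def algebra_simps)
  qed
  have tz: "cmod (of_real t * (w - z)) \<le> cmod (w - z)" if "t \<in> {0..1}" for t :: real and w z :: complex
    using that by (simp add: norm_mult mult_left_le_one_le)
  have inU: "of_real c + of_real t * z \<in> U1 \<inter> U2"
    if z: "z \<in> ball (of_real l) r" and t: "t \<in> {0..1}" and c: "c + t * l \<in> K" for z t c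
  proof (rule e1(2)[OF imageI[OF c]])
    have "dist (complex_of_real (c + t * l)) (of_real c + of_real t * z)
        = cmod (of_real t * (of_real l - z))"
      by (simp add: dist_norm algebra_simps)
    also have "\<dots> \<le> cmod (of_real l - z)" by (rule tz[OF t])
    also have "\<dots> < e1" using z by (simp add: r_def dist_norm)
    finally show "dist (complex_of_real (c + t * l)) (of_real c + of_real t * z) < e1" .
  qed
  have inL: "c + t * x \<in> L" if x: "\<bar>x - l\<bar> < r" and t: "t \<in> {0..1}" and c: "c + t * l \<in> K" for x t c
  proof (rule e2(2)[OF c])
    have "dist (c + t * l) (c + t * x) = \<bar>t * (x - l)\<bar>"
      by (simp add: dist_real_def algebra_simps abs_minus_commute)
    also have "\<dots> \<le> \<bar>x - l\<bar>" using t by (simp add: abs_mult mult_left_le_one_le)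
    also have "\<dots> < e2" using x by (simp add: r_def)
    finally show "dist (c + t * l) (c + t * x) < e2" .
  qed
  have 1: "1 - t \<in> {0..1}" if "t \<in> {0..1}" for t :: real using that by auto
  define \<phi> where "\<phi> z t = of_real a + of_real t * z" for z :: complex and t :: real
  define \<psi> where "\<psi> z t = of_real b + of_real (1 - t) * z" for z :: complex and t :: real
  define p where "p z t = z * (F' (\<phi> z t) * M' (\<psi> z t))" for z t
  define p' where "p' z t = F' (\<phi> z t) * M' (\<psi> z t) +
     z * (of_real t * deriv F' (\<phi> z t) * M' (\<psi> z t) +
          of_real (1 - t) * F' (\<phi> z t) * deriv M' (\<psi> z t))" for z t
  let ?D = "ball (complex_of_real l) r \<times> {0..1::real}"
  have \<phi>U: "\<phi> z t \<in> U1" and \<psi>U: "\<psi> z t \<in> U2" if "z \<in> ball (of_real l) r" "t \<in> {0..1}" for z t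
    using inU[OF that pts(1)[OF that(2)]] inU[OF that(1) 1[OF that(2)] pts(2)[OF that(2)]]
    by (auto simp: \<phi>_def \<psi>_def)
  have cont\<phi>: "continuous_on ?D (\<lambda>x. \<phi> (fst x) (snd x))"
    and cont\<psi>: "continuous_on ?D (\<lambda>x. \<psi> (fst x) (snd x))"
    unfolding \<phi>_def \<psi>_def by (intro continuous_intros)+
  have im\<phi>: "(\<lambda>x. \<phi> (fst x) (snd x)) ` ?D \<subseteq> U1" and im\<psi>: "(\<lambda>x. \<psi> (fst x) (snd x)) ` ?D \<subseteq> U2"
    using \<phi>U \<psi>U by auto
  have contF: "continuous_on U1 F'" "continuous_on U1 (deriv F')"
    and contM: "continuous_on U2 M'" "continuous_on U2 (deriv M')"
    using U1 U2 by (auto intro!: holomorphic_on_imp_continuous_on holomorphic_deriv)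
  note comp = continuous_on_compose2[OF contF(1) cont\<phi> im\<phi>] continuous_on_compose2[OF contF(2) cont\<phi> im\<phi>]
    continuous_on_compose2[OF contM(1) cont\<psi> im\<psi>] continuous_on_compose2[OF contM(2) cont\<psi> im\<psi>]
  have cont: "continuous_on ?D (\<lambda>(z, t). p z t)" "continuous_on ?D (\<lambda>(z, t). p' z t)"
    unfolding p_def p'_def case_prod_beta by (intro continuous_intros comp)+
  have der: "((\<lambda>z. p z t) has_field_derivative p' z t) (at z)"
    if z: "z \<in> ball (of_real l) r" "t \<in> {0..1}" for z t
  proof -
    have "(F' has_field_derivative deriv F' (\<phi> z t)) (at (\<phi> z t))"
      using holomorphic_derivI[OF U1(3,1) \<phi>U[OF z]] .
    hence dF: "((\<lambda>z. F' (\<phi> z t)) has_field_derivative deriv F' (\<phi> z t) * of_real t) (at z)"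
      by (rule DERIV_chain2) (auto simp: \<phi>_def intro!: derivative_eq_intros)
    have "(M' has_field_derivative deriv M' (\<psi> z t)) (at (\<psi> z t))"
      using holomorphic_derivI[OF U2(3,1) \<psi>U[OF z]] .
    hence dM: "((\<lambda>z. M' (\<psi> z t)) has_field_derivative deriv M' (\<psi> z t) * of_real (1 - t)) (at z)"
      by (rule DERIV_chain2) (auto simp: \<psi>_def intro!: derivative_eq_intros)
    show ?thesis
      unfolding p_def p'_def
      by (rule DERIV_cong[OF DERIV_mult[OF DERIV_ident DERIV_mult[OF dF dM]]])
         (simp add: algebra_simps)
  qed
  define q where "q x t = x * (F (a + t * x) * M (b + (1 - t) * x))" for x t
  have ext: "F' (\<phi> (of_real x) t) = of_real (F (a + t * x))"
      "deriv F' (\<phi> (of_real x) t) = of_real (deriv F (a + t * x))"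
      "M' (\<psi> (of_real x) t) = of_real (M (b + (1 - t) * x))"
      "deriv M' (\<psi> (of_real x) t) = of_real (deriv M (b + (1 - t) * x))"
    if x: "\<bar>x - l\<bar> < r" "t \<in> {0..1}" for x t
    using F'[OF inL[OF x pts(1)[OF x(2)]]] M'[OF inL[OF x(1) 1[OF x(2)] pts(2)[OF x(2)]]]
    by (simp_all add: \<phi>_def \<psi>_def)
  have re: "p (of_real x) t = of_real (q x t)" if "\<bar>x - l\<bar> < r" "t \<in> {0..1}" for x t
    unfolding p_def q_def using ext[OF that] by simp
  \<comment> \<open>The substitution \<open>t = a + \<tau> (x - a - b)\<close> maps \<open>[0, 1]\<close> onto \<open>[a, x - b]\<close>.\<close>
  have subst: "integral {a..x - b} (\<lambda>t. f t * g (x - t)) =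
      integral {0..1} (\<lambda>t. (x - a - b) * (f (a + t * (x - a - b)) * g (b + (1 - t) * (x - a - b))))"
    if f: "f real_analytic_on L" and g: "g real_analytic_on L" and x: "\<bar>x - h\<bar> < r"
    for f g :: "real \<Rightarrow> real" and x
  proof -
    define k where "k = x - a - b"
    have kl: "\<bar>k - l\<bar> < r" using x by (simp add: k_def l_def)
    have k: "k > 0" using kl by (auto simp: r_def)
    have inL': "y \<in> L" "x - y \<in> L" if "y \<in> {a..x - b}" for y
    proof -
      define t where "t = (y - a) / k"
      have t: "t \<in> {0..1}" using that k by (auto simp: t_def k_def)
      have y: "y = a + t * k" using k by (simp add: t_def)
      have y': "x - y = b + (1 - t) * k" unfolding y by (simp add: k_def algebra_simps)
      show "y \<in> L" unfolding y by (rule inL[OF kl t pts(1)[OF t]])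
      show "x - y \<in> L" unfolding y' by (rule inL[OF kl 1[OF t] pts(2)[OF t]])
    qed
    have img: "(\<lambda>t. x - t) ` {a..x - b} \<subseteq> L" "{a..x - b} \<subseteq> L" using inL' by blast+
    have "continuous_on {a..x - b} (\<lambda>t. f t * g (x - t))"
      by (intro continuous_on_mult continuous_on_subset[OF real_analytic_on_imp_continuous_on[OF f] img(2)]
            continuous_on_compose2[OF real_analytic_on_imp_continuous_on[OF g] _ img(1)] continuous_intros)
    hence int: "((\<lambda>t. f t * g (x - t)) has_integral integral {a..x - b} (\<lambda>t. f t * g (x - t))) (cbox a (x - b))"
      using integrable_continuous_interval integrable_integral by fastforce
    have e: "x - b - a = k" and e2: "k * t + a = a + t * k" "x - (a + t * k) = b + (1 - t) * k" for t
      by (simp_all add: k_def algebra_simps)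
    have ends: "cbox (inverse k * (a - a)) (inverse k * (x - b - a)) = {0..1}"
      unfolding e using k by simp
    have "((\<lambda>t. f (a + t * k) * g (b + (1 - t) * k)) has_integral
        integral {a..x - b} (\<lambda>t. f t * g (x - t)) /\<^sub>R k ^ DIM(real)) {0..1}"
      using has_integral_affinity'[OF int k, of a] unfolding real_scaleR_def e2 ends .
    from has_integral_mult_right[OF this, of k]
    have "((\<lambda>t. k * (f (a + t * k) * g (b + (1 - t) * k))) has_integral
        integral {a..x - b} (\<lambda>t. f t * g (x - t))) {0..1}"
      using k by (simp add: mult.assoc[symmetric, of k "inverse k"] del: mult.assoc)
    from integral_unique[OF this] show ?thesis by (simp add: k_def)
  qed
  have subst': "integral {a..x - b} (\<lambda>t. F t * M (x - t)) = integral {0..1} (q (x - a - b))"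
    if "\<bar>x - h\<bar> < r" for x
    using subst[OF F M that] by (simp add: q_def[abs_def])
  have ev: "\<forall>\<^sub>F x in nhds h. integral {0..1} (q (x - (a + b))) =
      integral {a..x - b} (\<lambda>t. F t * M (x - t))"
    unfolding eventually_nhds_metric using subst' r
    by (intro exI[of _ r]) (auto simp: dist_real_def diff_diff_eq)
  have shift: "(\<lambda>x. integral {0..1} (q (x - (a + b)))) real_analytic_on {h}"
    by (rule real_analytic_on_compose[OF real_analytic_parameter_integral(1)[OF r der cont re]])
       (auto simp: l_def intro!: real_analytic_on_diff)
  show "(\<lambda>x. integral {a..x - b} (\<lambda>t. F t * M (x - t))) real_analytic_on {h}"
    by (rule real_analytic_on_cong_ev[OF shift ev])
  \<comment> \<open>\<open>d\<close> is the derivative of \<open>t F(a + t l) M(b + (1 - t) l)\<close>. It integrates to the boundary term at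
    the moving end, and the rest of the integrand, \<open>d2\<close>, is the integral with \<open>M'\<close> in place of \<open>M\<close>.\<close>
  define d where "d t = F (a + t * l) * M (b + (1 - t) * l) +
     l * (t * deriv F (a + t * l) * M (b + (1 - t) * l) - t * (F (a + t * l) * deriv M (b + (1 - t) * l)))" for t
  define d2 where "d2 t = l * (F (a + t * l) * deriv M (b + (1 - t) * l))" for t
  have r0: "\<bar>l - l\<bar> < r" using r by simp
  have "Re (p' (of_real l) t) = d t + d2 t" if t: "t \<in> {0..1}" for t
    unfolding p'_def ext[OF r0 t] d_def d2_def by (simp add: algebra_simps)
  hence Rep: "integral {0..1} (\<lambda>t. Re (p' (of_real l) t)) = integral {0..1} (\<lambda>t. d t + d2 t)"
    by (intro integral_cong) simp
  have contL: "continuous_on {0..1} (\<lambda>t. f (a + t * l))" "continuous_on {0..1} (\<lambda>t. f (b + (1 - t) * l))"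
    if "f real_analytic_on L" for f
    using inL[OF r0] pts 1
    by (intro continuous_on_compose2[OF real_analytic_on_imp_continuous_on[OF that]]
         continuous_intros; auto)+
  have "(d has_integral (1 * (F (a + 1 * l) * M (b + (1 - 1) * l)) -
      0 * (F (a + 0 * l) * M (b + (1 - 0) * l)))) {0..1}"
  proof (rule fundamental_theorem_of_calculus_interior)
    show "continuous_on {0..1} (\<lambda>t. t * (F (a + t * l) * M (b + (1 - t) * l)))"
      by (intro continuous_intros contL F M)
    fix t :: real assume "t \<in> {0<..<1}"
    hence t: "t \<in> {0..1}" by auto
    have "(F has_real_derivative deriv F (a + t * l)) (at (a + t * l))"
      by (rule real_analytic_on_imp_DERIV[OF F inL[OF r0 t pts(1)[OF t]]])
    hence dF: "((\<lambda>t. F (a + t * l)) has_real_derivative deriv F (a + t * l) * l) (at t)"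
      by (rule DERIV_chain2) (auto intro!: derivative_eq_intros)
    have "(M has_real_derivative deriv M (b + (1 - t) * l)) (at (b + (1 - t) * l))"
      by (rule real_analytic_on_imp_DERIV[OF M inL[OF r0 1[OF t] pts(2)[OF t]]])
    hence dM: "((\<lambda>t. M (b + (1 - t) * l)) has_real_derivative deriv M (b + (1 - t) * l) * (- l)) (at t)"
      by (rule DERIV_chain2) (auto intro!: derivative_eq_intros)
    have "((\<lambda>t. t * (F (a + t * l) * M (b + (1 - t) * l))) has_real_derivative d t) (at t)"
      by (rule DERIV_cong[OF DERIV_mult[OF DERIV_ident DERIV_mult[OF dF dM]]])
         (simp add: d_def algebra_simps)
    thus "((\<lambda>t. t * (F (a + t * l) * M (b + (1 - t) * l))) has_vector_derivative d t) (at t)"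
      by (simp add: has_real_derivative_iff_has_vector_derivative)
  qed simp
  hence "(d has_integral (F (h - b) * M b)) {0..1}"
    by (simp add: l_def)
  moreover have "d2 integrable_on {0..1}"
    unfolding d2_def[abs_def]
    by (intro integrable_continuous_interval continuous_intros contL F real_analytic_on_deriv M)
  ultimately have "integral {0..1} (\<lambda>t. d t + d2 t) = F (h - b) * M b + integral {0..1} d2"
    by (simp add: integral_add integral_unique has_integral_integrable)
  also have "integral {0..1} d2 = integral {a..h - b} (\<lambda>t. F t * deriv M (h - t))"
    using subst[OF F real_analytic_on_deriv[OF M], of h] r by (simp add: d2_def[abs_def] l_def)
  finally have val: "integral {0..1} (\<lambda>t. Re (p' (of_real l) t)) =
      F (h - b) * M b + integral {a..h - b} (\<lambda>t. F t * deriv M (h - t))"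
    using Rep by simp
  have "((\<lambda>k. integral {0..1} (q k)) has_real_derivative
      integral {0..1} (\<lambda>t. Re (p' (of_real l) t))) (at (h - (a + b)))"
    using real_analytic_parameter_integral(2)[OF r der cont re] by (simp add: l_def diff_diff_eq)
  hence "((\<lambda>x. integral {0..1} (q (x - (a + b)))) has_real_derivative
      integral {0..1} (\<lambda>t. Re (p' (of_real l) t)) * 1) (at h)"
    by (rule DERIV_chain2) (auto intro!: derivative_eq_intros)
  thus "((\<lambda>x. integral {a..x - b} (\<lambda>t. F t * M (x - t))) has_real_derivative
            F (h - b) * M b + integral {a..h - b} (\<lambda>t. F t * deriv M (h - t))) (at h)"
    unfolding val using DERIV_cong_ev[OF refl ev refl] by simp
qed

lemma is_interval_einterval: "is_interval (einterval a b)"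
  unfolding is_interval_1
proof (intro ballI allI impI)
  fix p q x assume p: "p \<in> einterval a b" and q: "q \<in> einterval a b" and x: "p \<le> x \<and> x \<le> q"
  have "a < ereal x" using less_le_trans[of a "ereal p" "ereal x"] p x by (simp add: einterval_iff)
  moreover have "ereal x < b" using le_less_trans[of "ereal x" "ereal q" b] q x by (simp add: einterval_iff)
  ultimately show "x \<in> einterval a b" by (simp add: einterval_iff)
qed

lemma connected_einterval: "connected (einterval a b)"
  by (simp add: is_interval_connected is_interval_einterval)

lemma has_integral_reflect_Icc:
  fixes f :: "real \<Rightarrow> real"
  assumes "(f has_integral i) {a..b}"
  shows "((\<lambda>t. f (h - t)) has_integral i) {h - b..h - a}"
proof -
  have im: "(\<lambda>x. (1 / - 1) *\<^sub>R x + - ((1 / - 1) *\<^sub>R h)) ` {a..b} = {h - b..h - a}"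
    by (force intro!: image_eqI[of _ _ "h - _"])
  show ?thesis
    using has_integral_affinity[of f i a b "-1" h] assms im by simp
qed

text \<open>\<open>F\<close> may be unbounded at \<open>0\<close>. Its integrability there is expressed by a primitive that is
  continuous up to \<open>0\<close>, which is all that integration by parts requires.\<close>

locale primitive_pair =
  fixes R :: ereal and F F1 :: "real \<Rightarrow> real"
  assumes analytic: "F real_analytic_on einterval 0 R"
    and primitive_cont: "continuous_on (insert 0 (einterval 0 R)) F1"
    and primitive_0: "F1 0 = 0"
    and primitive: "\<And>t. t \<in> einterval 0 R \<Longrightarrow> (F1 has_real_derivative F t) (at t)"

lemma einterval_0_Icc_subset:
  assumes "h \<in> einterval 0 R" "0 < a" "b \<le> h"
  shows "{a..b} \<subseteq> einterval 0 R"
proof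
  fix t assume t: "t \<in> {a..b}"
  have "ereal t \<le> ereal h" using t assms by simp
  also have "ereal h < R" using assms by (simp add: einterval_iff)
  finally show "t \<in> einterval 0 R" using t assms by (simp add: einterval_iff)
qed

lemma einterval_0_Icc_subset':
  assumes "h \<in> einterval 0 R" "0 \<le> a" "b \<le> h"
  shows "{a..b} \<subseteq> insert 0 (einterval 0 R)"
proof
  fix t assume t: "t \<in> {a..b}"
  show "t \<in> insert 0 (einterval 0 R)"
    using einterval_0_Icc_subset[OF assms(1), of t b] assms t by (cases "t = 0") auto
qed

definition convolution :: "(real \<Rightarrow> real) \<Rightarrow> (real \<Rightarrow> real) \<Rightarrow> real \<Rightarrow> real" where
  "convolution F M h = integral {0..h} (\<lambda>t. F t * M (h - t))"

text \<open>On the last piece the reflection \<open>t \<mapsto> h - t\<close> exchanges the roles of the two factors, so that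
  the singular factor is again the one evaluated near \<open>0\<close>.\<close>

lemma convolution_split:
  assumes FP: "primitive_pair R F F1" and MP: "primitive_pair R M L"
    and h: "h \<in> einterval 0 R" and ab: "0 < a" "0 < b" "a + b < h"
  shows "((\<lambda>t. F t * M (h - t)) has_integral
     (integral {0..a} (\<lambda>t. F t * M (h - t)) + integral {a..h - b} (\<lambda>t. F t * M (h - t)) +
      integral {0..b} (\<lambda>s. M s * F (h - s)))) {0..h}"
proof -
  let ?I = "einterval 0 R"
  interpret F: primitive_pair R F F1 by (rule FP)
  interpret M: primitive_pair R M L by (rule MP)
  have inI: "t \<in> ?I" if "0 < t" "t \<le> h" for t
    using einterval_0_Icc_subset[OF h, of t t] that by auto
  have inI0: "t \<in> insert 0 ?I" if "0 \<le> t" "t \<le> h" for t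
    using inI[of t] that by (cases "t = 0") auto
  have sub: "{h - a..h} \<subseteq> ?I" "{h - b..h} \<subseteq> ?I" "{a..h - b} \<subseteq> ?I"
      "{0..a} \<subseteq> insert 0 ?I" "{0..b} \<subseteq> insert 0 ?I"
    by (rule subsetI, rule inI, use ab in force, use ab in force)+
       (rule subsetI, rule inI0, use ab in force, use ab in force)+
  have 1: "(\<lambda>t. F t * M (h - t)) integrable_on {0..a}"
    by (rule has_integral_integrable[OF end_piece_has_integral[OF ab(1)
          continuous_on_subset[OF F.primitive_cont sub(4)] F.primitive_0 F.primitive M.analytic sub(1)]])
       (use inI ab in auto)
  have 3: "(\<lambda>s. M s * F (h - s)) integrable_on {0..b}"
    by (rule has_integral_integrable[OF end_piece_has_integral[OF ab(2)
          continuous_on_subset[OF M.primitive_cont sub(5)] M.primitive_0 M.primitive F.analytic sub(2)]])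
       (use inI ab in auto)
  have refl3: "((\<lambda>t. F t * M (h - t)) has_integral integral {0..b} (\<lambda>s. M s * F (h - s))) {h - b..h}"
    using has_integral_reflect_Icc[OF integrable_integral[OF 3], of h] by (simp add: mult.commute)
  have img: "(\<lambda>t. h - t) ` {a..h - b} \<subseteq> ?I"
    using ab by (auto intro!: inI)
  have "continuous_on {a..h - b} (\<lambda>t. F t * M (h - t))"
    by (intro continuous_on_mult continuous_on_compose2[OF real_analytic_on_imp_continuous_on[OF M.analytic] _ img]
          continuous_on_subset[OF real_analytic_on_imp_continuous_on[OF F.analytic] sub(3)] continuous_intros)
  hence 2: "(\<lambda>t. F t * M (h - t)) integrable_on {a..h - b}"
    by (rule integrable_continuous_interval)
  have "((\<lambda>t. F t * M (h - t)) has_integral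
     (integral {0..a} (\<lambda>t. F t * M (h - t)) + integral {a..h - b} (\<lambda>t. F t * M (h - t)))) {0..h - b}"
    using ab by (intro has_integral_combine[OF _ _ integrable_integral[OF 1] integrable_integral[OF 2]]) auto
  thus ?thesis
    using ab by (intro has_integral_combine[OF _ _ _ refl3]) auto
qed

lemma convolution_eq_split:
  assumes FP: "primitive_pair R F F1" and MP: "primitive_pair R M L"
    and h: "h \<in> einterval 0 R" and ab: "0 < a" "0 < b" "a + b < h"
  shows "convolution F M h =
     integral {0..a} (\<lambda>t. F t * M (h - t)) + integral {a..h - b} (\<lambda>t. F t * M (h - t)) +
      integral {0..b} (\<lambda>s. M s * F (h - s))"
  unfolding convolution_def by (rule integral_unique[OF convolution_split[OF assms]])

lemma convolution_has_integral:
  assumes FP: "primitive_pair R F F1" and MP: "primitive_pair R M L" and h: "h \<in> einterval 0 R"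
  shows "((\<lambda>t. F t * M (h - t)) has_integral convolution F M h) {0..h}"
proof -
  have "0 < h / 4" "h / 4 + h / 4 < h" using h by (auto simp: einterval_iff)
  from has_integral_integrable[OF convolution_split[OF FP MP h this(1,1,2)]]
  show ?thesis unfolding convolution_def by (rule integrable_integral)
qed

lemma convolution_real_analytic_and_derivative:
  assumes FP: "primitive_pair R F F1" and MP: "primitive_pair R M L"
    and h: "h \<in> einterval 0 R" and ab: "0 < a" "0 < b" "a + b < h"
  shows "convolution F M real_analytic_on {h}"
    and "(convolution F M has_real_derivative
      (integral {0..a} (\<lambda>t. F t * deriv M (h - t)) +
       (F (h - b) * M b + integral {a..h - b} (\<lambda>t. F t * deriv M (h - t))) +
       integral {0..b} (\<lambda>s. M s * deriv F (h - s)))) (at h)"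
proof -
  let ?I = "einterval 0 R"
  let ?C = "\<lambda>h. integral {0..a} (\<lambda>t. F t * M (h - t)) + integral {a..h - b} (\<lambda>t. F t * M (h - t)) +
      integral {0..b} (\<lambda>s. M s * F (h - s))"
  interpret F: primitive_pair R F F1 by (rule FP)
  interpret M: primitive_pair R M L by (rule MP)
  have inI: "t \<in> ?I" if "0 < t" "t \<le> h" for t
    using einterval_0_Icc_subset[OF h, of t t] that by auto
  have inI0: "t \<in> insert 0 ?I" if "0 \<le> t" "t \<le> h" for t
    using inI[of t] that by (cases "t = 0") auto
  have sub: "{h - a..h} \<subseteq> ?I" "{h - b..h} \<subseteq> ?I" "{a..h - b} \<subseteq> ?I" "{b..h - a} \<subseteq> ?I"
      "{0..a} \<subseteq> insert 0 ?I" "{0..b} \<subseteq> insert 0 ?I"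
    by (rule subsetI, rule inI, use ab in force, use ab in force)+
       (rule subsetI, rule inI0, use ab in force, use ab in force)+
  have I: "open ?I" "connected ?I"
    by (simp_all add: connected_einterval)
  have prF: "(F1 has_real_derivative F t) (at t)" if "0 < t" "t < a" for t
    using that ab by (intro F.primitive inI) auto
  have prM: "(L has_real_derivative M t) (at t)" if "0 < t" "t < b" for t
    using that ab by (intro M.primitive inI) auto
  note endF = end_piece_real_analytic[OF ab(1) continuous_on_subset[OF F.primitive_cont sub(5)]
      F.primitive_0 prF I M.analytic sub(1)]
  note endM = end_piece_real_analytic[OF ab(2) continuous_on_subset[OF M.primitive_cont sub(6)]
      M.primitive_0 prM I F.analytic sub(2)]
  note mid = middle_piece_real_analytic[OF I F.analytic M.analytic ab(3) sub(3,4)]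
  have "\<forall>\<^sub>F x in nhds h. x \<in> ?I \<inter> {a + b<..}"
    using I(1) h ab by (intro eventually_nhds_in_open) auto
  hence ev: "\<forall>\<^sub>F x in nhds h. ?C x = convolution F M x"
    by eventually_elim (use convolution_eq_split[OF FP MP _ ab(1,2)] in auto)
  have "?C real_analytic_on {h}"
    by (intro real_analytic_on_add endF(1) endM(1) mid(1))
  thus "convolution F M real_analytic_on {h}"
    using ev by (rule real_analytic_on_cong_ev)
  show "(convolution F M has_real_derivative
      (integral {0..a} (\<lambda>t. F t * deriv M (h - t)) +
       (F (h - b) * M b + integral {a..h - b} (\<lambda>t. F t * deriv M (h - t))) +
       integral {0..b} (\<lambda>s. M s * deriv F (h - s)))) (at h)"
    using DERIV_add[OF DERIV_add[OF endF(2) mid(2)] endM(2)] DERIV_cong_ev[OF refl ev refl] by blast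
qed

lemma convolution_real_analytic:
  assumes FP: "primitive_pair R F F1" and MP: "primitive_pair R M L"
  shows "convolution F M real_analytic_on einterval 0 R"
proof (rule real_analytic_onI)
  fix h assume h: "h \<in> einterval 0 R"
  have "0 < h / 4" "h / 4 + h / 4 < h" using h by (auto simp: einterval_iff)
  thus "convolution F M real_analytic_on {h}"
    using convolution_real_analytic_and_derivative(1)[OF FP MP h] by blast
qed

text \<open>That \<open>M\<close> is itself a continuous primitive vanishing at \<open>0\<close> is what makes the boundary term
  of the last piece cancel the one produced by the moving end of the middle piece.\<close>

lemma deriv_convolution:
  assumes FP: "primitive_pair R F F1" and MP: "primitive_pair R M L" and DMP: "primitive_pair R (deriv M) M"
    and h: "h \<in> einterval 0 R"
  shows "deriv (convolution F M) h = convolution F (deriv M) h"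
proof -
  let ?I = "einterval 0 R"
  define a where "a = h / 4"
  have ab: "0 < a" "a + a < h" using h by (auto simp: einterval_iff a_def)
  interpret F: primitive_pair R F F1 by (rule FP)
  interpret M: primitive_pair R "deriv M" M by (rule DMP)
  have inI: "t \<in> ?I" if "0 < t" "t \<le> h" for t
    using einterval_0_Icc_subset[OF h, of t t] that by auto
  have inI0: "t \<in> insert 0 ?I" if "0 \<le> t" "t \<le> h" for t
    using inI[of t] that by (cases "t = 0") auto
  have sub: "{h - a..h} \<subseteq> ?I" "{0..a} \<subseteq> insert 0 ?I"
    by (rule subsetI, rule inI, use ab in force, use ab in force)+
       (rule subsetI, rule inI0, use ab in force, use ab in force)+
  have pr: "(M has_real_derivative deriv M t) (at t)" if "0 < t" "t < a" for t
    using that ab by (intro M.primitive inI) auto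
  have "integral {0..a} (\<lambda>s. deriv M s * F (h - s)) =
      M a * F (h - a) + integral {0..a} (\<lambda>s. M s * deriv F (h - s))"
    by (rule integral_unique[OF end_piece_has_integral[OF ab(1)
          continuous_on_subset[OF M.primitive_cont sub(2)] M.primitive_0 pr F.analytic sub(1)]])
  thus ?thesis
    using DERIV_imp_deriv[OF convolution_real_analytic_and_derivative(2)[OF FP MP h ab(1,1,2)]]
      convolution_eq_split[OF FP DMP h ab(1,1,2)] by (simp add: mult.commute)
qed

section \<open>Chebyshev systems of convolutions\<close>

lemma primitive_pair_lincomb:
  assumes "\<And>i. i < k \<Longrightarrow> primitive_pair R (F i) (F1 i)"
  shows "primitive_pair R (lincomb k \<alpha> F) (lincomb k \<alpha> F1)"
proof
  note pp = assms[unfolded primitive_pair_def]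
  show "lincomb k \<alpha> F real_analytic_on einterval 0 R"
    using pp by (intro real_analytic_on_lincomb) blast
  show "continuous_on (insert 0 (einterval 0 R)) (lincomb k \<alpha> F1)"
    unfolding lincomb_def[abs_def] using pp by (intro continuous_intros) blast
  show "lincomb k \<alpha> F1 0 = 0"
    unfolding lincomb_def using pp by (intro sum.neutral) auto
  show "(lincomb k \<alpha> F1 has_real_derivative lincomb k \<alpha> F t) (at t)" if "t \<in> einterval 0 R" for t
    unfolding lincomb_def[abs_def] using pp that by (intro DERIV_sum DERIV_cmult) blast
qed

lemma convolution_lincomb:
  assumes "\<And>i. i < k \<Longrightarrow> primitive_pair R (F i) (F1 i)" "primitive_pair R M L" "h \<in> einterval 0 R"
  shows "convolution (lincomb k \<alpha> F) M h = lincomb k \<alpha> (\<lambda>i. convolution (F i) M) h"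
proof -
  have "((\<lambda>t. \<Sum>i<k. \<alpha> i * (F i t * M (h - t))) has_integral
      (\<Sum>i<k. \<alpha> i * convolution (F i) M h)) {0..h}"
    by (intro has_integral_sum has_integral_mult_right convolution_has_integral[OF assms(1,2,3)]) auto
  moreover have "(\<Sum>i<k. \<alpha> i * (F i t * M (h - t))) = lincomb k \<alpha> F t * M (h - t)" for t
    by (simp only: lincomb_def sum_distrib_right mult.assoc)
  ultimately show ?thesis
    unfolding convolution_def lincomb_def[of _ _ "\<lambda>i. _ i"] by (simp add: integral_unique lincomb_def convolution_def)
qed

text \<open>If the derivatives of order less than \<open>k\<close> of a combination of the \<open>J i\<close> vanish at \<open>h\<close>, the same
  combination of the \<open>F i\<close> is orthogonal to \<open>L (Suc j) (h - t)\<close> for \<open>j < k\<close>. The indices of \<open>L\<close> are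
  shifted so that the kernel of the convolution is \<open>L 1\<close> and \<open>L 0\<close> is a primitive of it.\<close>

theorem ECT_system_convolution:
  fixes F F1 L J :: "nat \<Rightarrow> real \<Rightarrow> real"
  assumes R: "0 < R"
    and F: "\<And>i. i < n \<Longrightarrow> primitive_pair R (F i) (F1 i)"
    and L: "\<And>j. j < n \<Longrightarrow> primitive_pair R (L (Suc j)) (L j)"
    and haar_F: "\<And>k. k \<in> {1..n} \<Longrightarrow> haar_system k F (einterval 0 R)"
    and haar_L: "\<And>k. k \<in> {1..n} \<Longrightarrow> haar_system k (\<lambda>j. L (Suc j)) (einterval 0 R)"
    and J: "\<And>i h. i < n \<Longrightarrow> h \<in> einterval 0 R \<Longrightarrow> J i h = convolution (F i) (L 1) h"
  shows "ECT_system n J (einterval 0 R)"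
proof (rule ECT_systemI)
  let ?I = "einterval 0 R"
  show I: "open ?I" "is_interval ?I"
    by (simp_all add: is_interval_einterval)
  show "?I \<noteq> {}"
    using ereal_dense2[OF R] by (auto simp: einterval_iff zero_ereal_def)
  show "J i real_analytic_on ?I" if "i < n" for i
  proof (rule real_analytic_on_cong[OF convolution_real_analytic I(1)])
    show "primitive_pair R (F i) (F1 i)" "primitive_pair R (L 1) (L 0)" using F L[of 0] that by auto
    show "convolution (F i) (L 1) x = J i x" if "x \<in> ?I" for x
      using J[OF \<open>i < n\<close> that] by simp
  qed
  have dL: "deriv (L j) t = L (Suc j) t" if "j < n" "t \<in> ?I" for j t
    using L[OF that(1)] that(2) by (intro DERIV_imp_deriv) (auto simp: primitive_pair_def)
  show "nondegenerate_jets n J ?I"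
    unfolding nondegenerate_jets_def
  proof (intro ballI allI impI notI)
    fix k h and \<alpha> :: "nat \<Rightarrow> real"
    assume k: "k \<in> {1..n}" and h: "h \<in> ?I" and \<alpha>: "\<exists>i<k. \<alpha> i \<noteq> 0"
      and van: "vanishes_to (lincomb k \<alpha> J) h k"
    define G where "G = lincomb k \<alpha> F"
    define G1 where "G1 = lincomb k \<alpha> F1"
    have G: "primitive_pair R G G1"
      unfolding G_def G1_def using F k by (intro primitive_pair_lincomb) auto
    have derivs: "(deriv ^^ j) (lincomb k \<alpha> J) x = convolution G (L (Suc j)) x"
      if "j < n" "x \<in> ?I" for j x
      using that
    proof (induction j arbitrary: x)
      case 0
      have "lincomb k \<alpha> J x = lincomb k \<alpha> (\<lambda>i. convolution (F i) (L 1)) x"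
        unfolding lincomb_def using J[OF _ 0(2)] k by (intro sum.cong) auto
      also have "\<dots> = convolution G (L 1) x"
        unfolding G_def using convolution_lincomb[of k R F F1 "L 1" "L 0" x \<alpha>] F L[of 0] k 0 by simp
      finally show ?case by simp
    next
      case (Suc j)
      have "(deriv ^^ Suc j) (lincomb k \<alpha> J) x = deriv ((deriv ^^ j) (lincomb k \<alpha> J)) x" by simp
      also have "\<dots> = deriv (convolution G (L (Suc j))) x"
        using Suc
        by (intro deriv_cong_ev eventually_mono[OF eventually_nhds_in_open[OF I(1) Suc.prems(2)]]) auto
      also have "\<dots> = convolution G (deriv (L (Suc j))) x"
      proof (rule deriv_convolution[OF G _ _ Suc.prems(2)])
        show "primitive_pair R (L (Suc j)) (L j)" using L Suc.prems by simp
        have "primitive_pair R (L (Suc (Suc j))) (L (Suc j))" using L Suc.prems by simp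
        moreover have "deriv (L (Suc j)) real_analytic_on ?I"
          using L[of j] Suc.prems by (intro real_analytic_on_deriv) (auto simp: primitive_pair_def)
        ultimately show "primitive_pair R (deriv (L (Suc j))) (L (Suc j))"
          using dL[OF Suc.prems(1)] by (simp add: primitive_pair_def)
      qed
      also have "\<dots> = convolution G (L (Suc (Suc j))) x"
        unfolding convolution_def integral_open_interval_real
      proof (rule integral_cong)
        fix t assume "t \<in> {0<..<x}"
        hence "x - t \<in> ?I" using einterval_0_Icc_subset[OF Suc.prems(2), of "x - t" "x - t"] by auto
        thus "G t * deriv (L (Suc j)) (x - t) = G t * L (Suc (Suc j)) (x - t)"
          using dL[OF Suc.prems(1)] by simp
      qed
      finally show ?case .
    qed
    have h0: "0 < h" using h by (simp add: einterval_iff)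
  have sub: "{0<..<h} \<subseteq> ?I"
      using einterval_0_Icc_subset[OF h] by fastforce
    have refl: "(\<lambda>t. h - t) ` {0<..<h} \<subseteq> ?I"
    proof
      fix x assume "x \<in> (\<lambda>t. h - t) ` {0<..<h}"
      hence "x \<in> {0<..<h}" by auto
      thus "x \<in> ?I" using sub by blast
    qed
    show False
    proof (rule haar_systems_not_orthogonal[of 0 h k F "\<lambda>j t. L (Suc j) (h - t)" \<alpha>])
      show "haar_system k F {0<..<h}"
        by (rule haar_system_subset[OF haar_F[OF k] sub])
      show "continuous_on {0<..<h} (F i)" if "i < k" for i
      proof -
        have "F i real_analytic_on ?I" using F[of i] k that by (simp add: primitive_pair_def)
        thus ?thesis using real_analytic_on_imp_continuous_on continuous_on_subset sub by blast
      qed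
      show "haar_system j (\<lambda>j t. L (Suc j) (h - t)) {0<..<h}" if "j \<in> {1..k}" for j
      proof (rule haar_system_reparam[where \<phi> = "\<lambda>t. h - t" and c = 1])
        show "haar_system j (\<lambda>j. L (Suc j)) ?I" using haar_L k that by simp
        show "(\<lambda>t. h - t) ` {0<..<h} \<subseteq> ?I" by (rule refl)
      qed (auto simp: inj_on_def)
      show "continuous_on {0<..<h} (\<lambda>t. L (Suc i) (h - t))" if "i < k" for i
      proof -
        have "L (Suc i) real_analytic_on ?I" using L[of i] k that by (simp add: primitive_pair_def)
        from continuous_on_compose2[OF real_analytic_on_imp_continuous_on[OF this] _ refl]
        show ?thesis by (simp add: continuous_intros)
      qed
      show "((\<lambda>t. lincomb k \<alpha> F t * L (Suc j) (h - t)) has_integral 0) {0..h}" if "j < k" for j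
      proof -
        have jn: "j < n" using that k by simp
        have "convolution G (L (Suc j)) h = 0"
          using van that derivs[OF jn h] by (simp add: vanishes_to_def)
        thus ?thesis
          using convolution_has_integral[OF G L[OF jn] h] by (simp add: G_def)
      qed
    qed (use h0 \<alpha> in auto)
  qed
qed

section \<open>Potential wells\<close>

lemma einterval_primitive:
  fixes f :: "real \<Rightarrow> real"
  assumes f: "continuous_on (einterval a b) f"
  obtains A where "\<And>x. x \<in> einterval a b \<Longrightarrow> (A has_real_derivative f x) (at x)"
proof (cases "a < b")
  case True
  have "isCont f x" if "a < ereal x" "ereal x < b" for x
  proof -
    have "x \<in> einterval a b" using that by (simp add: einterval_iff)
    thus ?thesis using iffD1[OF continuous_on_eq_continuous_at[OF open_einterval] f] by blast
  qed
  then obtain A where A: "\<And>x. a < ereal x \<Longrightarrow> ereal x < b \<Longrightarrow> (A has_vector_derivative f x) (at x)"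
    using einterval_antiderivative[OF True, of f] by auto
  show ?thesis
    by (rule that[of A]) (simp add: einterval_iff A has_real_derivative_iff_has_vector_derivative)
next
  case False
  have "x \<notin> einterval a b" for x
    using False less_trans[of a "ereal x" b] by (auto simp: einterval_iff)
  thus ?thesis using that by blast
qed

locale potential_well =
  fixes \<Phi> :: "real \<Rightarrow> real" and xl xr :: ereal
  assumes zero_in: "0 \<in> einterval xl xr"
    and analytic: "\<Phi> real_analytic_on einterval xl xr"
    and \<Phi>_0 [simp]: "\<Phi> 0 = 0"
    and deriv_sign: "\<And>x. x \<in> einterval xl xr - {0} \<Longrightarrow> x * deriv \<Phi> x > 0"
begin

lemma deriv_pos: "x \<in> einterval xl xr \<Longrightarrow> x > 0 \<Longrightarrow> deriv \<Phi> x > 0"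
  using deriv_sign[of x] by (auto simp: zero_less_mult_iff)

lemma deriv_neg: "x \<in> einterval xl xr \<Longrightarrow> x < 0 \<Longrightarrow> deriv \<Phi> x < 0"
  using deriv_sign[of x] by (auto simp: zero_less_mult_iff)

lemma deriv_nz: "x \<in> einterval xl xr \<Longrightarrow> x \<noteq> 0 \<Longrightarrow> deriv \<Phi> x \<noteq> 0"
  using deriv_sign[of x] by auto

lemma between_in:
  "x \<in> einterval xl xr \<Longrightarrow> y \<in> einterval xl xr \<Longrightarrow> x \<le> z \<Longrightarrow> z \<le> y \<Longrightarrow> z \<in> einterval xl xr"
  using mem_is_interval_1_I[OF is_interval_einterval] by blast

lemma right_half: "einterval 0 xr = {x \<in> einterval xl xr. 0 < x}"
proof -
  have "xl < ereal x" if "0 < x" for x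
    using zero_in that less_trans[of xl 0 "ereal x"] by (auto simp: einterval_iff zero_ereal_def)
  thus ?thesis by (auto simp: einterval_iff zero_ereal_def)
qed

lemma DERIV_\<Phi>: "x \<in> einterval xl xr \<Longrightarrow> (\<Phi> has_real_derivative deriv \<Phi> x) (at x)"
  by (rule real_analytic_on_imp_DERIV[OF analytic])

lemma cont_\<Phi>: "continuous_on (einterval xl xr) \<Phi>"
  by (rule real_analytic_on_imp_continuous_on[OF analytic])

lemma increasing:
  assumes "x \<in> einterval xl xr" "y \<in> einterval xl xr" "0 \<le> x" "x < y"
  shows "\<Phi> x < \<Phi> y"
proof (rule DERIV_pos_imp_increasing_open[OF assms(4)])
  show "\<exists>d. (\<Phi> has_real_derivative d) (at z) \<and> 0 < d" if "x < z" "z < y" for z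
    using DERIV_\<Phi>[of z] deriv_pos[of z] between_in[OF assms(1,2), of z] that assms(3) by auto
  show "continuous_on {x..y} \<Phi>"
    by (rule continuous_on_subset[OF cont_\<Phi>]) (use between_in[OF assms(1,2)] in auto)
qed

lemma decreasing:
  assumes "x \<in> einterval xl xr" "y \<in> einterval xl xr" "y \<le> 0" "x < y"
  shows "\<Phi> y < \<Phi> x"
proof (rule DERIV_neg_imp_decreasing_open[OF assms(4)])
  show "\<exists>d. (\<Phi> has_real_derivative d) (at z) \<and> d < 0" if "x < z" "z < y" for z
    using DERIV_\<Phi>[of z] deriv_neg[of z] between_in[OF assms(1,2), of z] that assms(3) by auto
  show "continuous_on {x..y} \<Phi>"
    by (rule continuous_on_subset[OF cont_\<Phi>]) (use between_in[OF assms(1,2)] in auto)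
qed

lemma pos: "x \<in> einterval xl xr \<Longrightarrow> x \<noteq> 0 \<Longrightarrow> \<Phi> x > 0"
  using increasing[OF zero_in, of x] decreasing[OF _ zero_in, of x] by (cases "x > 0") auto

lemma nonneg: "x \<in> einterval xl xr \<Longrightarrow> \<Phi> x \<ge> 0"
  using pos[of x] by (cases "x = 0") auto

lemma inj_right:
  assumes "x \<in> einterval xl xr" "y \<in> einterval xl xr" "0 \<le> x" "0 \<le> y" "\<Phi> x = \<Phi> y"
  shows "x = y"
  using increasing[OF assms(1,2,3)] increasing[OF assms(2,1,4)] assms(5) by (cases x y rule: linorder_cases) auto

lemma inj_left:
  assumes "x \<in> einterval xl xr" "y \<in> einterval xl xr" "x \<le> 0" "y \<le> 0" "\<Phi> x = \<Phi> y"
  shows "x = y"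
  using decreasing[OF assms(1,2,4)] decreasing[OF assms(2,1,3)] assms(5) by (cases x y rule: linorder_cases) auto

text \<open>An involution that preserves \<open>\<Phi>\<close> either swaps the two monotone branches or fixes
  every point; by continuity no mixture of the two can occur.\<close>

lemma involution_swaps:
  assumes \<sigma>: "associated_involution \<Phi> (einterval xl xr) \<sigma>" and x: "x \<in> einterval xl xr" "0 < x"
  shows "\<sigma> x \<in> einterval xl xr" "\<sigma> x < 0" "\<Phi> (\<sigma> x) = \<Phi> x"
proof -
  let ?D = "einterval xl xr"
  have an: "\<sigma> real_analytic_on ?D" and inv: "\<And>x. x \<in> ?D \<Longrightarrow> \<sigma> x \<in> ?D" "\<And>x. x \<in> ?D \<Longrightarrow> \<sigma> (\<sigma> x) = x"
    and ne: "\<exists>x\<in>?D. \<sigma> x \<noteq> x" and pres: "\<And>x. x \<in> ?D \<Longrightarrow> \<Phi> (\<sigma> x) = \<Phi> x"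
    using \<sigma> unfolding associated_involution_def involution_on_def by auto
  show D: "\<sigma> x \<in> ?D" "\<Phi> (\<sigma> x) = \<Phi> x" using inv pres x by auto
  show "\<sigma> x < 0"
  proof (rule ccontr)
    assume "\<not> \<sigma> x < 0"
    hence sx: "\<sigma> x > 0" using pos[OF x(1)] x(2) D by (cases "\<sigma> x = 0") auto
    have nz: "\<sigma> z \<noteq> 0" if "z \<in> ?D" "z \<noteq> 0" for z
      using pos[OF that] pres[OF that(1)] by auto
    have right: "\<sigma> y = y" if y: "y \<in> ?D" "y > 0" for y
    proof -
      have "\<sigma> y > 0"
      proof (rule ccontr)
        assume "\<not> \<sigma> y > 0"
        hence sy: "\<sigma> y < 0" using nz[OF y(1)] y(2) by auto
        have "einterval 0 xr \<subseteq> ?D" unfolding right_half by blast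
        hence conn: "connected (\<sigma> ` einterval 0 xr)"
          by (intro connected_continuous_image connected_einterval
                continuous_on_subset[OF real_analytic_on_imp_continuous_on[OF an]])
        have "0 \<in> \<sigma> ` einterval 0 xr"
          using connectedD_interval[OF conn, of "\<sigma> y" "\<sigma> x" 0] x y sx sy unfolding right_half by auto
        thus False using nz unfolding right_half by auto
      qed
      thus ?thesis using inj_right[of "\<sigma> y" y] inv pres y by auto
    qed
    have left: "\<sigma> y = y" if y: "y \<in> ?D" "y < 0" for y
    proof -
      have "\<sigma> y < 0"
        using right[of "\<sigma> y"] inv[OF y(1)] nz[OF y(1)] y by (cases "\<sigma> y > 0") auto
      thus ?thesis using inj_left[of "\<sigma> y" y] inv pres y by auto
    qed
    have "\<sigma> 0 = 0" using pres[OF zero_in] pos[OF inv(1)[OF zero_in]] by fastforce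
    hence "\<forall>x\<in>?D. \<sigma> x = x" using left right by (metis linorder_cases)
    thus False using ne by blast
  qed
qed

end

text \<open>\<open>R\<close> is the energy of the rim of the well. The image condition speaks of the right branch; the
  involution carries it over to the left one.\<close>

locale energy_well = potential_well +
  fixes \<sigma> :: "real \<Rightarrow> real" and R :: ereal
  assumes image: "\<Phi> ` einterval 0 xr = einterval 0 R"
    and invol: "associated_involution \<Phi> (einterval xl xr) \<sigma>"
begin

lemma \<sigma>_analytic: "\<sigma> real_analytic_on einterval xl xr"
  using invol by (simp add: associated_involution_def)

lemma \<sigma>_in: "x \<in> einterval xl xr \<Longrightarrow> \<sigma> x \<in> einterval xl xr"
  using invol by (auto simp: associated_involution_def involution_on_def)

lemma \<Phi>_\<sigma>: "x \<in> einterval xl xr \<Longrightarrow> \<Phi> (\<sigma> x) = \<Phi> x"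
  using invol by (auto simp: associated_involution_def)

lemma \<sigma>_neg: "x \<in> einterval xl xr \<Longrightarrow> 0 < x \<Longrightarrow> \<sigma> x < 0"
  using involution_swaps[OF invol] by blast

lemma \<sigma>_0 [simp]: "\<sigma> 0 = 0"
  using \<Phi>_\<sigma>[OF zero_in] pos[OF \<sigma>_in[OF zero_in]] by fastforce

lemma DERIV_\<sigma>:
  assumes x: "x \<in> einterval xl xr" "x > 0"
  shows "(\<sigma> has_real_derivative deriv \<Phi> x / deriv \<Phi> (\<sigma> x)) (at x)"
proof -
  have d: "(\<sigma> has_real_derivative deriv \<sigma> x) (at x)"
    by (rule real_analytic_on_imp_DERIV[OF \<sigma>_analytic x(1)])
  have "((\<lambda>x. \<Phi> (\<sigma> x)) has_real_derivative deriv \<Phi> (\<sigma> x) * deriv \<sigma> x) (at x)"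
    by (rule DERIV_chain2[OF DERIV_\<Phi>[OF \<sigma>_in[OF x(1)]] d])
  moreover have ev: "\<forall>\<^sub>F z in nhds x. \<Phi> (\<sigma> z) = \<Phi> z"
    by (rule eventually_mono[OF eventually_nhds_in_open[OF open_einterval x(1)] \<Phi>_\<sigma>])
  ultimately have "(\<Phi> has_real_derivative deriv \<Phi> (\<sigma> x) * deriv \<sigma> x) (at x)"
    by (simp add: DERIV_cong_ev[OF refl ev refl])
  hence "deriv \<Phi> x = deriv \<Phi> (\<sigma> x) * deriv \<sigma> x"
    by (rule DERIV_imp_deriv)
  moreover have "deriv \<Phi> (\<sigma> x) \<noteq> 0"
    using deriv_nz[OF \<sigma>_in[OF x(1)]] \<sigma>_neg[OF x] by simp
  ultimately show ?thesis using d by simp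
qed

text \<open>The signed potential is strictly increasing through the bottom of the well, so its
  inverse is continuous there from both sides.\<close>

definition signed_potential :: "real \<Rightarrow> real" where
  "signed_potential x = (if 0 \<le> x then \<Phi> x else - \<Phi> x)"

definition branch :: "real \<Rightarrow> real" where
  "branch = the_inv_into (einterval xl xr) signed_potential"

lemma signed_potential_inj: "inj_on signed_potential (einterval xl xr)"
proof (rule inj_onI)
  fix x y assume D: "x \<in> einterval xl xr" "y \<in> einterval xl xr"
    and eq: "signed_potential x = signed_potential y"
  have "x \<ge> 0 \<longleftrightarrow> y \<ge> 0"
    using eq pos[OF D(1)] pos[OF D(2)] nonneg[OF D(1)] nonneg[OF D(2)]
    by (auto simp: signed_potential_def split: if_splits)
  thus "x = y"
    using inj_right[OF D] inj_left[OF D] eq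
    by (cases "x \<ge> 0") (auto simp: signed_potential_def)
qed

lemma branch_signed_potential: "x \<in> einterval xl xr \<Longrightarrow> branch (signed_potential x) = x"
  unfolding branch_def by (rule the_inv_into_f_f[OF signed_potential_inj])

lemma branch_\<Phi>: "x \<in> einterval xl xr \<Longrightarrow> 0 \<le> x \<Longrightarrow> branch (\<Phi> x) = x"
  using branch_signed_potential[of x] by (simp add: signed_potential_def)

lemma branch_0 [simp]: "branch 0 = 0"
  using branch_\<Phi>[OF zero_in] by simp

lemma branch_in: "t \<in> einterval 0 R \<Longrightarrow> branch t \<in> einterval xl xr"
  and branch_pos: "t \<in> einterval 0 R \<Longrightarrow> branch t > 0"
  and \<Phi>_branch: "t \<in> einterval 0 R \<Longrightarrow> \<Phi> (branch t) = t"
proof -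
  assume "t \<in> einterval 0 R"
  then obtain x where "x \<in> einterval xl xr" "0 < x" "t = \<Phi> x"
    using image unfolding right_half by blast
  thus "branch t \<in> einterval xl xr" "branch t > 0" "\<Phi> (branch t) = t"
    using branch_\<Phi>[of x] by auto
qed

lemma isCont_signed_potential:
  assumes "x \<in> einterval xl xr"
  shows "isCont signed_potential x"
proof -
  have "continuous_on (einterval xl xr) signed_potential"
  proof -
    have "continuous_on ({x\<in>einterval xl xr. 0 \<le> x} \<union> {x\<in>einterval xl xr. x \<le> 0})
        (\<lambda>x. if 0 \<le> x then \<Phi> x else - \<Phi> x)"
    proof (rule continuous_on_cases_local)
      show "closedin (top_of_set ({x \<in> einterval xl xr. 0 \<le> x} \<union> {x \<in> einterval xl xr. x \<le> 0}))
          {x \<in> einterval xl xr. 0 \<le> x}"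
        unfolding closedin_closed by (intro exI[of _ "{0..}"]) auto
      show "closedin (top_of_set ({x \<in> einterval xl xr. 0 \<le> x} \<union> {x \<in> einterval xl xr. x \<le> 0}))
          {x \<in> einterval xl xr. x \<le> 0}"
        unfolding closedin_closed by (intro exI[of _ "{..0}"]) auto
      show "continuous_on {x \<in> einterval xl xr. 0 \<le> x} \<Phi>"
        by (rule continuous_on_subset[OF cont_\<Phi>]) auto
      show "continuous_on {x \<in> einterval xl xr. x \<le> 0} (\<lambda>x. - \<Phi> x)"
        by (intro continuous_intros continuous_on_subset[OF cont_\<Phi>]) auto
    qed auto
    moreover have "{x\<in>einterval xl xr. 0 \<le> x} \<union> {x\<in>einterval xl xr. x \<le> 0} = einterval xl xr"
      by auto
    ultimately show "continuous_on (einterval xl xr) signed_potential"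
      by (simp add: signed_potential_def[abs_def])
  qed
  thus ?thesis using assms continuous_on_eq_continuous_at[OF open_einterval] by blast
qed

lemma isCont_branch:
  assumes t: "t \<in> insert 0 (einterval 0 R)"
  shows "isCont branch t"
proof -
  define x where "x = branch t"
  have x: "x \<in> einterval xl xr" "0 \<le> x" "\<Phi> x = t"
    using t zero_in branch_in[of t] branch_pos[of t] \<Phi>_branch[of t] by (auto simp: x_def)
  obtain e where e: "e > 0" "cball x e \<subseteq> einterval xl xr"
    using x(1) open_contains_cball open_einterval by metis
  have sub: "z \<in> einterval xl xr" if "x - e \<le> z" "z \<le> x + e" for z
    using e(2) that by (auto simp: subset_iff dist_real_def abs_le_iff)
  have "isCont branch (signed_potential x)"
    by (rule isCont_inverse_function2[of "x - e" _ "x + e"])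
       (use e(1) sub branch_signed_potential isCont_signed_potential in auto)
  thus ?thesis using x by (simp add: signed_potential_def)
qed

lemma DERIV_branch:
  assumes t: "t \<in> einterval 0 R"
  shows "(branch has_real_derivative 1 / deriv \<Phi> (branch t)) (at t)"
proof -
  obtain e where e: "e > 0" "ball t e \<subseteq> einterval 0 R"
    using t open_contains_ball open_einterval by metis
  have "(branch has_real_derivative inverse (deriv \<Phi> (branch t))) (at t)"
  proof (rule DERIV_inverse_function[where f = \<Phi> and a = "t - e" and b = "t + e"])
    show "\<Phi> (branch y) = y" if "t - e < y" "y < t + e" for y
      using e(2) that by (intro \<Phi>_branch) (auto simp: subset_iff dist_real_def abs_less_iff)
  qed (use DERIV_\<Phi>[OF branch_in[OF t]] deriv_nz[OF branch_in[OF t]] branch_pos[OF t] e(1)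
        isCont_branch[of t] t in auto)
  thus ?thesis by (simp add: inverse_eq_divide)
qed

lemma branch_analytic: "branch real_analytic_on einterval 0 R"
proof (rule real_analytic_onI)
  fix t assume t: "t \<in> einterval 0 R"
  show "branch real_analytic_on {t}"
  proof (rule real_analytic_on_inverse_function)
    show "\<Phi> real_analytic_on {branch t}"
      by (rule real_analytic_on_subset[OF analytic]) (use branch_in[OF t] in auto)
    show "deriv \<Phi> (branch t) \<noteq> 0" using deriv_nz[OF branch_in[OF t]] branch_pos[OF t] by auto
    show "isCont branch t" using t by (intro isCont_branch) auto
    show "\<forall>\<^sub>F s in nhds t. \<Phi> (branch s) = s"
      by (rule eventually_mono[OF eventually_nhds_in_open[OF open_einterval t] \<Phi>_branch])
  qed
qed

lemma branch_right: "t \<in> einterval 0 R \<Longrightarrow> branch t \<in> einterval 0 xr"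
  unfolding right_half using branch_in branch_pos by blast

lemma branch_inj: "inj_on branch (einterval 0 R)"
  by (metis inj_onI \<Phi>_branch)

lemma left_branch_in: "t \<in> einterval 0 R \<Longrightarrow> \<sigma> (branch t) \<in> einterval xl xr"
  by (intro \<sigma>_in branch_in)

lemma left_branch_neg: "t \<in> einterval 0 R \<Longrightarrow> \<sigma> (branch t) < 0"
  by (intro \<sigma>_neg branch_in branch_pos)

lemma \<Phi>_left_branch: "t \<in> einterval 0 R \<Longrightarrow> \<Phi> (\<sigma> (branch t)) = t"
  using \<Phi>_\<sigma>[OF branch_in] \<Phi>_branch by simp

lemma isCont_left_branch:
  assumes "t \<in> insert 0 (einterval 0 R)"
  shows "isCont (\<lambda>t. \<sigma> (branch t)) t"
  by (rule isCont_o2[OF isCont_branch[OF assms] real_analytic_on_imp_isCont[OF \<sigma>_analytic]])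
     (use assms zero_in branch_in in auto)

lemma DERIV_left_branch:
  assumes t: "t \<in> einterval 0 R"
  shows "((\<lambda>t. \<sigma> (branch t)) has_real_derivative 1 / deriv \<Phi> (\<sigma> (branch t))) (at t)"
  by (rule DERIV_cong[OF DERIV_chain2[OF DERIV_\<sigma>[OF branch_in[OF t] branch_pos[OF t]] DERIV_branch[OF t]]])
     (use deriv_nz[OF branch_in[OF t]] branch_pos[OF t] in simp)

lemma sublevel:
  assumes h: "h \<in> einterval 0 R" and x: "x \<in> einterval xl xr" "\<Phi> x \<le> h"
  shows "\<sigma> (branch h) \<le> x" "x \<le> branch h"
proof -
  show "x \<le> branch h"
  proof (rule ccontr)
    assume "\<not> x \<le> branch h"
    thus False
      using increasing[OF branch_in[OF h] x(1)] branch_pos[OF h] \<Phi>_branch[OF h] x(2) by simp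
  qed
  show "\<sigma> (branch h) \<le> x"
  proof (rule ccontr)
    assume "\<not> \<sigma> (branch h) \<le> x"
    thus False
      using decreasing[OF x(1) left_branch_in[OF h]] left_branch_neg[OF h] \<Phi>_left_branch[OF h] x(2)
      by simp
  qed
qed

lemma sublevel_iff:
  assumes h: "h \<in> einterval 0 R" and x: "\<sigma> (branch h) \<le> x" "x \<le> branch h"
  shows "x \<in> einterval xl xr" "\<Phi> x \<le> h"
proof -
  show D: "x \<in> einterval xl xr"
    by (rule between_in[OF left_branch_in[OF h] branch_in[OF h] x])
  show "\<Phi> x \<le> h"
  proof (cases "0 \<le> x")
    case True
    thus ?thesis
      using increasing[OF D branch_in[OF h]] \<Phi>_branch[OF h] x(2) by (cases "x = branch h") auto
  next
    case False
    thus ?thesis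
      using decreasing[OF left_branch_in[OF h] D] \<Phi>_left_branch[OF h] x(1)
      by (cases "x = \<sigma> (branch h)") auto
  qed
qed

lemma eq_branch: "y \<in> einterval xl xr \<Longrightarrow> 0 \<le> y \<Longrightarrow> y = branch (\<Phi> y)"
  by (simp add: branch_\<Phi>)

lemma eq_left_branch:
  assumes y: "y \<in> einterval xl xr" "y \<le> 0" "\<Phi> y \<in> insert 0 (einterval 0 R)"
  shows "y = \<sigma> (branch (\<Phi> y))"
proof (cases "y = 0")
  case False
  hence t: "\<Phi> y \<in> einterval 0 R" using y pos[of y] by auto
  show ?thesis
    using inj_left[OF y(1) left_branch_in[OF t] y(2)] left_branch_neg[OF t] \<Phi>_left_branch[OF t] by simp
qed simp

text \<open>Changing the variable in an integral over a sublevel interval to the energy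
  \<open>t = \<Phi> x\<close> folds the two branches of the well onto each other.\<close>

lemma fold_has_integral:
  assumes h: "h \<in> einterval 0 R"
    and k: "continuous_on {\<sigma> (branch h)..branch h} k"
  shows "((\<lambda>t. balance \<sigma> (\<lambda>x. k x / deriv \<Phi> x) (branch t)) has_integral
     integral {\<sigma> (branch h)..branch h} k) {0..h}"
proof -
  define p q where "p = \<sigma> (branch h)" and "q = branch h"
  define U where "U x = integral {p..x} k" for x
  have pq: "p < q" using left_branch_neg[OF h] branch_pos[OF h] by (simp add: p_def q_def)
  have h0: "0 < h" using h by (simp add: einterval_iff)
  have inI: "t \<in> einterval 0 R" if "0 < t" "t \<le> h" for t
    using einterval_0_Icc_subset[OF h, of t t] that by auto
  have k': "continuous_on {p..q} k" using k by (simp add: p_def q_def)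
  have contU: "continuous_on {p..q} U"
    unfolding U_def by (rule indefinite_integral_continuous_1[OF integrable_continuous_interval[OF k']])
  have DU: "(U has_real_derivative k x) (at x)" if "p < x" "x < q" for x
  proof -
    have "(U has_real_derivative k x) (at x within {p..q})"
      unfolding U_def by (rule integral_has_real_derivative[OF k']) (use that in auto)
    moreover have "at x within {p..q} = at x"
      using that by (intro at_within_interior) auto
    ultimately show ?thesis by simp
  qed
  have range: "branch t \<in> {p..q}" "\<sigma> (branch t) \<in> {p..q}" if t: "0 \<le> t" "t \<le> h" for t
  proof -
    have "branch t \<in> einterval xl xr" "\<Phi> (branch t) = t"
        "\<sigma> (branch t) \<in> einterval xl xr" "\<Phi> (\<sigma> (branch t)) = t"
      using inI[of t] t zero_in branch_in[of t] \<Phi>_branch[of t] left_branch_in[of t] \<Phi>_left_branch[of t]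
      by (cases "t = 0"; auto)+
    thus "branch t \<in> {p..q}" "\<sigma> (branch t) \<in> {p..q}"
      using sublevel[OF h] t unfolding p_def q_def by auto
  qed
  have isC: "t \<in> insert 0 (einterval 0 R)" if "t \<in> {0..h}" for t
    using inI[of t] that by (cases "t = 0") auto
  have "((\<lambda>t. balance \<sigma> (\<lambda>x. k x / deriv \<Phi> x) (branch t)) has_integral
      ((U (branch h) - U (\<sigma> (branch h))) - (U (branch 0) - U (\<sigma> (branch 0))))) {0..h}"
  proof (rule fundamental_theorem_of_calculus_interior)
    show "continuous_on {0..h} (\<lambda>t. U (branch t) - U (\<sigma> (branch t)))"
      using range isC
      by (intro continuous_on_diff continuous_on_compose2[OF contU]
            continuous_at_imp_continuous_on ballI isCont_branch isCont_left_branch) auto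
    fix t assume t: "t \<in> {0<..<h}"
    hence tI: "t \<in> einterval 0 R" using inI by auto
    have ne: "branch t \<noteq> q" "\<sigma> (branch t) \<noteq> p"
      using \<Phi>_branch[OF tI] \<Phi>_branch[OF h] \<Phi>_left_branch[OF tI] \<Phi>_left_branch[OF h] t
      by (auto simp: p_def q_def)
    have ineq: "p < branch t" "branch t < q" "p < \<sigma> (branch t)" "\<sigma> (branch t) < q"
      using range[of t] ne t branch_pos[OF tI] left_branch_neg[OF h] left_branch_neg[OF tI] branch_pos[OF h]
      by (auto simp: p_def q_def)
    have "((\<lambda>t. U (branch t) - U (\<sigma> (branch t))) has_real_derivative
        (k (branch t) * (1 / deriv \<Phi> (branch t)) - k (\<sigma> (branch t)) * (1 / deriv \<Phi> (\<sigma> (branch t))))) (at t)"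
      by (intro DERIV_diff DERIV_chain2[OF DU DERIV_branch[OF tI]]
            DERIV_chain2[OF DU DERIV_left_branch[OF tI]] ineq)
    thus "((\<lambda>t. U (branch t) - U (\<sigma> (branch t))) has_vector_derivative
        balance \<sigma> (\<lambda>x. k x / deriv \<Phi> x) (branch t)) (at t)"
      by (simp add: has_real_derivative_iff_has_vector_derivative balance_def)
  qed (use h0 in simp)
  thus ?thesis by (simp add: U_def p_def q_def)
qed

text \<open>The quotient \<open>f / \<Phi>'\<close> has a pole at the bottom of the well in general, but a primitive of \<open>f\<close>,
  read along the two branches, is continuous there.\<close>

lemma fold_primitive_pair:
  assumes f: "continuous_on (einterval xl xr) f"
    and an: "balance \<sigma> (\<lambda>x. f x / deriv \<Phi> x) real_analytic_on einterval 0 xr"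
  obtains F1 where "primitive_pair R (\<lambda>t. balance \<sigma> (\<lambda>x. f x / deriv \<Phi> x) (branch t)) F1"
proof -
  obtain A where DA: "\<And>x. x \<in> einterval xl xr \<Longrightarrow> (A has_real_derivative f x) (at x)"
    using einterval_primitive[OF f] by metis
  have contA: "isCont A x" if "x \<in> einterval xl xr" for x
    using DA[OF that] by (rule DERIV_isCont)
  have inD: "branch t \<in> einterval xl xr" "\<sigma> (branch t) \<in> einterval xl xr"
    if "t \<in> insert 0 (einterval 0 R)" for t
    using that zero_in branch_in left_branch_in by auto
  have "primitive_pair R (\<lambda>t. balance \<sigma> (\<lambda>x. f x / deriv \<Phi> x) (branch t))
     (\<lambda>t. A (branch t) - A (\<sigma> (branch t)))"
  proof
    show "(\<lambda>t. balance \<sigma> (\<lambda>x. f x / deriv \<Phi> x) (branch t)) real_analytic_on einterval 0 R"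
      by (rule real_analytic_on_compose[OF an branch_analytic]) (use branch_right in blast)
    show "continuous_on (insert 0 (einterval 0 R)) (\<lambda>t. A (branch t) - A (\<sigma> (branch t)))"
      by (intro continuous_at_imp_continuous_on ballI continuous_diff isCont_o2[OF isCont_branch]
           isCont_o2[OF isCont_left_branch] contA inD)
    show "A (branch 0) - A (\<sigma> (branch 0)) = 0" by simp
    fix t assume t: "t \<in> einterval 0 R"
    have "((\<lambda>t. A (branch t) - A (\<sigma> (branch t))) has_real_derivative
       (f (branch t) * (1 / deriv \<Phi> (branch t)) - f (\<sigma> (branch t)) * (1 / deriv \<Phi> (\<sigma> (branch t))))) (at t)"
      by (intro DERIV_diff DERIV_chain2[OF DA DERIV_branch[OF t]]
            DERIV_chain2[OF DA DERIV_left_branch[OF t]] branch_in left_branch_in t)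
    thus "((\<lambda>t. A (branch t) - A (\<sigma> (branch t))) has_real_derivative
        balance \<sigma> (\<lambda>x. f x / deriv \<Phi> x) (branch t)) (at t)"
      by (simp add: balance_def)
  qed
  thus ?thesis using that by blast
qed

end

section \<open>Abelian integrals as convolutions\<close>

locale separable_hamiltonian =
  X: energy_well \<Phi> xl xr \<sigma>1 R + Y: energy_well \<Psi> yl yr \<sigma>2 R
  for \<Phi> :: "real \<Rightarrow> real" and xl xr \<sigma>1 R \<Psi> yl yr \<sigma>2
begin

lemma level_cases:
  assumes h: "h \<in> einterval 0 R"
    and x: "x \<in> einterval xl xr" and y: "y \<in> einterval yl yr" and H: "\<Phi> x + \<Psi> y = h"
  shows "x \<in> {\<sigma>1 (X.branch h)..X.branch h}"
    and "0 \<le> y \<Longrightarrow> y = Y.branch (h - \<Phi> x)"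
    and "y \<le> 0 \<Longrightarrow> y = \<sigma>2 (Y.branch (h - \<Phi> x))"
    and "y \<noteq> 0 \<Longrightarrow> \<sigma>1 (X.branch h) < x \<and> x < X.branch h"
    and "y = 0 \<Longrightarrow> x = X.branch h \<or> x = \<sigma>1 (X.branch h)"
proof -
  have h0: "0 < h" using h by (simp add: einterval_iff)
  have \<Psi>: "\<Psi> y = h - \<Phi> x" "0 \<le> \<Psi> y" "0 \<le> \<Phi> x" using H Y.nonneg[OF y] X.nonneg[OF x] by auto
  show rng: "x \<in> {\<sigma>1 (X.branch h)..X.branch h}"
    using X.sublevel[OF h x] \<Psi> by auto
  have I: "\<Psi> y \<in> insert 0 (einterval 0 R)"
    by (rule subsetD[OF einterval_0_Icc_subset'[OF h, of 0 h]]) (use \<Psi> in auto)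
  show "y = Y.branch (h - \<Phi> x)" if "0 \<le> y" using Y.eq_branch[OF y that] \<Psi> by simp
  show "y = \<sigma>2 (Y.branch (h - \<Phi> x))" if "y \<le> 0" using Y.eq_left_branch[OF y that I] \<Psi> by simp
  show "\<sigma>1 (X.branch h) < x \<and> x < X.branch h" if "y \<noteq> 0"
  proof -
    have "\<Phi> x < h" using Y.pos[OF y that] H by simp
    hence "x \<noteq> X.branch h" "x \<noteq> \<sigma>1 (X.branch h)"
      using X.\<Phi>_branch[OF h] X.\<Phi>_left_branch[OF h] by auto
    thus ?thesis using rng by auto
  qed
  show "x = X.branch h \<or> x = \<sigma>1 (X.branch h)" if "y = 0"
  proof -
    have "\<Phi> x = h" using H that by simp
    thus ?thesis
      using X.inj_right[OF x X.branch_in[OF h]] X.inj_left[OF x X.left_branch_in[OF h]]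
        X.branch_pos[OF h] X.left_branch_neg[OF h] X.\<Phi>_branch[OF h] X.\<Phi>_left_branch[OF h]
      by (cases "x \<ge> 0") auto
  qed
qed

text \<open>On the level curve the form \<open>f(x) g(y) dx\<close> differs from a constant multiple of the angular
  form by the differential of a function \<open>W\<close> that is single valued on the curve. The integral
  of the angular form is \<open>2 pi\<close> times the winding number, whatever the parameterization.\<close>

lemma oval_integral:
  fixes c :: "real \<Rightarrow> complex" and s :: real
  assumes h: "h \<in> einterval 0 R"
    and c: "valid_path c" "simple_path c" "pathfinish c = pathstart c"
    and im: "\<And>z. z \<in> path_image c \<Longrightarrow>
       Re z \<in> einterval xl xr \<and> Im z \<in> einterval yl yr \<and> \<Phi> (Re z) + \<Psi> (Im z) = h"
    and wn: "winding_number c 0 = of_real s"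
    and f: "continuous_on (einterval xl xr) f" and g: "continuous_on (einterval yl yr) g"
  shows "line_integral_dx (\<lambda>x y. f x * g y) c =
    - s * integral {\<sigma>1 (X.branch h)..X.branch h} (\<lambda>x. f x * balance \<sigma>2 g (Y.branch (h - \<Phi> x)))"
proof -
  define p q where "p = \<sigma>1 (X.branch h)" and "q = X.branch h"
  have pq: "p < 0" "0 < q" using X.left_branch_neg[OF h] X.branch_pos[OF h] by (auto simp: p_def q_def)
  have h0: "0 < h" using h by (simp add: einterval_iff)
  have pqD: "x \<in> einterval xl xr" "\<Phi> x \<le> h" if "x \<in> {p..q}" for x
    using X.sublevel_iff[OF h, of x] that by (auto simp: p_def q_def)
  have energy: "h - \<Phi> x \<in> insert 0 (einterval 0 R)" if "x \<in> {p..q}" for x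
    by (rule subsetD[OF einterval_0_Icc_subset'[OF h, of 0 h]])
       (use pqD[OF that] X.nonneg[of x] in auto)
  have Yin: "Y.branch t \<in> einterval yl yr" "\<sigma>2 (Y.branch t) \<in> einterval yl yr"
    if "t \<in> insert 0 (einterval 0 R)" for t
    using that Y.zero_in Y.branch_in Y.left_branch_in by auto
  define a where "a x = f x * g (Y.branch (h - \<Phi> x))" for x
  define b where "b x = f x * g (\<sigma>2 (Y.branch (h - \<Phi> x)))" for x
  have cont_energy: "continuous_on {p..q} (\<lambda>x. h - \<Phi> x)"
    using pqD by (intro continuous_intros continuous_on_subset[OF X.cont_\<Phi>]) auto
  have contf: "continuous_on {p..q} f"
    using pqD by (intro continuous_on_subset[OF f]) auto
  have contg: "continuous_on (insert 0 (einterval 0 R)) (\<lambda>t. g (Y.branch t))"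
      "continuous_on (insert 0 (einterval 0 R)) (\<lambda>t. g (\<sigma>2 (Y.branch t)))"
    using Yin
    by (intro continuous_on_compose2[OF g] continuous_at_imp_continuous_on ballI
         Y.isCont_branch Y.isCont_left_branch; blast)+
  have img: "(\<lambda>x. h - \<Phi> x) ` {p..q} \<subseteq> insert 0 (einterval 0 R)" using energy by blast
  have conta: "continuous_on {p..q} a" and contb: "continuous_on {p..q} b"
    unfolding a_def[abs_def] b_def[abs_def]
    by (intro continuous_on_mult contf continuous_on_compose2[OF contg(1) cont_energy img]
         continuous_on_compose2[OF contg(2) cont_energy img])+
  define A where "A x = integral {p..x} a" for x
  define B where "B x = integral {p..x} b" for x
  have contA: "continuous_on {p..q} A" and contB: "continuous_on {p..q} B"
    unfolding A_def B_def
    by (intro indefinite_integral_continuous_1 integrable_continuous_interval conta contb)+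
  have DA: "(A has_real_derivative a x) (at x)" and DB: "(B has_real_derivative b x) (at x)"
    if "p < x" "x < q" for x
  proof -
    have at: "at x within {p..q} = at x" using that by (intro at_within_interior) auto
    show "(A has_real_derivative a x) (at x)"
      using integral_has_real_derivative[OF conta, of x] that unfolding A_def at by simp
    show "(B has_real_derivative b x) (at x)"
      using integral_has_real_derivative[OF contb, of x] that unfolding B_def at by simp
  qed
  have Ap: "A p = 0" and Bp: "B p = 0" by (simp_all add: A_def B_def)
  define I0 where "I0 = B q - A q"
  \<comment> \<open>With this multiple of the angular form, the jump of the primitives of \<open>a dx\<close> and \<open>b dx\<close> at the
    right vertex is compensated by the jump \<open>2 pi\<close> of the argument.\<close>
  define \<kappa> where "\<kappa> = I0 / (2 * pi)"
  \<comment> \<open>The two branches of the argument are continuous on the closed upper and lower half planes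
    without the origin; they agree at the left vertex and differ by \<open>2 pi\<close> at the right one.\<close>
  define up where "up z = A (Re z) - A q - \<kappa> * (Im (Ln (- \<i> * z)) + pi / 2)" for z
  define lo where "lo z = B (Re z) - A q - \<kappa> * (Im (Ln (\<i> * z)) + 3 * pi / 2)" for z
  define W where "W z = (if Im z \<le> 0 then lo z else up z)" for z
  have level: "Re (c t) \<in> {p..q}" "c t \<noteq> 0"
      "0 \<le> Im (c t) \<Longrightarrow> Im (c t) = Y.branch (h - \<Phi> (Re (c t)))"
      "Im (c t) \<le> 0 \<Longrightarrow> Im (c t) = \<sigma>2 (Y.branch (h - \<Phi> (Re (c t))))"
      "Im (c t) \<noteq> 0 \<Longrightarrow> p < Re (c t) \<and> Re (c t) < q"
      "Im (c t) = 0 \<Longrightarrow> c t \<in> {of_real p, of_real q}"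
    if t: "t \<in> {0..1}" for t
  proof -
    have "c t \<in> path_image c" using t by (auto simp: path_image_def)
    note z = conjunct1[OF im[OF this]] conjunct1[OF conjunct2[OF im[OF this]]]
      conjunct2[OF conjunct2[OF im[OF this]]]
    note lc = level_cases[OF h z]
    show "Re (c t) \<in> {p..q}" using lc(1) by (simp add: p_def q_def)
    show "c t \<noteq> 0" using z h0 by auto
    show "0 \<le> Im (c t) \<Longrightarrow> Im (c t) = Y.branch (h - \<Phi> (Re (c t)))" by (rule lc(2))
    show "Im (c t) \<le> 0 \<Longrightarrow> Im (c t) = \<sigma>2 (Y.branch (h - \<Phi> (Re (c t))))" by (rule lc(3))
    show "Im (c t) \<noteq> 0 \<Longrightarrow> p < Re (c t) \<and> Re (c t) < q" using lc(4) by (simp add: p_def q_def)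
    show "Im (c t) = 0 \<Longrightarrow> c t \<in> {of_real p, of_real q}"
      using lc(5) by (auto simp: p_def q_def complex_eq_iff)
  qed
  have contc: "continuous_on {0..1} c"
    using c(1) valid_path_imp_path path_def by blast
  have contW: "continuous_on {0..1} (\<lambda>t. W (c t))"
    unfolding W_def
  proof (rule continuous_on_cases_le)
    show "continuous_on {t \<in> {0..1}. Im (c t) \<le> 0} (\<lambda>t. lo (c t))"
      unfolding lo_def
    proof (intro continuous_intros)
      show "continuous_on {t \<in> {0..1}. Im (c t) \<le> 0} (\<lambda>t. B (Re (c t)))"
        using level(1)
        by (intro continuous_on_compose2[OF contB] continuous_intros continuous_on_subset[OF contc]) auto
      show "continuous_on {t \<in> {0..1}. Im (c t) \<le> 0} c" by (rule continuous_on_subset[OF contc]) auto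
      show "\<i> * c t \<notin> \<real>\<^sub>\<le>\<^sub>0" if "t \<in> {t \<in> {0..1}. Im (c t) \<le> 0}" for t
        using level(2)[of t] that by (auto simp: complex_nonpos_Reals_iff complex_eq_iff)
    qed
    show "continuous_on {t \<in> {0..1}. 0 \<le> Im (c t)} (\<lambda>t. up (c t))"
      unfolding up_def
    proof (intro continuous_intros)
      show "continuous_on {t \<in> {0..1}. 0 \<le> Im (c t)} (\<lambda>t. A (Re (c t)))"
        using level(1)
        by (intro continuous_on_compose2[OF contA] continuous_intros continuous_on_subset[OF contc]) auto
      show "continuous_on {t \<in> {0..1}. 0 \<le> Im (c t)} c" by (rule continuous_on_subset[OF contc]) auto
      show "- \<i> * c t \<notin> \<real>\<^sub>\<le>\<^sub>0" if "t \<in> {t \<in> {0..1}. 0 \<le> Im (c t)}" for t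
        using level(2)[of t] that by (auto simp: complex_nonpos_Reals_iff complex_eq_iff)
    qed
    show "continuous_on {0..1} (\<lambda>t. Im (c t))" by (intro continuous_intros contc)
    show "lo (c t) = up (c t)" if "t \<in> {0..1}" "Im (c t) = 0" for t
    proof -
      have Lnp: "Im (Ln (\<i> * of_real x)) = pi / 2 \<and> Im (Ln (- \<i> * of_real x)) = - pi / 2" if "x > 0" for x
        using that Im_Ln_eq_pi_half(1)[of "\<i> * of_real x"] Im_Ln_eq_pi_half(2)[of "- \<i> * of_real x"]
        by simp
      from level(6)[OF that] consider "c t = of_real p" | "c t = of_real q" by blast
      thus ?thesis
      proof cases
        case 1
        have "Im (Ln (\<i> * of_real p)) = - pi / 2" "Im (Ln (- \<i> * of_real p)) = pi / 2"
          using Lnp[of "- p"] pq by simp_all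
        thus ?thesis unfolding lo_def up_def 1 by (simp add: Ap Bp)
      next
        case 2
        have "\<kappa> * (2 * pi) = B q - A q" by (simp add: \<kappa>_def I0_def)
        moreover have "lo (c t) - up (c t) = B q - A q - \<kappa> * (2 * pi)"
          unfolding lo_def up_def 2 using Lnp[OF pq(2)] by (simp add: algebra_simps)
        ultimately show ?thesis by simp
      qed
    qed
  qed
  obtain S D where S: "finite S" and D: "\<And>t. t \<in> {0..1} - S \<Longrightarrow> (c has_vector_derivative D t) (at t)"
    using c(1) unfolding valid_path_def piecewise_C1_differentiable_on_def C1_differentiable_on_def by blast
  define Z where "Z = {t \<in> {0<..<1}. Im (c t) = 0}"
  have "finite Z"
  proof -
      \<comment> \<open>The curve meets the horizontal axis only at its two vertices, and it is simple.\<close>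
    have single: "finite {t \<in> {0<..<1}. c t = w}" for w
    proof (rule ccontr)
      assume "infinite {t \<in> {0<..<1}. c t = w}"
      then obtain T where "T \<subseteq> {t \<in> {0<..<1}. c t = w}" "finite T" "card T = 2"
        using infinite_arbitrarily_large by metis
      then obtain t1 t2 where "t1 \<noteq> t2" "t1 \<in> {0<..<1}" "t2 \<in> {0<..<1}" "c t1 = c t2"
        unfolding card_2_iff by auto
      thus False using c(2) unfolding simple_path_def loop_free_def by fastforce
    qed
    have "Z \<subseteq> {t \<in> {0<..<1}. c t = of_real p} \<union> {t \<in> {0<..<1}. c t = of_real q}"
    proof
      fix t assume "t \<in> Z"
      thus "t \<in> {t \<in> {0<..<1}. c t = of_real p} \<union> {t \<in> {0<..<1}. c t = of_real q}"
        using level(6)[of t] unfolding Z_def by auto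
    qed
    thus ?thesis using single finite_subset by blast
  qed
  define form where "form t = f (Re (c t)) * g (Im (c t)) * Re (vector_derivative c (at t within {0..1}))" for t
  define ang where "ang t = Im (1 / (c t - 0) * vector_derivative c (at t within {0..1}))" for t
  have "((\<lambda>t. form t - \<kappa> * ang t) has_integral (W (c 1) - W (c 0))) {0..1}"
  proof (rule fundamental_theorem_of_calculus_interior_strong)
    show "finite (S \<union> Z)" using S \<open>finite Z\<close> by simp
    fix t assume t: "t \<in> {0<..<1} - (S \<union> Z)"
    hence t01: "t \<in> {0..1}" by auto
    have dc: "(c has_vector_derivative D t) (at t)" using D t by auto
    hence vd: "vector_derivative c (at t within {0..1}) = D t"
      using t by (intro vector_derivative_at_within_ivl) auto
    have dRe: "((\<lambda>t. Re (c t)) has_real_derivative Re (D t)) (at t)"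
      using bounded_linear.has_vector_derivative[OF bounded_linear_Re dc]
      by (simp add: has_real_derivative_iff_has_vector_derivative)
    have cz: "c t \<noteq> 0" using level(2)[OF t01] .
    have dLn: "((\<lambda>t. Im (Ln (w * c t))) has_real_derivative ang t) (at t)"
      if w: "w \<noteq> 0" "w * c t \<notin> \<real>\<^sub>\<le>\<^sub>0" for w
    proof -
      have "((\<lambda>t. w * c t) has_vector_derivative w * D t) (at t)"
        by (rule has_vector_derivative_mult_right[OF dc])
      hence "((Ln \<circ> (\<lambda>t. w * c t)) has_vector_derivative (w * D t) * inverse (w * c t)) (at t)"
        by (intro field_vector_diff_chain_at has_field_derivative_Ln w)
      from bounded_linear.has_vector_derivative[OF bounded_linear_Im this]
      show ?thesis
        using w cz by (simp add: has_real_derivative_iff_has_vector_derivative ang_def vd o_def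
            field_simps del: Im_divide)
    qed
    have nz: "Im (c t) \<noteq> 0" using t by (auto simp: Z_def)
    have rng: "p < Re (c t)" "Re (c t) < q" using level(5)[OF t01 nz] by auto
    have isCc: "isCont c t" using dc has_vector_derivative_continuous by blast
    hence tend: "((\<lambda>t. Im (c t)) \<longlongrightarrow> Im (c t)) (nhds t)"
      unfolding continuous_at tendsto_at_iff_tendsto_nhds by (intro tendsto_intros)
    have "((\<lambda>t. W (c t)) has_real_derivative form t - \<kappa> * ang t) (at t)"
    proof (cases "Im (c t) > 0")
      case True
      have "\<forall>\<^sub>F t in nhds t. Im (c t) > 0" using order_tendstoD(1)[OF tend True] .
      hence ev: "\<forall>\<^sub>F t in nhds t. up (c t) = W (c t)" by eventually_elim (simp add: W_def)
      have "- \<i> * c t \<notin> \<real>\<^sub>\<le>\<^sub>0" using True by (auto simp: complex_nonpos_Reals_iff)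
      hence "((\<lambda>t. up (c t)) has_real_derivative a (Re (c t)) * Re (D t) - 0 - \<kappa> * (ang t + 0)) (at t)"
        unfolding up_def
        by (intro DERIV_diff DERIV_add DERIV_const DERIV_cmult DERIV_chain2[OF DA dRe] rng dLn) simp
      moreover have "a (Re (c t)) * Re (D t) = form t"
        unfolding a_def form_def vd using level(3)[OF t01] True by simp
      ultimately show ?thesis using DERIV_cong_ev[OF refl ev refl] by simp
    next
      case False
      hence neg: "Im (c t) < 0" using nz by simp
      have "\<forall>\<^sub>F t in nhds t. Im (c t) < 0" using order_tendstoD(2)[OF tend neg] .
      hence ev: "\<forall>\<^sub>F t in nhds t. lo (c t) = W (c t)" by eventually_elim (simp add: W_def)
      have "\<i> * c t \<notin> \<real>\<^sub>\<le>\<^sub>0" using neg by (auto simp: complex_nonpos_Reals_iff)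
      hence "((\<lambda>t. lo (c t)) has_real_derivative b (Re (c t)) * Re (D t) - 0 - \<kappa> * (ang t + 0)) (at t)"
        unfolding lo_def
        by (intro DERIV_diff DERIV_add DERIV_const DERIV_cmult DERIV_chain2[OF DB dRe] rng dLn) simp
      moreover have "b (Re (c t)) * Re (D t) = form t"
        unfolding b_def form_def vd using level(4)[OF t01] neg by simp
      ultimately show ?thesis using DERIV_cong_ev[OF refl ev refl] by simp
    qed
    thus "((\<lambda>t. W (c t)) has_vector_derivative form t - \<kappa> * ang t) (at t)"
      by (simp add: has_real_derivative_iff_has_vector_derivative)
  qed (use contW in auto)
  moreover have "c 1 = c 0" using c(3) by (simp add: pathfinish_def pathstart_def)
  ultimately have exact: "((\<lambda>t. form t - \<kappa> * ang t) has_integral 0) {0..1}" by simp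
  have "0 \<notin> path_image c" using level(2) unfolding path_image_def by force
  hence "((\<lambda>w. 1 / (w - 0)) has_contour_integral 2 * pi * \<i> * winding_number c 0) c"
    by (rule has_contour_integral_winding_number[OF c(1)])
  hence "((\<lambda>t. 1 / (c t - 0) * vector_derivative c (at t within {0..1})) has_integral
      2 * pi * \<i> * of_real s) {0..1}"
    unfolding has_contour_integral_def wn .
  hence "(ang has_integral Im (2 * pi * \<i> * of_real s)) {0..1}"
    unfolding ang_def[abs_def] by (rule has_integral_Im)
  hence "(ang has_integral 2 * pi * s) {0..1}" by simp
  from has_integral_add[OF exact has_integral_mult_right[OF this, of \<kappa>]]
  have "(form has_integral \<kappa> * (2 * pi * s)) {0..1}" by simp
  hence "line_integral_dx (\<lambda>x y. f x * g y) c = I0 * s"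
    unfolding line_integral_dx_def form_def[abs_def] \<kappa>_def by (simp add: integral_unique)
  also have "I0 = integral {p..q} (\<lambda>x. b x - a x)"
    unfolding I0_def A_def B_def
    by (intro integral_diff[symmetric] integrable_continuous_interval conta contb)
  also have "(\<lambda>x. b x - a x) = (\<lambda>x. - (f x * balance \<sigma>2 g (Y.branch (h - \<Phi> x))))"
    by (simp add: a_def b_def balance_def algebra_simps)
  finally show ?thesis by (simp add: p_def q_def)
qed

text \<open>Folding the two branches of \<open>\<Phi>\<close> turns the integral over the sublevel interval
  into a convolution in the energy; the orientation is absorbed into \<open>f\<close>.\<close>

lemma oval_integral_eq_convolution:
  fixes c :: "real \<Rightarrow> complex" and s :: real
  assumes h: "h \<in> einterval 0 R"
    and c: "valid_path c" "simple_path c" "pathfinish c = pathstart c"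
    and im: "\<And>z. z \<in> path_image c \<Longrightarrow>
       Re z \<in> einterval xl xr \<and> Im z \<in> einterval yl yr \<and> \<Phi> (Re z) + \<Psi> (Im z) = h"
    and wn: "winding_number c 0 = of_real s"
    and f: "continuous_on (einterval xl xr) f" and g: "continuous_on (einterval yl yr) g"
    and M: "\<And>t. t \<in> einterval 0 R \<Longrightarrow> M t = balance \<sigma>2 g (Y.branch t)"
  shows "line_integral_dx (\<lambda>x y. f x * g y) c =
    convolution (\<lambda>t. balance \<sigma>1 (\<lambda>x. (- s * f x) / deriv \<Phi> x) (X.branch t)) M h"
proof -
  define p q where "p = \<sigma>1 (X.branch h)" and "q = X.branch h"
  define k where "k x = (- s * f x) * balance \<sigma>2 g (Y.branch (h - \<Phi> x))" for x
  have pqD: "x \<in> einterval xl xr" "\<Phi> x \<le> h" if "x \<in> {p..q}" for x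
    using X.sublevel_iff[OF h, of x] that by (auto simp: p_def q_def)
  have h0: "0 < h" using h by (simp add: einterval_iff)
  have energy: "(\<lambda>x. h - \<Phi> x) ` {p..q} \<subseteq> insert 0 (einterval 0 R)"
  proof
    fix t assume "t \<in> (\<lambda>x. h - \<Phi> x) ` {p..q}"
    hence "t \<in> {0..h}" using pqD X.nonneg by auto
    thus "t \<in> insert 0 (einterval 0 R)"
      using einterval_0_Icc_subset'[OF h, of 0 h] by auto
  qed
  have Yin: "Y.branch t \<in> einterval yl yr" "\<sigma>2 (Y.branch t) \<in> einterval yl yr"
    if "t \<in> insert 0 (einterval 0 R)" for t
    using that Y.zero_in Y.branch_in Y.left_branch_in by auto
  have "continuous_on (insert 0 (einterval 0 R)) (\<lambda>t. balance \<sigma>2 g (Y.branch t))"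
    unfolding balance_def using Yin
    by (intro continuous_on_diff continuous_on_compose2[OF g] continuous_at_imp_continuous_on ballI
         Y.isCont_branch Y.isCont_left_branch; blast)
  hence "continuous_on {p..q} (\<lambda>x. balance \<sigma>2 g (Y.branch (h - \<Phi> x)))"
    by (rule continuous_on_compose2[OF _ _ energy])
       (intro continuous_intros continuous_on_subset[OF X.cont_\<Phi>] subsetI pqD)
  moreover have "continuous_on {p..q} f"
    by (intro continuous_on_subset[OF f] subsetI pqD)
  ultimately have contk: "continuous_on {p..q} k"
    unfolding k_def by (intro continuous_intros)
  have "integral {0..h} (\<lambda>t. balance \<sigma>1 (\<lambda>x. k x / deriv \<Phi> x) (X.branch t)) = integral {p..q} k"
    using integral_unique[OF X.fold_has_integral[OF h, of k]] contk by (simp add: p_def q_def)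
  also have "integral {p..q} k =
      - s * integral {p..q} (\<lambda>x. f x * balance \<sigma>2 g (Y.branch (h - \<Phi> x)))"
    unfolding k_def
    by (simp only: mult.assoc integral_mult_right)
  also have "integral {0..h} (\<lambda>t. balance \<sigma>1 (\<lambda>x. k x / deriv \<Phi> x) (X.branch t)) =
      convolution (\<lambda>t. balance \<sigma>1 (\<lambda>x. (- s * f x) / deriv \<Phi> x) (X.branch t)) M h"
    unfolding convolution_def integral_open_interval_real
  proof (rule integral_cong)
    fix t assume t: "t \<in> {0<..<h}"
    have tI: "t \<in> einterval 0 R" "h - t \<in> einterval 0 R"
      using einterval_0_Icc_subset[OF h, of t t] einterval_0_Icc_subset[OF h, of "h - t" "h - t"] t by auto
    show "balance \<sigma>1 (\<lambda>x. k x / deriv \<Phi> x) (X.branch t) =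
        balance \<sigma>1 (\<lambda>x. (- s * f x) / deriv \<Phi> x) (X.branch t) * M (h - t)"
      unfolding balance_def[of \<sigma>1] k_def X.\<Phi>_branch[OF tI(1)] X.\<Phi>_left_branch[OF tI(1)] M[OF tI(2)]
      by (simp add: algebra_simps diff_divide_distrib)
  qed
  finally show ?thesis
    using oval_integral[OF h c im wn f g] by (simp add: p_def q_def)
qed

end

section \<open>Balances and their derivatives at the critical level\<close>

text \<open>Only the germ to the right of \<open>0\<close> matters: at \<open>0\<close> itself, where \<open>deriv \<Psi>\<close> vanishes, balances
  of the \<open>g_seq\<close> may have arbitrary values.\<close>

definition vanishing_order_right :: "(real \<Rightarrow> real) \<Rightarrow> nat \<Rightarrow> bool" where
  "vanishing_order_right G p \<longleftrightarrow>
     (\<exists>a. a real_analytic_on {0} \<and> (\<forall>\<^sub>F y in at_right 0. G y = y ^ p * a y))"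

lemma vanishing_order_right_tendsto:
  assumes "vanishing_order_right G p" "p > 0"
  shows "(G \<longlongrightarrow> 0) (at_right 0)"
proof -
  obtain a where a: "a real_analytic_on {0}" and ev: "\<forall>\<^sub>F y in at_right 0. G y = y ^ p * a y"
    using assms(1) unfolding vanishing_order_right_def by blast
  have "isCont a 0" using real_analytic_on_imp_isCont[OF a] by simp
  hence "isCont (\<lambda>y. y ^ p * a y) 0" by (intro continuous_intros)
  hence "((\<lambda>y. y ^ p * a y) \<longlongrightarrow> 0) (at 0)"
    using assms(2) by (simp add: isCont_def zero_power)
  hence "((\<lambda>y. y ^ p * a y) \<longlongrightarrow> 0) (at_right 0)"
    by (rule tendsto_mono[OF at_le[OF subset_UNIV]])
  moreover have "\<forall>\<^sub>F y in at_right 0. y ^ p * a y = G y"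
    using ev by eventually_elim simp
  ultimately show ?thesis by (rule Lim_transform_eventually)
qed

lemma eventually_deriv_at_right:
  fixes u v :: "real \<Rightarrow> real"
  assumes "\<forall>\<^sub>F y in at_right 0. u y = v y"
  shows "\<forall>\<^sub>F y in at_right 0. deriv u y = deriv v y"
proof -
  obtain d where d: "d > 0" "\<And>y. 0 < y \<Longrightarrow> y < d \<Longrightarrow> u y = v y"
    using assms unfolding eventually_at_right_field by blast
  have "deriv u y = deriv v y" if "0 < y" "y < d" for y
  proof (rule deriv_cong_ev[OF _ refl])
    have "\<forall>\<^sub>F z in nhds y. z \<in> {0<..<d}"
      using that by (intro eventually_nhds_in_open) auto
    thus "\<forall>\<^sub>F z in nhds y. u z = v z" by eventually_elim (use d in auto)
  qed
  thus ?thesis unfolding eventually_at_right_field using d(1) by blast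
qed

lemma eventually_at_right_nhds: "\<forall>\<^sub>F y in nhds (0::real). P y \<Longrightarrow> \<forall>\<^sub>F y in at_right 0. P y"
  by (simp add: eventually_at_filter eventually_mono)

text \<open>Dividing a derivative by \<open>\<Psi>'\<close>, which vanishes to order \<open>2 m - 1\<close>, lowers the order
  of vanishing by \<open>2 m\<close>.\<close>

lemma vanishing_order_right_step:
  assumes G: "vanishing_order_right G (p + 2 * m)" and m: "m > 0"
    and \<Psi>: "b real_analytic_on {0}" "b 0 \<noteq> 0" "\<And>y. \<Psi> y = y ^ (2 * m) * b y"
  shows "vanishing_order_right (\<lambda>y. deriv G y / deriv \<Psi> y) p"
proof -
  define M where "M = 2 * m"
  have M: "M > 0" using m by (simp add: M_def)
  obtain a where a: "a real_analytic_on {0}" and ev: "\<forall>\<^sub>F y in at_right 0. G y = y ^ (p + M) * a y"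
    using G unfolding vanishing_order_right_def M_def by blast
  have dpow: "deriv (\<lambda>y. y ^ N * c y) y = y ^ (N - 1) * (real N * c y + y * deriv c y)"
    if "N > 0" "c real_analytic_on {y}" for N c and y :: real
  proof -
    have "((\<lambda>y. y ^ N * c y) has_real_derivative real N * y ^ (N - 1) * c y + deriv c y * y ^ N) (at y)"
      using DERIV_mult[OF DERIV_pow[of N y] real_analytic_on_imp_DERIV[OF that(2)]] by simp
    moreover have "y ^ N = y ^ (N - 1) * y" using that(1) by (cases N) auto
    ultimately show ?thesis by (simp add: DERIV_imp_deriv algebra_simps)
  qed
  define B where "B y = real M * b y + y * deriv b y" for y
  have B: "B real_analytic_on {0}" "B 0 \<noteq> 0"
    unfolding B_def using \<Psi> M
    by (auto intro!: real_analytic_on_add real_analytic_on_mult real_analytic_on_deriv)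
  define c where "c y = (real (p + M) * a y + y * deriv a y) / B y" for y
  have c: "c real_analytic_on {0}"
    unfolding c_def[abs_def]
    by (intro real_analytic_on_divide real_analytic_on_add real_analytic_on_mult
          real_analytic_on_const real_analytic_on_ident real_analytic_on_deriv a B) (use B in auto)
  have "(B \<longlongrightarrow> B 0) (nhds 0)"
    using real_analytic_on_imp_isCont[OF B(1)] by (simp add: continuous_at tendsto_at_iff_tendsto_nhds)
  hence nzB: "\<forall>\<^sub>F y in nhds 0. B y \<noteq> 0"
    using B(2) by (rule tendsto_imp_eventually_ne)
  have "\<forall>\<^sub>F y in at_right 0. deriv G y / deriv \<Psi> y = y ^ p * c y"
    using eventually_deriv_at_right[OF ev]
      eventually_at_right_nhds[OF real_analytic_on_open_nhd[OF a]]
      eventually_at_right_nhds[OF real_analytic_on_open_nhd[OF \<Psi>(1)]]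
      eventually_at_right_nhds[OF nzB] eventually_at_right_less[of 0]
  proof eventually_elim
    case (elim y)
    have 1: "deriv G y = y ^ (p + (M - 1)) * (real (p + M) * a y + y * deriv a y)"
      unfolding elim(1) using dpow[of "p + M" a y] elim(2) M by simp
    have "\<Psi> = (\<lambda>y. y ^ M * b y)" using \<Psi>(3) by (auto simp: M_def)
    hence 2: "deriv \<Psi> y = y ^ (M - 1) * B y"
      using dpow[of M b y] elim(3) M by (simp add: B_def)
    have "y ^ (M - 1) \<noteq> 0" using elim(5) by simp
    moreover have "q * w * A / (w * D) = q * (A / D)" if "w \<noteq> 0" for q w A D :: real
      using that by simp
    ultimately show ?case unfolding 1 2 power_add c_def by blast
  qed
  thus ?thesis unfolding vanishing_order_right_def using c by blast
qed

lemma real_analytic_factor_of_expansion: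
  assumes \<Psi>: "\<Psi> real_analytic_on {0}" and exp: "(\<lambda>y. \<Psi> y - e * y ^ N) \<in> o[at 0](\<lambda>y. y ^ N)"
  obtains b where "b real_analytic_on {0}" "b 0 = e" "\<And>y. \<Psi> y = y ^ N * b y"
proof -
  have small: "\<forall>\<^sub>F y in at 0. \<bar>\<Psi> y - e * y ^ N\<bar> \<le> c * \<bar>y ^ N\<bar>" if "c > 0" for c
    using landau_o.smallD[OF exp that] by simp
  have "\<forall>\<^sub>F y in at 0. \<bar>\<Psi> y\<bar> \<le> (\<bar>e\<bar> + 1) * \<bar>y\<bar> ^ N"
    using small[of 1] unfolding power_abs[symmetric]
  proof (rule eventually_mono)
    fix y assume "\<bar>\<Psi> y - e * y ^ N\<bar> \<le> 1 * \<bar>y ^ N\<bar>"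
    moreover have "\<bar>e * y ^ N\<bar> = \<bar>e\<bar> * \<bar>y ^ N\<bar>" by (rule abs_mult)
    ultimately show "\<bar>\<Psi> y\<bar> \<le> (\<bar>e\<bar> + 1) * \<bar>y ^ N\<bar>" by (simp add: algebra_simps)
  qed simp
  then obtain b where b: "b real_analytic_on {0}" "\<And>y. \<Psi> y = y ^ N * b y"
    using real_analytic_on_factor_power[OF \<Psi>] by blast
  have "(b \<longlongrightarrow> e) (at 0)"
  proof (rule tendstoI)
    fix c :: real assume "c > 0"
    have "\<forall>\<^sub>F y in at 0. \<bar>\<Psi> y - e * y ^ N\<bar> \<le> c / 2 * \<bar>y ^ N\<bar>"
      using small[of "c / 2"] \<open>c > 0\<close> by simp
    moreover have "\<forall>\<^sub>F y in at 0. y \<noteq> (0::real)" by (rule eventually_neq_at_within)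
    ultimately show "\<forall>\<^sub>F y in at 0. dist (b y) e < c"
    proof eventually_elim
      case (elim y)
      have "\<Psi> y - e * y ^ N = (b y - e) * y ^ N" by (simp add: b(2) algebra_simps)
      hence "\<bar>b y - e\<bar> * \<bar>y ^ N\<bar> \<le> c / 2 * \<bar>y ^ N\<bar>" using elim(1) by (simp add: abs_mult)
      moreover have "\<bar>y ^ N\<bar> > 0" using elim(2) by simp
      ultimately have "\<bar>b y - e\<bar> \<le> c / 2" by (simp only: mult_le_cancel_right_pos)
      thus ?case using \<open>c > 0\<close> by (simp add: dist_real_def)
    qed
  qed
  moreover have "(b \<longlongrightarrow> b 0) (at 0)"
    using real_analytic_on_imp_isCont[OF b(1)] by (simp add: isCont_def)
  ultimately have "b 0 = e" using tendsto_unique trivial_limit_at by metis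
  thus ?thesis using that b by blast
qed

context energy_well
begin

lemma g_seq_analytic:
  assumes g: "g real_analytic_on einterval xl xr"
  shows "g_seq \<Phi> g j real_analytic_on (einterval xl xr - {0})"
proof (induction j)
  case 0
  thus ?case using real_analytic_on_subset[OF g] by auto
next
  case (Suc j)
  have "deriv \<Phi> real_analytic_on (einterval xl xr - {0})"
    using real_analytic_on_subset[OF real_analytic_on_deriv[OF analytic]] by blast
  thus ?case
    using deriv_nz by (auto intro!: real_analytic_on_divide real_analytic_on_deriv Suc)
qed

text \<open>Differentiating \<open>\<Phi> (\<sigma> y) = \<Phi> y\<close> shows that \<open>d / d\<Phi>\<close> commutes with the balance.\<close>

lemma balance_g_seq_Suc:
  assumes g: "g real_analytic_on einterval xl xr" and y: "y \<in> einterval xl xr" "y > 0"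
  shows "balance \<sigma> (g_seq \<Phi> g (Suc j)) y = deriv (balance \<sigma> (g_seq \<Phi> g j)) y / deriv \<Phi> y"
proof -
  let ?u = "g_seq \<Phi> g j"
  have sy: "\<sigma> y \<in> einterval xl xr" "\<sigma> y < 0" using \<sigma>_in[OF y(1)] \<sigma>_neg[OF y] by auto
  have d1: "(?u has_real_derivative deriv ?u y) (at y)"
    by (rule real_analytic_on_imp_DERIV[OF g_seq_analytic[OF g]]) (use y in auto)
  have d2: "(?u has_real_derivative deriv ?u (\<sigma> y)) (at (\<sigma> y))"
    by (rule real_analytic_on_imp_DERIV[OF g_seq_analytic[OF g]]) (use sy in auto)
  have "((\<lambda>y. ?u y - ?u (\<sigma> y)) has_real_derivative
      deriv ?u y - deriv ?u (\<sigma> y) * (deriv \<Phi> y / deriv \<Phi> (\<sigma> y))) (at y)"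
    by (intro DERIV_diff d1 DERIV_chain2[OF d2 DERIV_\<sigma>[OF y]])
  hence "deriv (balance \<sigma> ?u) y = deriv ?u y - deriv ?u (\<sigma> y) * (deriv \<Phi> y / deriv \<Phi> (\<sigma> y))"
    unfolding balance_def[abs_def] by (rule DERIV_imp_deriv)
  thus ?thesis
    using deriv_nz[OF y(1)] y(2) by (simp add: balance_def field_simps)
qed

text \<open>The smallness of an analytic function is improved by one order for free, since its order of
  vanishing is an integer. This extra order is what remains at \<open>j = k\<close>.\<close>

lemma vanishing_order_balance_g_seq:
  assumes g: "g real_analytic_on einterval xl xr" and e: "e > 0"
    and \<Phi>: "(\<lambda>y. \<Phi> y - e * y ^ (2 * m)) \<in> o[at 0](\<lambda>y. y ^ (2 * m))"
    and small: "balance \<sigma> g \<in> o[at 0](\<lambda>y. y ^ (2 * m * k))" and j: "j \<le> k"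
  shows "vanishing_order_right (balance \<sigma> (g_seq \<Phi> g j)) (2 * m * (k - j) + 1)"
proof -
  obtain b where b: "b real_analytic_on {0}" "b 0 = e" "\<And>y. \<Phi> y = y ^ (2 * m) * b y"
    using real_analytic_factor_of_expansion[OF real_analytic_on_subset[OF analytic] \<Phi>] zero_in by auto
  have m: "m > 0" using b(2) b(3)[of 0] e by (cases m) auto
  have "(\<lambda>x. g (\<sigma> x)) real_analytic_on {0}"
    by (rule real_analytic_on_compose[OF g real_analytic_on_subset[OF \<sigma>_analytic]]) (use zero_in in auto)
  hence "balance \<sigma> g real_analytic_on {0}"
    unfolding balance_def[abs_def] using zero_in
    by (intro real_analytic_on_diff real_analytic_on_subset[OF g]) auto
  then obtain a where a: "a real_analytic_on {0}" "a 0 = 0" "\<And>y. balance \<sigma> g y = y ^ (2 * m * k) * a y"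
    using real_analytic_factor_of_expansion[of "balance \<sigma> g" 0 "2 * m * k"] small by auto
  obtain a1 where a1: "a1 real_analytic_on {0}" "\<And>y. a y = y * a1 y"
    using real_analytic_on_divide_by_id[OF a(1,2)] by blast
  have base: "vanishing_order_right (balance \<sigma> g) (2 * m * k + 1)"
    unfolding vanishing_order_right_def using a(3) a1 by (intro exI[of _ a1]) simp
  show ?thesis
    using j
  proof (induction j)
    case 0
    thus ?case using base by simp
  next
    case (Suc j)
    have "2 * m * (k - j) + 1 = (2 * m * (k - Suc j) + 1) + 2 * m"
      using Suc.prems by (simp add: Suc_diff_Suc[symmetric] algebra_simps)
    moreover have "vanishing_order_right (balance \<sigma> (g_seq \<Phi> g j)) (2 * m * (k - j) + 1)"
      using Suc by simp
    ultimately have "vanishing_order_right (balance \<sigma> (g_seq \<Phi> g j)) ((2 * m * (k - Suc j) + 1) + 2 * m)"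
      by (simp only:)
    moreover have "b 0 \<noteq> 0" using b(2) e by simp
    ultimately have "vanishing_order_right (\<lambda>y. deriv (balance \<sigma> (g_seq \<Phi> g j)) y / deriv \<Phi> y) (2 * m * (k - Suc j) + 1)"
      by (rule vanishing_order_right_step[OF _ m b(1) _ b(3)])
    then obtain a where a: "a real_analytic_on {0}"
      "\<forall>\<^sub>F y in at_right 0. deriv (balance \<sigma> (g_seq \<Phi> g j)) y / deriv \<Phi> y = y ^ (2 * m * (k - Suc j) + 1) * a y"
      unfolding vanishing_order_right_def by blast
    have "\<forall>\<^sub>F y in nhds 0. y \<in> einterval xl xr"
      using zero_in by (intro eventually_nhds_in_open) auto
    from eventually_at_right_nhds[OF this] a(2) eventually_at_right_less[of 0]
    have "\<forall>\<^sub>F y in at_right 0. balance \<sigma> (g_seq \<Phi> g (Suc j)) y = y ^ (2 * m * (k - Suc j) + 1) * a y"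
    proof eventually_elim
      case (elim y)
      thus ?case using balance_g_seq_Suc[OF g elim(1,3), of j] by simp
    qed
    thus ?case unfolding vanishing_order_right_def using a(1) by blast
  qed
qed

lemma branch_tendsto_at_right_0:
  "filterlim branch (at_right 0) (at 0 within einterval 0 R)"
proof -
  have "(branch \<longlongrightarrow> 0) (at 0)"
    using isCont_branch[of 0] by (simp add: isCont_def)
  hence "(branch \<longlongrightarrow> 0) (at 0 within einterval 0 R)"
    by (rule tendsto_mono[OF at_le[OF subset_UNIV]])
  moreover have "\<forall>\<^sub>F t in at 0 within einterval 0 R. branch t \<in> {0<..} \<and> branch t \<noteq> 0"
    unfolding eventually_at_filter using branch_pos by (intro always_eventually) force
  ultimately show ?thesis by (simp add: filterlim_at)
qed

text \<open>In the variable \<open>y\<close> the kernel is the integrand \<open>balance \<sigma> g\<close> times \<open>\<Phi>'\<close>, which is regular at \<open>0\<close>.\<close>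

lemma balance_primitive_pair_0:
  assumes g: "g real_analytic_on einterval xl xr"
    and M: "\<And>t. t \<in> einterval 0 R \<Longrightarrow> M t = balance \<sigma> g (branch t)"
  obtains L where "primitive_pair R M L"
proof -
  have an': "balance \<sigma> g real_analytic_on einterval xl xr"
    unfolding balance_def[abs_def]
    by (intro real_analytic_on_diff g real_analytic_on_compose[OF g \<sigma>_analytic]) (use \<sigma>_in in auto)
  define k where "k y = balance \<sigma> g y * deriv \<Phi> y" for y
  have contk: "continuous_on (einterval xl xr) k"
    unfolding k_def
    by (intro continuous_on_mult real_analytic_on_imp_continuous_on an' real_analytic_on_deriv analytic)
  obtain A where DA: "\<And>x. x \<in> einterval xl xr \<Longrightarrow> (A has_real_derivative k x) (at x)"
    using einterval_primitive[OF contk] by metis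
  have "primitive_pair R M (\<lambda>t. A (branch t) - A 0)"
  proof
    show "M real_analytic_on einterval 0 R"
    proof (rule real_analytic_on_cong[OF _ open_einterval])
      show "(\<lambda>t. balance \<sigma> g (branch t)) real_analytic_on einterval 0 R"
        by (rule real_analytic_on_compose[OF an' branch_analytic]) (use branch_in in blast)
    qed (simp add: M)
    show "continuous_on (insert 0 (einterval 0 R)) (\<lambda>t. A (branch t) - A 0)"
      using zero_in branch_in DA
      by (intro continuous_at_imp_continuous_on ballI continuous_diff continuous_const
           isCont_o2[OF isCont_branch] DERIV_isCont[OF DA]) auto
    fix t assume t: "t \<in> einterval 0 R"
    have "((\<lambda>t. A (branch t) - A 0) has_real_derivative k (branch t) * (1 / deriv \<Phi> (branch t)) - 0) (at t)"
      by (intro DERIV_diff DERIV_const DERIV_chain2[OF DA DERIV_branch[OF t]] branch_in t)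
    thus "((\<lambda>t. A (branch t) - A 0) has_real_derivative M t) (at t)"
      using deriv_nz[OF branch_in[OF t]] branch_pos[OF t] M[OF t] by (simp add: k_def)
  qed simp
  thus ?thesis using that by blast
qed

text \<open>In the energy variable, each balance of the \<open>g_seq\<close> is a primitive of the next one. It extends
  continuously by \<open>0\<close> to the bottom of the well when it vanishes there to positive order.\<close>

lemma balance_primitive_pair_Suc:
  assumes g: "g real_analytic_on einterval xl xr"
    and an: "balance \<sigma> (g_seq \<Phi> g j) real_analytic_on einterval 0 xr"
       "balance \<sigma> (g_seq \<Phi> g (Suc j)) real_analytic_on einterval 0 xr"
    and ord: "vanishing_order_right (balance \<sigma> (g_seq \<Phi> g j)) p" "p > 0"
  shows "primitive_pair R (\<lambda>t. if t = 0 then 0 else balance \<sigma> (g_seq \<Phi> g (Suc j)) (branch t))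
     (\<lambda>t. if t = 0 then 0 else balance \<sigma> (g_seq \<Phi> g j) (branch t))"
proof
  let ?G = "\<lambda>j t. balance \<sigma> (g_seq \<Phi> g j) (branch t)"
  have nz: "t \<noteq> 0" if "t \<in> einterval 0 R" for t using that by (auto simp: einterval_iff)
  have an_G: "?G i real_analytic_on einterval 0 R"
    if "balance \<sigma> (g_seq \<Phi> g i) real_analytic_on einterval 0 xr" for i
    by (rule real_analytic_on_compose[OF that branch_analytic]) (use branch_right in blast)
  show "(\<lambda>t. if t = 0 then 0 else ?G (Suc j) t) real_analytic_on einterval 0 R"
    by (rule real_analytic_on_cong[OF an_G[OF an(2)] open_einterval]) (use nz in auto)
  show "continuous_on (insert 0 (einterval 0 R)) (\<lambda>t. if t = 0 then 0 else ?G j t)" (is "continuous_on ?T ?M")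
    unfolding continuous_on_eq_continuous_within
  proof
    fix t assume t: "t \<in> ?T"
    show "continuous (at t within ?T) ?M"
    proof (cases "t = 0")
      case True
      have "((\<lambda>t. ?G j t) \<longlongrightarrow> 0) (at 0 within einterval 0 R)"
        by (rule filterlim_compose[OF vanishing_order_right_tendsto[OF ord] branch_tendsto_at_right_0])
      moreover have "\<forall>\<^sub>F t in at 0 within einterval 0 R. ?G j t = ?M t"
        unfolding eventually_at_filter by (intro always_eventually) auto
      ultimately have "(?M \<longlongrightarrow> 0) (at 0 within einterval 0 R)"
        by (rule Lim_transform_eventually)
      moreover have "at 0 within ?T = at 0 within einterval 0 R"
        by (rule at_within_nhd[of _ UNIV]) auto
      ultimately show ?thesis using True by (simp add: continuous_within)
    next
      case False
      hence tI: "t \<in> einterval 0 R" using t by simp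
      have "?M real_analytic_on einterval 0 R"
        by (rule real_analytic_on_cong[OF an_G[OF an(1)] open_einterval]) (use nz in auto)
      from real_analytic_on_imp_isCont[OF this tI] show ?thesis
        by (rule continuous_at_imp_continuous_at_within)
    qed
  qed
  fix t assume t: "t \<in> einterval 0 R"
  have bt: "branch t \<in> einterval 0 xr" by (rule branch_right[OF t])
  have "(?G j has_real_derivative
      deriv (balance \<sigma> (g_seq \<Phi> g j)) (branch t) * (1 / deriv \<Phi> (branch t))) (at t)"
    by (rule DERIV_chain2[OF real_analytic_on_imp_DERIV[OF an(1) bt] DERIV_branch[OF t]])
  hence "(?G j has_real_derivative ?G (Suc j) t) (at t)"
    using balance_g_seq_Suc[OF g branch_in[OF t] branch_pos[OF t], of j] by simp
  moreover have ev: "\<forall>\<^sub>F s in nhds t. ?G j s = (if s = 0 then 0 else ?G j s)"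
    by (rule eventually_mono[OF eventually_nhds_in_open[OF open_einterval t]]) (use nz in auto)
  ultimately show "((\<lambda>t. if t = 0 then 0 else ?G j t) has_real_derivative
      (if t = 0 then 0 else ?G (Suc j) t)) (at t)"
    using DERIV_cong_ev[OF refl ev refl] nz[OF t] by simp
qed simp

end

section \<open>The Chebyshev hypotheses as Haar conditions\<close>

text \<open>A combination that does not vanish identically has isolated zeros only, by analyticity.\<close>

lemma T_system_imp_haar_system:
  assumes "T_system k v L" "open L" "connected L"
  shows "haar_system k v L"
  unfolding haar_system_def
proof (intro allI impI)
  fix \<alpha> :: "nat \<Rightarrow> real" assume \<alpha>: "\<exists>i<k. \<alpha> i \<noteq> 0"
  have "lincomb k \<alpha> v real_analytic_on L"
    using assms(1) by (intro real_analytic_on_lincomb) (auto simp: T_system_def)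
  moreover have T: "\<exists>x\<in>L. lincomb k \<alpha> v x \<noteq> 0" "finite (isolated_zeros (lincomb k \<alpha> v) L)"
      "card (isolated_zeros (lincomb k \<alpha> v) L) \<le> k - 1"
    using assms(1) \<alpha> by (auto simp: T_system_def)
  ultimately have "isolated_zeros (lincomb k \<alpha> v) L = {x\<in>L. lincomb k \<alpha> v x = 0}"
    by (intro isolated_zeros_real_analytic assms)
  moreover have "k > 0" using \<alpha> by auto
  ultimately show "finite {x\<in>L. lincomb k \<alpha> v x = 0} \<and> card {x\<in>L. lincomb k \<alpha> v x = 0} < k"
    using T by simp
qed

lemma CT_systemD:
  assumes "CT_system n v L"
  shows "k \<in> {1..n} \<Longrightarrow> T_system k v L" and "i < n \<Longrightarrow> v i real_analytic_on L"
proof -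
  show T: "T_system k v L" if "k \<in> {1..n}" for k
    using assms that by (simp add: CT_system_def)
  thus "v i real_analytic_on L" if "i < n" for i
    using T[of "Suc i"] that by (auto simp: T_system_def)
qed

section \<open>Ovals around the origin\<close>

text \<open>A ray that avoids \<open>S\<close> would be an unbounded connected set in the complement of \<open>S\<close>.\<close>

lemma inside_meets_ray:
  fixes S :: "complex set"
  assumes "0 \<in> inside S" "cmod v = 1"
  shows "\<exists>r>0. of_real r * v \<in> S"
proof (rule ccontr)
  assume no: "\<not> ?thesis"
  have 0: "0 \<notin> S" and bd: "bounded (connected_component_set (- S) 0)"
    using assms(1) by (auto simp: inside_def)
  define T where "T = (\<lambda>r. of_real r * v) ` {0::real..}"
  have "T \<subseteq> - S"
  proof
    fix z assume "z \<in> T"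
    then obtain r where "r \<ge> 0" "z = of_real r * v" by (auto simp: T_def)
    thus "z \<in> - S" using no 0 by (cases "r = 0") auto
  qed
  moreover have "connected T"
    unfolding T_def by (intro connected_continuous_image continuous_intros) auto
  moreover have "0 \<in> T" unfolding T_def by (rule image_eqI[of _ _ 0]) auto
  ultimately have "T \<subseteq> connected_component_set (- S) 0"
    by (intro connected_component_maximal)
  then obtain B where B: "\<And>z. z \<in> T \<Longrightarrow> cmod z \<le> B"
    using bounded_subset[OF bd] unfolding bounded_iff by blast
  have "of_real (\<bar>B\<bar> + 1) * v \<in> T" unfolding T_def by (intro imageI) auto
  from B[OF this] show False using assms(2) by (simp add: norm_mult)
qed

lemma projection_contains_0:
  assumes "open (insert 0 P)"
  shows "0 \<in> Re ` (P :: complex set)" "0 \<in> Im ` P"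
proof -
  obtain d where d: "d > 0" "ball 0 d \<subseteq> insert 0 P"
    using assms open_contains_ball by blast
  have "of_real (d / 2) \<in> ball (0::complex) d" "\<i> * of_real (d / 2) \<in> ball (0::complex) d"
    using d(1) by (simp_all add: norm_mult norm_divide)
  hence "of_real (d / 2) \<in> insert 0 P" "\<i> * of_real (d / 2) \<in> insert 0 P"
    using d(2) by blast+
  hence "of_real (d / 2) \<in> P" "\<i> * of_real (d / 2) \<in> P" using d(1) by (auto simp: complex_eq_iff)
  thus "0 \<in> Re ` P" "0 \<in> Im ` P" by (force intro: rev_image_eqI)+
qed

text \<open>The oval of each energy has a vertex on the half axis, where all the energy is carried by \<open>\<Phi>\<close>;
  conversely, at any point of an oval \<open>\<Phi>\<close> carries at most the whole energy.\<close>

lemma (in potential_well) image_eq_energies: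
  fixes u w :: "complex \<Rightarrow> real"
  assumes \<Psi>: "potential_well \<Psi> yl yr" and proj: "u ` P = einterval xl xr"
    and P: "P = (\<Union>h\<in>einterval 0 R. C h)"
    and level: "\<And>h z. h \<in> einterval 0 R \<Longrightarrow> z \<in> C h \<Longrightarrow>
       u z \<in> einterval xl xr \<and> w z \<in> einterval yl yr \<and> \<Phi> (u z) + \<Psi> (w z) = h"
    and vertex: "\<And>h. h \<in> einterval 0 R \<Longrightarrow> \<exists>z\<in>C h. 0 < u z \<and> w z = 0"
  shows "\<Phi> ` einterval 0 xr = einterval 0 R"
proof (intro equalityI subsetI)
  fix v assume "v \<in> \<Phi> ` einterval 0 xr"
  then obtain x where x: "x \<in> einterval xl xr" "0 < x" "v = \<Phi> x" unfolding right_half by blast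
  then obtain z where z: "z \<in> P" "u z = x" using proj by (metis imageE)
  then obtain h where h: "h \<in> einterval 0 R" "z \<in> C h" using P by blast
  have "0 < v" "v \<le> h"
    using level[OF h] pos[of x] potential_well.nonneg[OF \<Psi>, of "w z"] x z(2) by auto
  thus "v \<in> einterval 0 R"
    using einterval_0_Icc_subset[OF h(1), of v v] by auto
next
  fix h assume h: "h \<in> einterval 0 R"
  then obtain z where z: "z \<in> C h" "0 < u z" "w z = 0" using vertex by blast
  have "u z \<in> einterval 0 xr" "\<Phi> (u z) = h"
    using level[OF h z(1)] z potential_well.\<Phi>_0[OF \<Psi>] unfolding right_half by auto
  thus "h \<in> \<Phi> ` einterval 0 xr" by blast
qed

section \<open>The Chebyshev criterion\<close>

theorem theorem1:
  fixes \<Phi> \<Psi> g \<sigma>1 \<sigma>2 :: "real \<Rightarrow> real"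
    and f :: "nat \<Rightarrow> real \<Rightarrow> real"
    and \<gamma> :: "real \<Rightarrow> real \<Rightarrow> complex"
    and P :: "complex set"
    and xl xr yl yr h0 :: ereal
    and e :: real
    and m n :: nat
  assumes h0: "0 < h0"
    and annulus: "period_annulus (\<lambda>z. \<Phi> (Re z) + \<Psi> (Im z)) h0 \<gamma> P"
    and proj_x: "Re ` P = einterval xl xr"
    and proj_y: "Im ` P = einterval yl yr"
    and \<Phi>_analytic: "\<Phi> real_analytic_on einterval xl xr"
    and \<Psi>_analytic: "\<Psi> real_analytic_on einterval yl yr"
    and \<Phi>_0: "\<Phi> 0 = 0"
    and \<Psi>_0: "\<Psi> 0 = 0"
    and \<Phi>_deriv: "\<And>x. x \<in> einterval xl xr - {0} \<Longrightarrow> x * deriv \<Phi> x > 0"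
    and \<Psi>_deriv: "\<And>y. y \<in> einterval yl yr - {0} \<Longrightarrow> y * deriv \<Psi> y > 0"
    and e: "e > 0"
    and \<Psi>_expansion: "(\<lambda>y. \<Psi> y - e * y ^ (2 * m)) \<in> o[at 0](\<lambda>y. y ^ (2 * m))"
    and f_analytic: "\<And>i. i < n \<Longrightarrow> f i real_analytic_on einterval xl xr"
    and g_analytic: "g real_analytic_on einterval yl yr"
    and \<sigma>1: "associated_involution \<Phi> (einterval xl xr) \<sigma>1"
    and \<sigma>2: "associated_involution \<Psi> (einterval yl yr) \<sigma>2"
    and hyp_a: "CT_system n (\<lambda>i. balance \<sigma>1 (\<lambda>x. f i x / deriv \<Phi> x)) (einterval 0 xr)"
    and hyp_b: "CT_system n (\<lambda>i. balance \<sigma>2 (g_seq \<Psi> g i)) (einterval 0 yr)"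
    and hyp_b_order:
      "balance \<sigma>2 (g_seq \<Psi> g 0) \<in> o[at 0](\<lambda>y. y powi (2 * int m * (int n - 2)))"
  shows "ECT_system n (\<lambda>i. abelian_integral \<gamma> (f i) g) (einterval 0 h0)"
proof -
  let ?I = "einterval 0 h0"
  have P: "open (insert 0 P)" "P = (\<Union>h\<in>?I. path_image (\<gamma> h))"
    and ovals: "\<And>h. h \<in> ?I \<Longrightarrow> oval (\<lambda>z. \<Phi> (Re z) + \<Psi> (Im z)) h (\<gamma> h)"
    using annulus by (auto simp: period_annulus_def)
  obtain s :: real where s: "s \<noteq> 0" "\<And>h. h \<in> ?I \<Longrightarrow> winding_number (\<gamma> h) 0 = of_real s"
  proof -
    have "(\<forall>h\<in>?I. winding_number (\<gamma> h) 0 = 1) \<or> (\<forall>h\<in>?I. winding_number (\<gamma> h) 0 = - 1)"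
      using annulus by (auto simp: period_annulus_def)
    thus ?thesis using that[of 1] that[of "-1"] by auto
  qed
  have level: "Re z \<in> einterval xl xr \<and> Im z \<in> einterval yl yr \<and> \<Phi> (Re z) + \<Psi> (Im z) = h"
    if "h \<in> ?I" "z \<in> path_image (\<gamma> h)" for h z
  proof -
    have "z \<in> P" using P(2) that by blast
    hence "Re z \<in> Re ` P" "Im z \<in> Im ` P" by blast+
    moreover have "\<Phi> (Re z) + \<Psi> (Im z) = h" using ovals[OF that(1)] that(2) by (auto simp: oval_def)
    ultimately show ?thesis using proj_x proj_y by simp
  qed
  have ray: "\<exists>r>0. of_real r * v \<in> path_image (\<gamma> h)" if "h \<in> ?I" "cmod v = 1" for h v
    using ovals[OF that(1)] that(2) by (intro inside_meets_ray) (auto simp: oval_def)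
  interpret wX: potential_well \<Phi> xl xr
    using projection_contains_0(1)[OF P(1)] proj_x \<Phi>_analytic \<Phi>_0 \<Phi>_deriv by unfold_locales auto
  interpret wY: potential_well \<Psi> yl yr
    using projection_contains_0(2)[OF P(1)] proj_y \<Psi>_analytic \<Psi>_0 \<Psi>_deriv by unfold_locales auto
  have imageX: "\<Phi> ` einterval 0 xr = ?I"
  proof (rule wX.image_eq_energies[OF wY.potential_well_axioms proj_x P(2) level])
    show "\<exists>z\<in>path_image (\<gamma> h). 0 < Re z \<and> Im z = 0" if "h \<in> ?I" for h
      using ray[OF that, of 1] by force
  qed
  have imageY: "\<Psi> ` einterval 0 yr = ?I"
  proof (rule wY.image_eq_energies[OF wX.potential_well_axioms proj_y P(2)])
    show "\<exists>z\<in>path_image (\<gamma> h). 0 < Im z \<and> Re z = 0" if "h \<in> ?I" for h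
      using ray[OF that, of \<i>] by force
  qed (use level in \<open>auto simp: add.commute\<close>)
  interpret separable_hamiltonian \<Phi> xl xr \<sigma>1 h0 \<Psi> yl yr \<sigma>2
    by unfold_locales (use imageX imageY \<sigma>1 \<sigma>2 in auto)
  note Ta = CT_systemD[OF hyp_a] and Tb = CT_systemD[OF hyp_b]
  \<comment> \<open>The orientation \<open>s\<close> is absorbed into the first factor, so that the Abelian integrals are exactly
    the convolutions. The value of \<open>K j\<close> at \<open>0\<close> is its limit there for \<open>j < n - 1\<close>.\<close>
  define F where "F i t = balance \<sigma>1 (\<lambda>x. (- s * f i x) / deriv \<Phi> x) (X.branch t)" for i t
  define K where "K j t = (if t = 0 then 0 else balance \<sigma>2 (g_seq \<Psi> g j) (Y.branch t))" for j t
  have scale: "balance \<sigma>1 (\<lambda>x. (- s * f i x) / deriv \<Phi> x) x =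
      - s * balance \<sigma>1 (\<lambda>x. f i x / deriv \<Phi> x) x" for i x
    by (simp add: balance_def algebra_simps)
  have nz: "t \<noteq> 0" if "t \<in> ?I" for t using that by (auto simp: einterval_iff)
  have "\<exists>F1. primitive_pair h0 (F i) F1" if i: "i < n" for i
  proof -
    have "continuous_on (einterval xl xr) (\<lambda>x. - s * f i x)"
      by (intro continuous_intros real_analytic_on_imp_continuous_on[OF f_analytic[OF i]])
    moreover have "balance \<sigma>1 (\<lambda>x. (- s * f i x) / deriv \<Phi> x) real_analytic_on einterval 0 xr"
      using real_analytic_on_mult[OF real_analytic_on_const Ta(2)[OF i], of "- s"]
      unfolding scale[abs_def] by simp
    ultimately show ?thesis
      using X.fold_primitive_pair unfolding F_def[abs_def] by metis
  qed
  then obtain F1 where F1: "\<And>i. i < n \<Longrightarrow> primitive_pair h0 (F i) (F1 i)" by metis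
  obtain K1 where K1: "primitive_pair h0 (K 0) K1"
    by (rule Y.balance_primitive_pair_0[OF g_analytic, of "K 0"]) (use nz in \<open>auto simp: K_def\<close>)
  define L where "L = case_nat K1 K"
  have L: "primitive_pair h0 (L (Suc j)) (L j)" if j: "j < n" for j
  proof (cases j)
    case 0
    thus ?thesis using K1 by (simp add: L_def)
  next
    case (Suc i)
    have n2: "2 \<le> n" "i \<le> n - 2" using j Suc by auto
    have "2 * int m * (int n - 2) = int (2 * m * (n - 2))" using n2(1) by (simp add: of_nat_diff)
    hence "balance \<sigma>2 g \<in> o[at 0](\<lambda>y. y ^ (2 * m * (n - 2)))"
      using hyp_b_order by (simp only: g_seq.simps(1) power_int_of_nat)
    note ord = Y.vanishing_order_balance_g_seq[OF g_analytic e \<Psi>_expansion this n2(2)]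
    have "primitive_pair h0 (K (Suc i)) (K i)"
      unfolding K_def[abs_def]
      by (rule Y.balance_primitive_pair_Suc[OF g_analytic Tb(2) Tb(2) ord]) (use j Suc in auto)
    thus ?thesis by (simp add: L_def Suc)
  qed
  show ?thesis
  proof (rule ECT_system_convolution[where F = F and ?F1.0 = F1 and L = L, OF h0])
    show "primitive_pair h0 (F i) (F1 i)" if "i < n" for i by (rule F1[OF that])
    show "primitive_pair h0 (L (Suc j)) (L j)" if "j < n" for j by (rule L[OF that])
    show "haar_system k F ?I" if "k \<in> {1..n}" for k
    proof (rule haar_system_reparam[where c = "- s"])
      show "haar_system k (\<lambda>i. balance \<sigma>1 (\<lambda>x. f i x / deriv \<Phi> x)) (einterval 0 xr)"
        by (rule T_system_imp_haar_system[OF Ta(1)[OF that] open_einterval connected_einterval])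
      show "F i t = - s * balance \<sigma>1 (\<lambda>x. f i x / deriv \<Phi> x) (X.branch t)" for i t
        unfolding F_def scale ..
    qed (use X.branch_inj X.branch_right s(1) in auto)
    show "haar_system k (\<lambda>j. L (Suc j)) ?I" if "k \<in> {1..n}" for k
    proof (rule haar_system_reparam[where c = 1])
      show "haar_system k (\<lambda>i. balance \<sigma>2 (g_seq \<Psi> g i)) (einterval 0 yr)"
        by (rule T_system_imp_haar_system[OF Tb(1)[OF that] open_einterval connected_einterval])
    qed (use Y.branch_inj Y.branch_right nz in \<open>auto simp: L_def K_def\<close>)
    show "abelian_integral \<gamma> (f i) g h = convolution (F i) (L 1) h" if i: "i < n" and h: "h \<in> ?I" for i h
      unfolding abelian_integral_def F_def[abs_def]
    proof (rule oval_integral_eq_convolution[OF h])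
      show "valid_path (\<gamma> h)" "simple_path (\<gamma> h)" "pathfinish (\<gamma> h) = pathstart (\<gamma> h)"
        using ovals[OF h] by (auto simp: oval_def)
      show "L 1 t = balance \<sigma>2 g (Y.branch t)" if "t \<in> ?I" for t
        using nz[OF that] by (simp add: L_def K_def)
    qed (use level[OF h] s(2)[OF h] f_analytic[OF i] g_analytic in
          \<open>auto intro: real_analytic_on_imp_continuous_on\<close>)
  qed
qed

end
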